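(* Let $(X_n)_{n\ge1}$, $\mu_X$, $a$, $b$, $\nu$, $r$, $\theta_1\le\cdots\le\theta_r$, $r_0$, $(u_i^n)$, $\widetilde X_n$, $\widetilde\lambda^n_1\le\cdots\le\widetilde\lambda^n_n$ and $\rho_\theta$ be as in the context (either the i.i.d. model or the orthonormalised model), and assume Hypothesis (H1) on $X_n$ and Assumption (A1) on $\nu$. Then for all $i\in\{1,\ldots,r_0\}$, $\widetilde\lambda_i^n\to\rho_{\theta_i}$ almost surely, and for all $i\in\{r_0+1,\ldots,r\}$, $\widetilde\lambda^n_{n-r+i}\to\rho_{\theta_i}$ almost surely. Moreover, for every fixed integer $i>r_0$ (independent of $n$), $\widetilde\lambda_i^n\to a$ almost surely, and for every fixed integer $i\ge r-r_0$ (independent of $n$), $\widetilde\lambda^n_{n-i}\to b$ almost surely.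
   Context: For each $n\ge1$, $X_n$ is a deterministic $n\times n$ Hermitian (or real symmetric) matrix with eigenvalues $\lambda_1^n\le\cdots\le\lambda_n^n$ and spectral measure $\mu_n=\frac1n\sum_{l=1}^n\delta_{\lambda_l^n}$. Hypothesis (H1): $\mu_n$ converges weakly to a deterministic compactly supported probability measure $\mu_X$, and $\lambda_1^n\to a$, $\lambda_n^n\to b$, where $a$ and $b$ are the lower and upper bounds of the support of $\mu_X$. Assumption (A1): $\nu$ is a probability measure on $\mathbb R$ or on $\mathbb C$ which satisfies a logarithmic Sobolev inequality (there is $c>0$ such that $\int f^2\log\frac{f^2}{\int f^2d\nu}d\nu\le 2c\int|f'|^2d\nu$ for all differentiable $f\in L^2(\nu)$), is centred and has variance one; if $\nu$ is not supported on $\mathbb R$, its real and imaginary parts are independent and identically distributed. Fix an integer $r\ge1$ and nonzero real numbers $\theta_1\le\cdots\le\theta_r$ independent of $n$, and let $r_0\in\{0,\ldots,r\}$ be such that $\theta_1\le\cdots\le\theta_{r_0}<0<\theta_{r_0+1}\le\cdots\le\theta_r$. Let $v^n=\frac{1}{\sqrt n}(x_1,\ldots,x_n)^T$ with $x_1,\ldots,x_n$ i.i.d. with law $\nu$. In the i.i.d. model, $u_1^n,\ldots,u_r^n$ are independent copies of $v^n$; in the orthonormalised model, $(u_i^n)_{1\le i\le r}$ is obtained by Gram–Schmidt orthonormalisation of $r$ independent copies of $v^n$ (one restricts to the event, of overwhelming probability, on which this is well defined). Set $\widetilde X_n=X_n+\sum_{i=1}^r\theta_iu_i^nu_i^{n*}$,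 with eigenvalues $\widetilde\lambda_1^n\le\cdots\le\widetilde\lambda_n^n$. For $z\notin[a,b]$, $G_{\mu_X}(z)=\int\frac{d\mu_X(x)}{z-x}$. Set $\overline\theta=1/\lim_{z\downarrow b}G_{\mu_X}(z)\ge0$ and $\underline\theta=1/\lim_{z\uparrow a}G_{\mu_X}(z)\le0$ (with $1/\pm\infty=0$), and for $\theta\ne0$: $\rho_\theta=G_{\mu_X}^{-1}(1/\theta)$ if $\theta\in(-\infty,\underline\theta)\cup(\overline\theta,+\infty)$, $\rho_\theta=a$ if $\theta\in[\underline\theta,0)$, $\rho_\theta=b$ if $\theta\in(0,\overline\theta]$. *)

theory Defs
  imports "HOL-Probability.Probability" "Jordan_Normal_Form.Char_Poly"
    "HOL-Computational_Algebra.Fundamental_Theorem_Algebra"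
begin

definition hermitian_mat :: "complex mat \<Rightarrow> bool" where
  "hermitian_mat A \<longleftrightarrow> dim_row A = dim_col A \<and>
     (\<forall>i < dim_row A. \<forall>j < dim_row A. A $$ (i, j) = cnj (A $$ (j, i)))"

text \<open>Eigenvalues (with multiplicity) as the roots of the characteristic
  polynomial, listed in nondecreasing order (real parts: they are real for
  Hermitian matrices).\<close>
definition eigs_sorted :: "complex mat \<Rightarrow> real list" where
  "eigs_sorted A = sorted_list_of_multiset (image_mset Re (proots (char_poly A)))"

definition eig :: "complex mat \<Rightarrow> nat \<Rightarrow> real" where
  "eig A k = eigs_sorted A ! (k - 1)"

definition spectral_measure :: "complex mat \<Rightarrow> real measure" where
  "spectral_measure A =
     distr (measure_pmf (pmf_of_multiset (mset (eigs_sorted A)))) borel (\<lambda>x. x)"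

definition msupport :: "real measure \<Rightarrow> real set" where
  "msupport \<mu> = {x. \<forall>e>0. emeasure \<mu> (ball x e) > 0}"

definition stieltjes :: "real measure \<Rightarrow> real \<Rightarrow> real" where
  "stieltjes \<mu> z = (\<integral>x. 1 / (z - x) \<partial>\<mu>)"

definition theta_up :: "real measure \<Rightarrow> real" where
  "theta_up \<mu> =
     (let b = Sup (msupport \<mu>);
          L = Lim (at_right b) (\<lambda>z. ereal (stieltjes \<mu> z))
      in if L = \<infinity> then 0 else 1 / real_of_ereal L)"

definition theta_low :: "real measure \<Rightarrow> real" where
  "theta_low \<mu> =
     (let a = Inf (msupport \<mu>);
          L = Lim (at_left a) (\<lambda>z. ereal (stieltjes \<mu> z))
      in if L = -\<infinity> then 0 else 1 / real_of_ereal L)"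

definition rho :: "real measure \<Rightarrow> real \<Rightarrow> real" where
  "rho \<mu> \<theta> =
     (let a = Inf (msupport \<mu>); b = Sup (msupport \<mu>) in
      if \<theta> > theta_up \<mu> then (THE z. z > b \<and> stieltjes \<mu> z = 1 / \<theta>)
      else if \<theta> < theta_low \<mu> then (THE z. z < a \<and> stieltjes \<mu> z = 1 / \<theta>)
      else if \<theta> < 0 then a else b)"

text \<open>Logarithmic Sobolev inequality for a probability measure on C
  (identified with R^2; for a measure supported on R this is equivalent to the
  one-dimensional inequality).  For differentiable f : C -> R with derivative
  f' z at z, |f'(z)|^2 = (f' z 1)^2 + (f' z i)^2 is the squared gradient norm.
  When the right-hand side is infinite the inequality is trivial.\<close>
definition log_sobolev :: "complex measure \<Rightarrow> real \<Rightarrow> bool" where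
  "log_sobolev \<nu> c \<longleftrightarrow>
     (\<forall>(f :: complex \<Rightarrow> real) f'.
        (\<forall>z. (f has_derivative f' z) (at z)) \<longrightarrow>
        integrable \<nu> (\<lambda>z. (f z)\<^sup>2) \<longrightarrow>
        (\<integral>\<^sup>+ z. ennreal ((f' z 1)\<^sup>2 + (f' z \<i>)\<^sup>2) \<partial>\<nu>) < \<infinity> \<longrightarrow>
        (let m = (\<integral>z. (f z)\<^sup>2 \<partial>\<nu>) in
          integrable \<nu> (\<lambda>z. (f z)\<^sup>2 * ln ((f z)\<^sup>2 / m)) \<and>
          (\<integral>z. (f z)\<^sup>2 * ln ((f z)\<^sup>2 / m) \<partial>\<nu>)
            \<le> 2 * c * (\<integral>z. (f' z 1)\<^sup>2 + (f' z \<i>)\<^sup>2 \<partial>\<nu>)))"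

definition assumption_A1 :: "complex measure \<Rightarrow> bool" where
  "assumption_A1 \<nu> \<longleftrightarrow>
     prob_space \<nu> \<and> sets \<nu> = sets borel \<and>
     (\<exists>c>0. log_sobolev \<nu> c) \<and>
     integrable \<nu> (\<lambda>z. z) \<and> (\<integral>z. z \<partial>\<nu>) = 0 \<and>
     integrable \<nu> (\<lambda>z. (cmod z)\<^sup>2) \<and> (\<integral>z. (cmod z)\<^sup>2 \<partial>\<nu>) = 1 \<and>
     (emeasure \<nu> (range complex_of_real) \<noteq> 1 \<longrightarrow>
        distr \<nu> borel Re = distr \<nu> borel Im \<and>
        prob_space.indep_var \<nu> borel Re borel Im)"

definition hypothesis_H1 :: "(nat \<Rightarrow> complex mat) \<Rightarrow> real measure \<Rightarrow> bool" where
  "hypothesis_H1 X \<mu> \<longleftrightarrow>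
     real_distribution \<mu> \<and> compact (msupport \<mu>) \<and>
     weak_conv_m (\<lambda>n. spectral_measure (X n)) \<mu> \<and>
     (\<lambda>n. eig (X n) 1) \<longlonglongrightarrow> Inf (msupport \<mu>) \<and>
     (\<lambda>n. eig (X n) n) \<longlonglongrightarrow> Sup (msupport \<mu>)"

definition cinner_vec :: "complex vec \<Rightarrow> complex vec \<Rightarrow> complex" where
  "cinner_vec v w = (\<Sum>k<dim_vec v. v $ k * cnj (w $ k))"

definition vnorm :: "complex vec \<Rightarrow> real" where
  "vnorm v = sqrt (\<Sum>k<dim_vec v. (cmod (v $ k))\<^sup>2)"

text \<open>Gram--Schmidt orthonormalisation.  \<open>gs_step ws v\<close> appends to the
  already orthonormalised list ws the vector w / |w| where
  w = v - sum_{q in ws} <v, q> q.  (Outside the event where this is well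
  defined, i.e. some w = 0, division by 0 yields the zero vector.)\<close>
definition gs_next :: "complex vec list \<Rightarrow> complex vec \<Rightarrow> complex vec" where
  "gs_next ws v =
     (let w = vec (dim_vec v) (\<lambda>l. v $ l - (\<Sum>q\<leftarrow>ws. cinner_vec v q * q $ l))
      in vec (dim_vec w) (\<lambda>l. complex_of_real (1 / vnorm w) * w $ l))"

primrec gs_aux :: "complex vec list \<Rightarrow> complex vec list \<Rightarrow> complex vec list" where
  "gs_aux ws [] = ws"
| "gs_aux ws (v # vs) = gs_aux (ws @ [gs_next ws v]) vs"

definition gram_schmidt_c :: "nat \<Rightarrow> (nat \<Rightarrow> complex vec) \<Rightarrow> nat \<Rightarrow> complex vec" where
  "gram_schmidt_c r v i = gs_aux [] (map v [1..<r+1]) ! (i - 1)"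

definition perturbed :: "complex mat \<Rightarrow> nat \<Rightarrow> (nat \<Rightarrow> real) \<Rightarrow> (nat \<Rightarrow> complex vec) \<Rightarrow> complex mat" where
  "perturbed X r \<theta> u =
     mat (dim_row X) (dim_col X)
       (\<lambda>(j, k). X $$ (j, k) + (\<Sum>i\<in>{1..r}. complex_of_real (\<theta> i) * u i $ j * cnj (u i $ k)))"

end

theory Submission
  imports Defs "HOL-Real_Asymp.Real_Asymp"
begin

text \<open>
  For t above the spectrum of A, with resolvent \<open>R = (t - A)\<^sup>-\<^sup>1\<close>, the number of eigenvalues above t of
  \<open>A + \<Sum>l. \<theta> l * u l * (u l)\<^sup>*\<close> can be read off from the Gram matrix
  \<open>\<langle>R u l, u m\<rangle>\<close>: if it is close to G times the identity, this number lies between the numbers of l with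
  \<open>1 / G < \<theta> l\<close> and with \<open>1 / G \<le> \<theta> l\<close>. The logarithmic Sobolev inequality gives finite
  eighth moments, hence fourth moments of order \<open>1 / n\<^sup>2\<close> for the centred quadratic forms in the random
  vectors; so the Gram matrices converge almost surely to \<open>stieltjes \<mu>X t\<close> times the identity, and
  Gram--Schmidt does not change the limit. Comparing \<open>1 / stieltjes \<mu>X t\<close> with the \<open>\<theta> l\<close>
  locates the outliers. Inside the limiting spectrum the number of eigenvalues above t differs by at most r from that of
  A, which tends to infinity. The lower edge follows by changing signs.
\<close>

section \<open>Spectral theorem for Hermitian matrices\<close>

text \<open>Counting eigenvalues instead of solving a determinant equation turns each comparison
  into an inequality between quadratic forms, so equal \<open>\<theta> l\<close> need no separate
  treatment: they contribute to the same cardinality. The two cardinalities that enclose a count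
  differ exactly by the l with \<open>\<theta> l = 1 / G\<close>. Beyond the edge
  \<open>1 / stieltjes \<mu>X t\<close> is strictly monotone, so equality with a given
  \<open>\<theta> l\<close> occurs at most at the limit point itself, and counts on either side of
  that point fix the eigenvalue. If \<open>\<theta> l\<close> is subcritical, the threshold exceeds
  it at every t beyond the edge, and it is the bulk that holds the eigenvalue at the edge. No
  relation between the entries for different n is assumed, so almost sure convergence has to come
  from summability over n. Second moments of the normalised forms are only of order 1 / n, which is
  not summable; this is why fourth moments appear. The diagonal part of a form contains
  \<open>(cmod x)\<^sup>2 - 1\<close>, and the fourth moment of that variable is controlled by the
  eighth moment of x.\<close>

definition ip :: "nat \<Rightarrow> (nat \<Rightarrow> complex) \<Rightarrow> (nat \<Rightarrow> complex) \<Rightarrow> complex" where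
  "ip n x y = (\<Sum>j<n. x j * cnj (y j))"

lemma ip_cnj: "cnj (ip n x y) = ip n y x"
  by (simp add: ip_def mult.commute)

lemma ip_self: "ip n x x = of_real (\<Sum>j<n. (cmod (x j))\<^sup>2)"
  by (simp add: ip_def complex_norm_square[symmetric] del: of_real_power)

lemma ip_sum_left: "ip n (\<lambda>j. \<Sum>i\<in>I. c i * x i j) y = (\<Sum>i\<in>I. c i * ip n (x i) y)"
  unfolding ip_def sum_distrib_left sum_distrib_right
  by (subst sum.swap) (simp add: mult_ac)

lemma ip_sum_right: "ip n y (\<lambda>j. \<Sum>i\<in>I. c i * x i j) = (\<Sum>i\<in>I. cnj (c i) * ip n y (x i))"
  unfolding ip_def sum_distrib_left sum_distrib_right cnj_sum
  by (subst sum.swap) (simp add: mult_ac)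

text \<open>Padding the m equations with zero rows up to size k leaves a zero last row, so the
  determinant vanishes and the kernel is nontrivial. All dimension counts below rest on
  this.\<close>

lemma homogeneous_system_nontrivial:
  fixes F :: "nat \<Rightarrow> nat \<Rightarrow> complex"
  assumes "m < k"
  shows "\<exists>c. (\<exists>i<k. c i \<noteq> 0) \<and> (\<forall>l<m. (\<Sum>i<k. c i * F l i) = 0)"
proof -
  define A where "A = mat k k (\<lambda>(l, i). if l < m then F l i else 0)"
  have A: "A \<in> carrier_mat k k" by (simp add: A_def)
  have "A = mat\<^sub>r k k (\<lambda>i. if i = k - 1 then 0\<^sub>v k else row A i)"
    using assms by (intro eq_matI) (auto simp: A_def)
  moreover have "det (mat\<^sub>r k k (\<lambda>i. if i = k - 1 then 0\<^sub>v k else row A i)) = 0"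
    using assms A by (intro det_row_0) auto
  ultimately have "det A = 0" by simp
  then obtain v where v: "v \<in> carrier_vec k" "v \<noteq> 0\<^sub>v k" "A *\<^sub>v v = 0\<^sub>v k"
    using det_0_iff_vec_prod_zero_field[OF A] by blast
  have "\<exists>i<k. v $ i \<noteq> 0"
    using v(1,2) by (auto intro!: eq_vecI)
  moreover have "(\<Sum>i<k. v $ i * F l i) = 0" if "l < m" for l
  proof -
    have "(A *\<^sub>v v) $ l = 0" using v(3) that assms by simp
    moreover have "(A *\<^sub>v v) $ l = (\<Sum>i<k. v $ i * F l i)"
      using that assms v(1)
      by (auto simp: A_def scalar_prod_def lessThan_atLeast0 mult.commute intro!: sum.cong)
    ultimately show ?thesis by simp
  qed
  ultimately show ?thesis by (intro exI[of _ "\<lambda>i. v $ i"]) auto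
qed

text \<open>Vectors are functions on \<open>nat\<close> that are read only at arguments below n, so
  that vectors of all dimensions share one type and limits in n can be stated directly.\<close>

definition orthonormal :: "nat \<Rightarrow> nat \<Rightarrow> (nat \<Rightarrow> nat \<Rightarrow> complex) \<Rightarrow> bool" where
  "orthonormal n k P \<longleftrightarrow> (\<forall>i<k. \<forall>j<k. ip n (P i) (P j) = of_bool (i = j))"

lemma orthonormal_update:
  assumes "orthonormal n k P" "ip n w w = 1" "\<And>i. i < k \<Longrightarrow> ip n w (P i) = 0"
  shows "orthonormal n (Suc k) (P(k := w))"
proof -
  have "ip n (P i) w = 0" if "i < k" for i
    using assms(3)[OF that] ip_cnj[of n w "P i"] by simp
  then show ?thesis using assms by (auto simp: orthonormal_def less_Suc_eq)
qed

lemma ip_normalize: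
  assumes "\<exists>i<n. c i \<noteq> 0"
  obtains s :: real where "s > 0" "ip n (\<lambda>j. of_real s * c j) (\<lambda>j. of_real s * c j) = 1"
proof -
  let ?N = "\<Sum>j<n. (cmod (c j))\<^sup>2"
  have N: "?N > 0" using assms by (auto intro!: sum_pos2)
  have "ip n (\<lambda>j. of_real (1 / sqrt ?N) * c j) (\<lambda>j. of_real (1 / sqrt ?N) * c j)
      = of_real (\<Sum>j<n. (cmod (c j))\<^sup>2 / ?N)"
    unfolding ip_self using N
    by (intro arg_cong[where f = of_real] sum.cong refl)
      (simp add: norm_mult norm_divide power_mult_distrib power_divide del: sum_nonneg)
  also have "\<dots> = 1" using N by (simp add: sum_divide_distrib[symmetric])
  finally show ?thesis using that[of "1 / sqrt ?N"] N by simp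
qed

text \<open>Orthogonality to k < n given vectors is a system of k equations in n unknowns; a
  nontrivial solution, normalised, is the next vector.\<close>

lemma orthonormal_extend:
  assumes "orthonormal n k P" "k \<le> n"
  shows "\<exists>Q. orthonormal n n Q \<and> (\<forall>i<k. Q i = P i)"
  using assms(2,1)
proof (induction k arbitrary: P rule: inc_induct)
  case base
  then show ?case by blast
next
  case (step k)
  obtain c where c: "\<exists>i<n. c i \<noteq> 0" "\<forall>l<k. (\<Sum>i<n. c i * cnj (P l i)) = 0"
    using homogeneous_system_nontrivial[of k n "\<lambda>l i. cnj (P l i)"] step.hyps by auto
  obtain s :: real where s: "ip n (\<lambda>j. of_real s * c j) (\<lambda>j. of_real s * c j) = 1"
    using ip_normalize[OF c(1)] by blast
  have "ip n (\<lambda>j. of_real s * c j) (P i) = 0" if "i < k" for i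
    using c(2) that by (simp add: ip_def mult.assoc sum_distrib_left[symmetric])
  then have "orthonormal n (Suc k) (P(k := (\<lambda>j. of_real s * c j)))"
    using orthonormal_update[OF step.prems s] by blast
  from step.IH[OF this] obtain Q where "orthonormal n n Q" "\<forall>i<Suc k. Q i = (P(k := (\<lambda>j. of_real s * c j))) i"
    by blast
  then show ?case by (intro exI[of _ Q]) auto
qed

text \<open>Orthonormality says that the adjoint A is a left inverse of the square matrix B with
  columns \<open>P k\<close>. A left inverse of a square matrix is also a right inverse, and this is
  completeness of the basis.\<close>

lemma orthonormal_rows:
  assumes "orthonormal n n P" "i < n" "j < n"
  shows "(\<Sum>k<n. P k i * cnj (P k j)) = of_bool (i = j)"
proof -
  define A where "A = mat n n (\<lambda>(k, i). cnj (P k i))"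
  define B where "B = mat n n (\<lambda>(i, k). P k i)"
  have AB: "A \<in> carrier_mat n n" "B \<in> carrier_mat n n" by (auto simp: A_def B_def)
  have "A * B = 1\<^sub>m n"
  proof (rule eq_matI)
    fix k l assume kl: "k < dim_row (1\<^sub>m n)" "l < dim_col (1\<^sub>m n)"
    then have "(A * B) $$ (k, l) = ip n (P l) (P k)"
      by (simp add: A_def B_def scalar_prod_def ip_def lessThan_atLeast0 mult.commute)
    then show "(A * B) $$ (k, l) = 1\<^sub>m n $$ (k, l)"
      using assms(1) kl by (auto simp: orthonormal_def)
  qed (auto simp: A_def B_def)
  then have "B * A = 1\<^sub>m n" using mat_mult_left_right_inverse[OF AB] by simp
  then have "(B * A) $$ (i, j) = of_bool (i = j)" using assms by simp
  moreover have "(B * A) $$ (i, j) = (\<Sum>k<n. P k i * cnj (P k j))"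
    using assms by (simp add: A_def B_def scalar_prod_def lessThan_atLeast0)
  ultimately show ?thesis by simp
qed

lemma orthonormal_expand:
  assumes "orthonormal n n P" "j < n"
  shows "x j = (\<Sum>k<n. ip n x (P k) * P k j)"
proof -
  have "(\<Sum>k<n. ip n x (P k) * P k j) = (\<Sum>i<n. x i * (\<Sum>k<n. P k j * cnj (P k i)))"
    unfolding ip_def sum_distrib_left sum_distrib_right
    by (subst sum.swap) (simp add: mult_ac)
  also have "\<dots> = (\<Sum>i<n. x i * of_bool (j = i))"
    using orthonormal_rows[OF assms(1)] assms(2) by (intro sum.cong) auto
  also have "\<dots> = x j" using assms(2) by (simp add: of_bool_def sum.delta' if_distrib cong: if_cong)
  finally show ?thesis by simp
qed

lemma orthonormal_parseval:
  assumes "orthonormal n n P"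
  shows "ip n x y = (\<Sum>k<n. ip n x (P k) * cnj (ip n y (P k)))"
proof -
  have "ip n x y = ip n (\<lambda>j. \<Sum>k<n. ip n x (P k) * P k j) y"
    unfolding ip_def[of n _ y] using orthonormal_expand[OF assms] by (intro sum.cong) auto
  also have "\<dots> = (\<Sum>k<n. ip n x (P k) * ip n (P k) y)" by (rule ip_sum_left)
  finally show ?thesis by (simp add: ip_cnj)
qed

text \<open>The orthogonal complement of the eigenvectors found so far is invariant under A, the
  compression of A to it has an eigenvalue over the complex numbers, and self-adjointness makes that
  eigenvalue real.\<close>

lemma hermitian_eigenvector_orthogonal:
  assumes herm: "\<And>i j. i < n \<Longrightarrow> j < n \<Longrightarrow> A i j = cnj (A j i)"
    and P: "orthonormal n k P" and k: "k < n"
    and ev: "\<And>i j. i < k \<Longrightarrow> j < n \<Longrightarrow> (\<Sum>l<n. A j l * P i l) = of_real (lam i) * P i j"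
  shows "\<exists>w (e::real). ip n w w = 1 \<and> (\<forall>i<k. ip n w (P i) = 0) \<and>
           (\<forall>j<n. (\<Sum>l<n. A j l * w l) = of_real e * w j)"
proof -
  obtain Q where Q: "orthonormal n n Q" "\<And>i. i < k \<Longrightarrow> Q i = P i"
    using orthonormal_extend[OF P] k by (metis less_imp_le)
  define T where "T x = (\<lambda>j. \<Sum>l<n. A j l * x l)" for x
  have T_adj: "ip n (T x) y = ip n x (T y)" for x y
  proof -
    have "ip n (T x) y = (\<Sum>j<n. \<Sum>l<n. A j l * x l * cnj (y j))"
      by (simp add: ip_def T_def sum_distrib_right)
    also have "\<dots> = (\<Sum>l<n. \<Sum>j<n. x l * cnj (A l j * y j))"
      by (subst sum.swap, intro sum.cong refl) (subst herm, auto)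
    finally show ?thesis by (simp add: ip_def T_def sum_distrib_left)
  qed
  let ?m = "n - k"
  \<comment> \<open>The compression of A to the complement, in the basis \<open>Q k\<close>, ...,
    \<open>Q (n - 1)\<close>.\<close>
  define C where "C = mat ?m ?m (\<lambda>(i, j). ip n (T (Q (k + j))) (Q (k + i)))"
  have C: "C \<in> carrier_mat ?m ?m" by (simp add: C_def)
  obtain as where as: "char_poly C = (\<Prod>a\<leftarrow>as. [:- a, 1:])" "length as = ?m"
    using char_poly_factorized[OF C] by blast
  then obtain z zs where "as = z # zs" using k by (cases as) auto
  then have "eigenvalue C z" unfolding eigenvalue_root_char_poly[OF C] as(1) by simp
  then obtain y where y: "y \<in> carrier_vec ?m" "y \<noteq> 0\<^sub>v ?m" "C *\<^sub>v y = z \<cdot>\<^sub>v y"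
    using C unfolding eigenvalue_def eigenvector_def by auto
  define w where "w = (\<lambda>l. \<Sum>j<?m. y $ j * Q (k + j) l)"
  have w_Q: "ip n w (Q i) = (if i < k then 0 else y $ (i - k))" if "i < n" for i
  proof -
    have "ip n w (Q i) = (\<Sum>j<?m. y $ j * of_bool (k + j = i))"
      unfolding w_def ip_sum_left using Q(1) that by (intro sum.cong) (auto simp: orthonormal_def)
    also have "\<dots> = (\<Sum>j<?m. if j = i - k then (if i < k then 0 else y $ j) else 0)"
      by (intro sum.cong) auto
    also have "\<dots> = (if i < k then 0 else y $ (i - k))"
      using that by (subst sum.delta) auto
    finally show ?thesis .
  qed
  have Tw_Q: "ip n (T w) (Q i) = z * ip n w (Q i)" if i: "i < n" for i
  proof (cases "i < k")
    case True
    \<comment> \<open>Invariance of the complement: moved to the other argument, A meets the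
      eigenvector \<open>P i\<close>, which is orthogonal to w.\<close>
    have "ip n w (T (P i)) = ip n w (\<lambda>j. of_real (lam i) * P i j)"
      unfolding ip_def using ev[OF True] by (simp add: T_def)
    also have "\<dots> = of_real (lam i) * ip n w (P i)"
      by (simp add: ip_def sum_distrib_left mult_ac)
    also have "\<dots> = 0" using w_Q[OF i] True Q(2) by simp
    finally show ?thesis using w_Q[OF i] True Q(2) by (simp add: T_adj)
  next
    case False
    define p where "p = i - k"
    have p: "i = k + p" "p < ?m" using i False by (auto simp: p_def)
    have "T w l = (\<Sum>j<?m. y $ j * T (Q (k + j)) l)" for l
    proof -
      have "T w l = (\<Sum>l'<n. \<Sum>j<?m. A l l' * (y $ j * Q (k + j) l'))"
        by (simp add: T_def w_def sum_distrib_left)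
      also have "\<dots> = (\<Sum>j<?m. \<Sum>l'<n. A l l' * (y $ j * Q (k + j) l'))"
        by (rule sum.swap)
      finally show ?thesis by (simp add: T_def sum_distrib_left mult.left_commute)
    qed
    then have "T w = (\<lambda>l. \<Sum>j<?m. y $ j * T (Q (k + j)) l)" by blast
    then have "ip n (T w) (Q i) = (\<Sum>j<?m. y $ j * ip n (T (Q (k + j))) (Q i))"
      by (simp add: ip_sum_left)
    also have "\<dots> = (C *\<^sub>v y) $ p"
      using p y(1) by (auto simp: C_def scalar_prod_def lessThan_atLeast0 mult.commute intro!: sum.cong)
    also have "\<dots> = z * ip n w (Q i)"
      unfolding y(3) using p y(1) w_Q[OF i] by simp
    finally show ?thesis .
  qed
  have Tw: "T w j = z * w j" if "j < n" for j
    unfolding orthonormal_expand[OF Q(1) that, of "T w"] orthonormal_expand[OF Q(1) that, of w]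
    by (simp add: Tw_Q sum_distrib_left mult.assoc)
  have "\<exists>p<?m. y $ p \<noteq> 0" using y(1,2) by (auto intro!: eq_vecI)
  then obtain p where p: "p < ?m" "y $ p \<noteq> 0" by blast
  then have "ip n w (Q (k + p)) \<noteq> 0" using w_Q[of "k + p"] by simp
  then have w0: "\<exists>j<n. w j \<noteq> 0" by (auto simp: ip_def intro!: sum.neutral)
  then have "(\<Sum>j<n. (cmod (w j))\<^sup>2) > 0" by (auto intro!: sum_pos2)
  \<comment> \<open>Self-adjointness equates \<open>z * ip n w w\<close> with
    \<open>cnj z * ip n w w\<close>, and the common factor is nonzero.\<close>
  then have "ip n w w \<noteq> 0" by (simp add: ip_self del: of_real_sum)
  moreover have "ip n (T w) w = z * ip n w w" "ip n w (T w) = cnj z * ip n w w"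
    using Tw by (simp_all add: ip_def sum_distrib_left mult.assoc mult.left_commute)
  ultimately have "cnj z = z" using T_adj[of w w] by simp
  then have z: "z = of_real (Re z)" by (metis complex_is_Real_iff of_real_Re Reals_cnj_iff)
  obtain s :: real where s: "ip n (\<lambda>j. of_real s * w j) (\<lambda>j. of_real s * w j) = 1"
    using ip_normalize[OF w0] by blast
  have "ip n (\<lambda>j. of_real s * w j) (P i) = 0" if "i < k" for i
  proof -
    have "ip n (\<lambda>j. of_real s * w j) (P i) = of_real s * ip n w (Q i)"
      by (simp add: ip_def sum_distrib_left mult.assoc Q(2) that)
    then show ?thesis using w_Q[of i] that k by simp
  qed
  moreover have "(\<Sum>l<n. A j l * (of_real s * w l)) = of_real (Re z) * (of_real s * w j)" if "j < n" for j
  proof -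
    have "(\<Sum>l<n. A j l * (of_real s * w l)) = of_real s * T w j"
      by (simp add: T_def sum_distrib_left mult_ac)
    then show ?thesis using Tw[OF that] z by simp
  qed
  ultimately show ?thesis using s by blast
qed

lemma hermitian_orthonormal_eigenvectors:
  assumes herm: "\<And>i j. i < n \<Longrightarrow> j < n \<Longrightarrow> A i j = cnj (A j i)" and "k \<le> n"
  shows "\<exists>P (lam :: nat \<Rightarrow> real). orthonormal n k P \<and>
    (\<forall>i<k. \<forall>j<n. (\<Sum>l<n. A j l * P i l) = of_real (lam i) * P i j)"
  using assms(2)
proof (induction k)
  case 0
  then show ?case by (simp add: orthonormal_def)
next
  case (Suc k)
  then obtain P lam where P: "orthonormal n k P"
    "\<And>i j. i < k \<Longrightarrow> j < n \<Longrightarrow> (\<Sum>l<n. A j l * P i l) = of_real (lam i) * P i j"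
    by auto
  obtain w e where w: "ip n w w = 1" "\<And>i. i < k \<Longrightarrow> ip n w (P i) = 0"
    "\<And>j. j < n \<Longrightarrow> (\<Sum>l<n. A j l * w l) = of_real e * w j"
    using hermitian_eigenvector_orthogonal[OF herm P(1) _ P(2)] Suc.prems by auto
  show ?case
    using P(2) w(3) orthonormal_update[OF P(1) w(1,2)]
    by (intro exI[of _ "P(k := w)"] exI[of _ "lam(k := e)"] conjI) (assumption, auto simp: less_Suc_eq)
qed

text \<open>Row \<open>P k\<close> holds the coordinates of the k-th vector of an orthonormal basis of eigenvectors.\<close>
definition eigensystem :: "nat \<Rightarrow> (nat \<Rightarrow> nat \<Rightarrow> complex) \<Rightarrow> (nat \<Rightarrow> nat \<Rightarrow> complex) \<Rightarrow> (nat \<Rightarrow> real) \<Rightarrow> bool" where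
  "eigensystem n A P lam \<longleftrightarrow> orthonormal n n P \<and>
     (\<forall>i<n. \<forall>j<n. A i j = (\<Sum>k<n. of_real (lam k) * (P k i * cnj (P k j))))"

section \<open>Diagonalisation and the sorted list of eigenvalues\<close>

lemma hermitian_eigensystem_exists:
  assumes "\<And>i j. i < n \<Longrightarrow> j < n \<Longrightarrow> A i j = cnj (A j i)"
  shows "\<exists>P lam. eigensystem n A P lam"
proof -
  obtain P and lam :: "nat \<Rightarrow> real" where P: "orthonormal n n P"
    "\<And>i j. i < n \<Longrightarrow> j < n \<Longrightarrow> (\<Sum>l<n. A j l * P i l) = of_real (lam i) * P i j"
    using hermitian_orthonormal_eigenvectors[of n A n] assms by blast
  have "A i j = (\<Sum>k<n. of_real (lam k) * (P k i * cnj (P k j)))" if ij: "i < n" "j < n" for i j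
  proof -
    have "(\<Sum>k<n. of_real (lam k) * (P k i * cnj (P k j))) = (\<Sum>k<n. (\<Sum>l<n. A i l * P k l) * cnj (P k j))"
      using P(2) ij by (intro sum.cong) auto
    also have "\<dots> = (\<Sum>l<n. A i l * (\<Sum>k<n. P k l * cnj (P k j)))"
      unfolding sum_distrib_left sum_distrib_right by (subst sum.swap) (simp add: mult_ac)
    also have "\<dots> = (\<Sum>l<n. A i l * of_bool (l = j))"
      using orthonormal_rows[OF P(1)] ij by (intro sum.cong) auto
    also have "\<dots> = A i j" using ij by (simp add: of_bool_def if_distrib cong: if_cong)
    finally show ?thesis by simp
  qed
  then show ?thesis using P(1) unfolding eigensystem_def by blast
qed

text \<open>With the eigenvectors as columns of U and V the adjoint of U, A equals U D V and U V is
  the identity, so A is similar to the diagonal matrix D.\<close>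

lemma eigensystem_char_poly:
  assumes A: "A \<in> carrier_mat n n" and es: "eigensystem n (\<lambda>i j. A $$ (i, j)) P lam"
  shows "char_poly A = (\<Prod>k\<leftarrow>[0..<n]. [:- of_real (lam k), 1:])"
proof -
  define U where "U = mat n n (\<lambda>(i, k). P k i)"
  define V where "V = mat n n (\<lambda>(k, i). cnj (P k i))"
  define D where "D = mat n n (\<lambda>(k, l). if k = l then complex_of_real (lam k) else 0)"
  have P: "orthonormal n n P" using es by (simp add: eigensystem_def)
  have UV: "U * V = 1\<^sub>m n"
  proof (rule eq_matI)
    fix i j assume "i < dim_row (1\<^sub>m n)" "j < dim_col (1\<^sub>m n)"
    then show "(U * V) $$ (i, j) = 1\<^sub>m n $$ (i, j)"
      using orthonormal_rows[OF P, of i j] by (simp add: U_def V_def scalar_prod_def lessThan_atLeast0)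
  qed (auto simp: U_def V_def)
  have VU: "V * U = 1\<^sub>m n"
    using mat_mult_left_right_inverse[OF _ _ UV] by (simp add: U_def V_def)
  have DV: "D * V = mat n n (\<lambda>(k, j). of_real (lam k) * cnj (P k j))"
  proof (rule eq_matI)
    fix k j assume "k < dim_row (mat n n (\<lambda>(k, j). of_real (lam k) * cnj (P k j)))"
      "j < dim_col (mat n n (\<lambda>(k, j). of_real (lam k) * cnj (P k j)))"
    then show "(D * V) $$ (k, j) = mat n n (\<lambda>(k, j). of_real (lam k) * cnj (P k j)) $$ (k, j)"
      by (simp add: D_def V_def scalar_prod_def if_distrib[where f = "\<lambda>x. x * _"] cong: if_cong)
  qed (auto simp: D_def V_def)
  have "A = U * (D * V)"
  proof (rule eq_matI)
    fix i j assume "i < dim_row (U * (D * V))" "j < dim_col (U * (D * V))"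
    then have ij: "i < n" "j < n" by (auto simp: U_def V_def)
    then have "(U * (D * V)) $$ (i, j) = (\<Sum>k<n. of_real (lam k) * (P k i * cnj (P k j)))"
      unfolding DV by (auto simp: U_def scalar_prod_def lessThan_atLeast0 mult_ac intro!: sum.cong)
    then show "A $$ (i, j) = (U * (D * V)) $$ (i, j)"
      using es ij by (simp add: eigensystem_def)
  qed (use A in \<open>auto simp: U_def V_def\<close>)
  also have "\<dots> = U * D * V"
    by (rule assoc_mult_mat[symmetric, of _ n n _ n _ n]) (auto simp: U_def V_def D_def)
  finally have "similar_mat A D"
    by (intro similar_matI[of _ _ U V n]) (use A UV VU in \<open>auto simp: U_def V_def D_def\<close>)
  then have "char_poly A = char_poly D" by (rule char_poly_similar)
  also have "\<dots> = (\<Prod>a\<leftarrow>diag_mat D. [:- a, 1:])"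
    by (rule char_poly_upper_triangular[of _ n]) (auto simp: D_def upper_triangular_def)
  also have "diag_mat D = map (\<lambda>k. of_real (lam k)) [0..<n]"
    by (auto simp: diag_mat_def D_def)
  finally show ?thesis by (simp add: comp_def)
qed

lemma eigs_sorted_eigensystem:
  assumes A: "A \<in> carrier_mat n n" and es: "eigensystem n (\<lambda>i j. A $$ (i, j)) P lam"
  shows "eigs_sorted A = sort (map lam [0..<n])"
proof -
  have "proots (\<Prod>k\<leftarrow>ks. [:- complex_of_real (lam k), 1:]) = mset (map (\<lambda>k. of_real (lam k)) ks)" for ks
  proof (induction ks)
    case (Cons k ks)
    have "(\<Prod>k\<leftarrow>ks. [:- complex_of_real (lam k), 1:]) \<noteq> 0" by (auto simp: prod_list_zero_iff)
    then have "proots ([:- complex_of_real (lam k), 1:] * (\<Prod>k\<leftarrow>ks. [:- complex_of_real (lam k), 1:]))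
      = {#of_real (lam k)#} + proots (\<Prod>k\<leftarrow>ks. [:- complex_of_real (lam k), 1:])"
      by (subst proots_mult) auto
    then show ?case using Cons.IH by (simp del: mult_pCons_left)
  qed simp
  then have "image_mset Re (proots (char_poly A)) = mset (map lam [0..<n])"
    unfolding eigensystem_char_poly[OF A es] by (simp add: image_mset.compositionality comp_def)
  then show ?thesis by (simp add: eigs_sorted_def del: mset_map)
qed

text \<open>Eigenvalues are addressed through \<open>eigs_sorted\<close> from here on, so the
  eigenbasis is permuted until the sorted list itself is the eigenvalue function; reindexing the
  spectral sum leaves the matrix unchanged.\<close>

lemma hermitian_sorted_eigensystem:
  assumes A: "A \<in> carrier_mat n n" and herm: "hermitian_mat A"
  shows "length (eigs_sorted A) = n" "\<exists>P. eigensystem n (\<lambda>i j. A $$ (i, j)) P (\<lambda>k. eigs_sorted A ! k)"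
proof -
  obtain P lam where es: "eigensystem n (\<lambda>i j. A $$ (i, j)) P lam"
  proof -
    have "A $$ (i, j) = cnj (A $$ (j, i))" if "i < n" "j < n" for i j
      using A herm that unfolding hermitian_mat_def by blast
    then show ?thesis using hermitian_eigensystem_exists[of n "\<lambda>i j. A $$ (i, j)"] that by blast
  qed
  note eq = eigs_sorted_eigensystem[OF A es]
  show len: "length (eigs_sorted A) = n" by (simp add: eq)
  have "mset (eigs_sorted A) = mset (map lam [0..<n])" by (simp add: eq)
  then obtain \<pi> where \<pi>: "\<pi> permutes {..<n}" "permute_list \<pi> (map lam [0..<n]) = eigs_sorted A"
    using mset_eq_permutation[of "eigs_sorted A" "map lam [0..<n]"] by auto
  have bij: "bij_betw \<pi> {..<n} {..<n}" using \<pi>(1) by (rule permutes_imp_bij)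
  have lt: "\<pi> k < n" if "k < n" for k using bij_betwE[OF bij] that by auto
  have lam: "eigs_sorted A ! k = lam (\<pi> k)" if "k < n" for k
    using that \<pi>(1) lt[OF that] unfolding \<pi>(2)[symmetric] by (simp add: permute_list_nth)
  have "orthonormal n n (P \<circ> \<pi>)"
    using es lt inj_onD[OF bij_betw_imp_inj_on[OF bij]]
    unfolding eigensystem_def orthonormal_def by (auto simp: of_bool_def)
  moreover have "(\<Sum>k<n. of_real (eigs_sorted A ! k) * ((P \<circ> \<pi>) k i * cnj ((P \<circ> \<pi>) k j)))
      = (\<Sum>k<n. of_real (lam k) * (P k i * cnj (P k j)))" for i j
    using sum.reindex_bij_betw[OF bij, of "\<lambda>k. of_real (lam k) * (P k i * cnj (P k j))"] lam by simp
  ultimately have "eigensystem n (\<lambda>i j. A $$ (i, j)) (P \<circ> \<pi>) (\<lambda>k. eigs_sorted A ! k)"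
    using es unfolding eigensystem_def by simp
  then show "\<exists>P. eigensystem n (\<lambda>i j. A $$ (i, j)) P (\<lambda>k. eigs_sorted A ! k)" by blast
qed

section \<open>Counting eigenvalues of finite rank perturbations\<close>

lemma sum_swap_last:
  "(\<Sum>i\<in>A. \<Sum>j\<in>B. \<Sum>k\<in>C. f i j k) = (\<Sum>k\<in>C. \<Sum>i\<in>A. \<Sum>j\<in>B. f i j k)"
proof -
  have "(\<Sum>i\<in>A. \<Sum>j\<in>B. \<Sum>k\<in>C. f i j k) = (\<Sum>i\<in>A. \<Sum>k\<in>C. \<Sum>j\<in>B. f i j k)"
    by (intro sum.cong refl sum.swap)
  then show ?thesis by (simp add: sum.swap[of _ C A])
qed

text \<open>The index sets to come are sets of eigenvalue indices, subsets of R and disjoint sums of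
  these; bijections with initial segments reduce them to the numbered version.\<close>

lemma homogeneous_system_nontrivial_set:
  fixes F :: "'a \<Rightarrow> 'b \<Rightarrow> complex"
  assumes "finite I" "finite J" "card J < card I"
  shows "\<exists>c. (\<exists>i\<in>I. c i \<noteq> 0) \<and> (\<forall>l\<in>J. (\<Sum>i\<in>I. c i * F l i) = 0)"
proof -
  obtain f where f: "bij_betw f {..<card I} I"
    using ex_bij_betw_nat_finite[OF assms(1)] by (auto simp: lessThan_atLeast0)
  obtain g where g: "bij_betw g {..<card J} J"
    using ex_bij_betw_nat_finite[OF assms(2)] by (auto simp: lessThan_atLeast0)
  obtain c where c: "\<exists>i<card I. c i \<noteq> 0" "\<forall>l<card J. (\<Sum>i<card I. c i * F (g l) (f i)) = 0"
    using homogeneous_system_nontrivial[OF assms(3), of "\<lambda>l i. F (g l) (f i)"] by blast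
  let ?h = "inv_into {..<card I} f"
  have h: "?h (f i) = i" if "i < card I" for i
    using f that by (simp add: bij_betw_def inv_into_f_f)
  have "\<exists>i\<in>I. c (?h i) \<noteq> 0"
    using c(1) h f by (metis bij_betwE lessThan_iff)
  moreover have "(\<Sum>i\<in>I. c (?h i) * F l i) = 0" if "l \<in> J" for l
  proof -
    have "l \<in> g ` {..<card J}" using g that by (simp add: bij_betw_def)
    then obtain p where p: "p < card J" "g p = l" by auto
    have "(\<Sum>i\<in>I. c (?h i) * F l i) = (\<Sum>i<card I. c (?h (f i)) * F l (f i))"
      by (rule sum.reindex_bij_betw[OF f, symmetric])
    also have "\<dots> = (\<Sum>i<card I. c i * F (g p) (f i))"
      using h p by (intro sum.cong) auto
    finally show ?thesis using c(2)[rule_format, OF p(1)] by simp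
  qed
  ultimately show ?thesis by (intro exI[of _ "\<lambda>i. c (?h i)"]) auto
qed

text \<open>For Hermitian A the double sum is real and \<open>Re\<close> changes nothing; it only
  gives the form a type that carries an order.\<close>

definition qform :: "nat \<Rightarrow> (nat \<Rightarrow> nat \<Rightarrow> complex) \<Rightarrow> (nat \<Rightarrow> complex) \<Rightarrow> real" where
  "qform n A x = Re (\<Sum>i<n. \<Sum>j<n. cnj (x i) * A i j * x j)"

lemma qform_eigensystem:
  assumes "eigensystem n A P lam"
  shows "qform n A x = (\<Sum>k<n. lam k * (cmod (ip n x (P k)))\<^sup>2)"
proof -
  have "(\<Sum>i<n. \<Sum>j<n. cnj (x i) * A i j * x j)
      = (\<Sum>i<n. \<Sum>j<n. \<Sum>k<n. cnj (x i) * (of_real (lam k) * (P k i * cnj (P k j))) * x j)"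
    using assms by (intro sum.cong refl) (simp add: eigensystem_def sum_distrib_left sum_distrib_right)
  also have "\<dots> = (\<Sum>k<n. \<Sum>i<n. \<Sum>j<n. cnj (x i) * (of_real (lam k) * (P k i * cnj (P k j))) * x j)"
    by (rule sum_swap_last)
  also have "\<dots> = (\<Sum>k<n. of_real (lam k) * (ip n (P k) x * ip n x (P k)))"
    by (simp add: ip_def sum_product sum_distrib_left mult_ac)
  also have "\<dots> = (\<Sum>k<n. of_real (lam k * (cmod (ip n x (P k)))\<^sup>2))"
    by (intro sum.cong refl) (simp add: ip_cnj[symmetric, of n x] complex_norm_square[symmetric] mult.commute)
  finally show ?thesis unfolding qform_def by simp
qed

lemma qform_rank_perturbation:
  assumes A': "\<And>i j. i < n \<Longrightarrow> j < n \<Longrightarrow> A' i j = A i j + (\<Sum>l\<in>R. of_real (\<theta> l) * u l i * cnj (u l j))"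
  shows "qform n A' x = qform n A x + (\<Sum>l\<in>R. \<theta> l * (cmod (ip n x (u l)))\<^sup>2)"
proof -
  have "(\<Sum>i<n. \<Sum>j<n. cnj (x i) * A' i j * x j) = (\<Sum>i<n. \<Sum>j<n. cnj (x i) * A i j * x j)
      + (\<Sum>i<n. \<Sum>j<n. \<Sum>l\<in>R. cnj (x i) * (of_real (\<theta> l) * u l i * cnj (u l j)) * x j)"
    by (simp add: A' algebra_simps sum.distrib sum_distrib_left)
  also have "(\<Sum>i<n. \<Sum>j<n. \<Sum>l\<in>R. cnj (x i) * (of_real (\<theta> l) * u l i * cnj (u l j)) * x j)
     = (\<Sum>l\<in>R. \<Sum>i<n. \<Sum>j<n. cnj (x i) * (of_real (\<theta> l) * u l i * cnj (u l j)) * x j)"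
    by (rule sum_swap_last)
  also have "\<dots> = (\<Sum>l\<in>R. of_real (\<theta> l) * (ip n (u l) x * ip n x (u l)))"
    by (simp add: ip_def sum_product sum_distrib_left mult_ac)
  also have "\<dots> = (\<Sum>l\<in>R. of_real (\<theta> l * (cmod (ip n x (u l)))\<^sup>2))"
    by (intro sum.cong refl) (simp add: ip_cnj[symmetric, of n x] complex_norm_square[symmetric] mult.commute)
  finally show ?thesis unfolding qform_def by simp
qed

definition count_above :: "nat \<Rightarrow> (nat \<Rightarrow> real) \<Rightarrow> real \<Rightarrow> nat" where
  "count_above n lam t = card {k. k < n \<and> t < lam k}"

definition sqn :: "nat \<Rightarrow> (nat \<Rightarrow> complex) \<Rightarrow> real" where
  "sqn n x = (\<Sum>j<n. (cmod (x j))\<^sup>2)"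

lemma sqn_parseval:
  assumes "orthonormal n n P"
  shows "sqn n x = (\<Sum>k<n. (cmod (ip n x (P k)))\<^sup>2)"
proof -
  have "of_real (sqn n x) = ip n x x" by (simp add: sqn_def ip_self)
  also have "\<dots> = (\<Sum>k<n. of_real ((cmod (ip n x (P k)))\<^sup>2))"
    unfolding orthonormal_parseval[OF assms, of x x]
    by (intro sum.cong refl) (metis complex_norm_square of_real_power)
  finally show ?thesis by (metis of_real_eq_iff of_real_sum)
qed

lemma ip_orthonormal_combination:
  assumes "orthonormal n n P" "K \<subseteq> {..<n}" "k < n"
  shows "ip n (\<lambda>j. \<Sum>i\<in>K. c i * P i j) (P k) = (if k \<in> K then c k else 0)"
proof -
  have "ip n (\<lambda>j. \<Sum>i\<in>K. c i * P i j) (P k) = (\<Sum>i\<in>K. if i = k then c i else 0)"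
    unfolding ip_sum_left using assms by (intro sum.cong) (auto simp: orthonormal_def)
  then show ?thesis using finite_subset[OF assms(2)] by simp
qed

text \<open>Half of the min-max principle: more than \<open>card D\<close> eigenvectors with
  eigenvalue above t span a space containing a nonzero vector orthogonal to all \<open>d l\<close>,
  and on nonzero vectors of that span the form exceeds t times the squared norm.\<close>

lemma count_above_le:
  assumes es: "eigensystem n A P lam" and "finite D"
    and le: "\<And>x. (\<And>l. l \<in> D \<Longrightarrow> ip n x (d l) = 0) \<Longrightarrow> qform n A x \<le> t * sqn n x"
  shows "count_above n lam t \<le> card D"
proof (rule ccontr)
  define K where "K = {k. k < n \<and> t < lam k}"
  assume "\<not> count_above n lam t \<le> card D"
  then have "card D < card K" by (simp add: count_above_def K_def)
  moreover have K: "finite K" "K \<subseteq> {..<n}" by (auto simp: K_def)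
  ultimately obtain c where c: "\<exists>i\<in>K. c i \<noteq> 0" "\<forall>l\<in>D. (\<Sum>i\<in>K. c i * ip n (P i) (d l)) = 0"
    using homogeneous_system_nontrivial_set[of K D "\<lambda>l i. ip n (P i) (d l)"] assms(2) by blast
  have P: "orthonormal n n P" using es by (simp add: eigensystem_def)
  define x where "x = (\<lambda>j. \<Sum>i\<in>K. c i * P i j)"
  have xP: "ip n x (P k) = (if k \<in> K then c k else 0)" if "k < n" for k
    unfolding x_def using ip_orthonormal_combination[OF P K(2) that] .
  have "qform n A x \<le> t * sqn n x"
    using c(2) by (intro le) (simp add: x_def ip_sum_left)
  moreover have "qform n A x = (\<Sum>k\<in>K. lam k * (cmod (c k))\<^sup>2)"
    unfolding qform_eigensystem[OF es] using K(2)
    by (intro sum.mono_neutral_cong_right) (auto simp: xP)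
  moreover have "sqn n x = (\<Sum>k\<in>K. (cmod (c k))\<^sup>2)"
    unfolding sqn_parseval[OF P] using K(2)
    by (intro sum.mono_neutral_cong_right) (auto simp: xP)
  ultimately have "(\<Sum>k\<in>K. (lam k - t) * (cmod (c k))\<^sup>2) \<le> 0"
    by (simp add: algebra_simps sum_subtractf sum_distrib_left)
  moreover obtain i where "i \<in> K" "c i \<noteq> 0" using c(1) by blast
  then have "(\<Sum>k\<in>K. (lam k - t) * (cmod (c k))\<^sup>2) > 0"
    using K(1) by (intro sum_pos2[of _ i]) (auto simp: K_def)
  ultimately show False by simp
qed

text \<open>The other half: with too few eigenvalues above t, a nontrivial combination of the test
  vectors is orthogonal to all their eigenvectors, and there the form is at most t times the squared
  norm. The strict hypothesis also forces the \<open>w i\<close> to be linearly independent.\<close>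

lemma le_count_above:
  assumes es: "eigensystem n A P lam" and "finite D"
    and gt: "\<And>c. \<exists>i\<in>D. c i \<noteq> 0 \<Longrightarrow>
      t * sqn n (\<lambda>j. \<Sum>i\<in>D. c i * w i j) < qform n A (\<lambda>j. \<Sum>i\<in>D. c i * w i j)"
  shows "card D \<le> count_above n lam t"
proof (rule ccontr)
  define K where "K = {k. k < n \<and> t < lam k}"
  assume "\<not> card D \<le> count_above n lam t"
  then have "card K < card D" by (simp add: count_above_def K_def)
  moreover have K: "finite K" "K \<subseteq> {..<n}" by (auto simp: K_def)
  ultimately obtain c where c: "\<exists>i\<in>D. c i \<noteq> 0" "\<forall>k\<in>K. (\<Sum>i\<in>D. c i * ip n (w i) (P k)) = 0"
    using homogeneous_system_nontrivial_set[of D K "\<lambda>k i. ip n (w i) (P k)"] assms(2) by blast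
  have P: "orthonormal n n P" using es by (simp add: eigensystem_def)
  define x where "x = (\<lambda>j. \<Sum>i\<in>D. c i * w i j)"
  have xP: "ip n x (P k) = 0" if "k \<in> K" for k
    unfolding x_def ip_sum_left using c(2) that by blast
  have "(\<Sum>k<n. lam k * (cmod (ip n x (P k)))\<^sup>2) \<le> (\<Sum>k<n. t * (cmod (ip n x (P k)))\<^sup>2)"
  proof (rule sum_mono)
    fix k assume "k \<in> {..<n}"
    then show "lam k * (cmod (ip n x (P k)))\<^sup>2 \<le> t * (cmod (ip n x (P k)))\<^sup>2"
      using xP[of k] by (cases "k \<in> K") (auto simp: K_def intro!: mult_right_mono)
  qed
  then have "qform n A x \<le> t * sqn n x"
    unfolding qform_eigensystem[OF es] sqn_parseval[OF P] by (simp add: sum_distrib_left)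
  with gt[OF c(1)] show False by (simp add: x_def)
qed

text \<open>A Weyl-type inequality: the two forms agree on vectors orthogonal to all
  \<open>u l\<close>, and orthogonality to the eigenvectors of A' above t bounds the second form.
  The sum type keeps both families of constraints disjoint, so their cardinalities add.\<close>

lemma count_above_rank_perturbation:
  assumes es: "eigensystem n A P lam" and es': "eigensystem n A' P' lam'" and "finite R"
    and A': "\<And>i j. i < n \<Longrightarrow> j < n \<Longrightarrow> A' i j = A i j + (\<Sum>l\<in>R. of_real (\<theta> l) * u l i * cnj (u l j))"
  shows "count_above n lam t \<le> count_above n lam' t + card R"
proof -
  define K where "K = {k. k < n \<and> t < lam' k}"
  have K: "finite K" by (auto simp: K_def)
  have P': "orthonormal n n P'" using es' by (simp add: eigensystem_def)
  have "count_above n lam t \<le> card (K <+> R)"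
  proof (rule count_above_le[OF es, of _ "case_sum P' u"])
    show "finite (K <+> R)" using K assms(3) by simp
    fix x assume x: "\<And>l. l \<in> K <+> R \<Longrightarrow> ip n x (case_sum P' u l) = 0"
    have xu: "ip n x (u l) = 0" if "l \<in> R" for l using x[of "Inr l"] that by auto
    have xP: "ip n x (P' k) = 0" if "k \<in> K" for k using x[of "Inl k"] that by auto
    have "qform n A x = qform n A' x"
      using qform_rank_perturbation[OF A'] xu by simp
    also have "\<dots> = (\<Sum>k<n. lam' k * (cmod (ip n x (P' k)))\<^sup>2)" by (rule qform_eigensystem[OF es'])
    also have "\<dots> \<le> (\<Sum>k<n. t * (cmod (ip n x (P' k)))\<^sup>2)"
    proof (rule sum_mono)
      fix k assume "k \<in> {..<n}"
      then show "lam' k * (cmod (ip n x (P' k)))\<^sup>2 \<le> t * (cmod (ip n x (P' k)))\<^sup>2"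
        using xP[of k] by (cases "k \<in> K") (auto simp: K_def intro!: mult_right_mono)
    qed
    also have "\<dots> = t * sqn n x" unfolding sqn_parseval[OF P'] by (simp add: sum_distrib_left)
    finally show "qform n A x \<le> t * sqn n x" .
  qed
  then show ?thesis using K assms(3) by (simp add: card_Plus count_above_def K_def)
qed

section \<open>Counts controlled by the Gram matrix of the resolvent\<close>

lemma sum_square_le_card:
  fixes f :: "'a \<Rightarrow> real"
  assumes "finite R"
  shows "(\<Sum>l\<in>R. f l)\<^sup>2 \<le> card R * (\<Sum>l\<in>R. (f l)\<^sup>2)"
  using Cauchy_Schwarz_ineq_sum[of "\<lambda>_. 1" f R] by simp

text \<open>K is G times the identity plus an error with entries at most \<epsilon>. Bounding the
  error entrywise is crude but sufficient, because \<open>card R\<close> stays fixed while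
  \<epsilon> becomes small.\<close>

lemma near_scalar_form:
  fixes K :: "'a \<Rightarrow> 'a \<Rightarrow> complex" and G \<epsilon> :: real
  assumes "finite R" "0 \<le> \<epsilon>"
    and K: "\<And>l m. l \<in> R \<Longrightarrow> m \<in> R \<Longrightarrow> cmod (K l m - (if l = m then of_real G else 0)) \<le> \<epsilon>"
  shows "Re (\<Sum>l\<in>R. \<Sum>m\<in>R. c l * cnj (c m) * K l m) \<le> G * (\<Sum>l\<in>R. (cmod (c l))\<^sup>2) + \<epsilon> * (\<Sum>l\<in>R. cmod (c l))\<^sup>2"
proof -
  define E where "E l m = K l m - (if l = m then of_real G else 0)" for l m
  have "(\<Sum>l\<in>R. \<Sum>m\<in>R. c l * cnj (c m) * K l m)
      = (\<Sum>l\<in>R. \<Sum>m\<in>R. c l * cnj (c m) * E l m) + (\<Sum>l\<in>R. \<Sum>m\<in>R. if l = m then c l * cnj (c m) * of_real G else 0)"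
    unfolding sum.distrib[symmetric] by (intro sum.cong refl) (auto simp: E_def algebra_simps)
  also have "(\<Sum>l\<in>R. \<Sum>m\<in>R. if l = m then c l * cnj (c m) * of_real G else 0) = of_real (G * (\<Sum>l\<in>R. (cmod (c l))\<^sup>2))"
    using assms(1) by (simp add: sum_distrib_left complex_norm_square[symmetric] mult.commute del: of_real_power)
  finally have eq: "Re (\<Sum>l\<in>R. \<Sum>m\<in>R. c l * cnj (c m) * K l m)
      = Re (\<Sum>l\<in>R. \<Sum>m\<in>R. c l * cnj (c m) * E l m) + G * (\<Sum>l\<in>R. (cmod (c l))\<^sup>2)" by simp
  have "Re (\<Sum>l\<in>R. \<Sum>m\<in>R. c l * cnj (c m) * E l m) \<le> (\<Sum>l\<in>R. \<Sum>m\<in>R. cmod (c l * cnj (c m) * E l m))"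
    by (intro order.trans[OF complex_Re_le_cmod] order.trans[OF norm_sum] sum_mono norm_sum)
  also have "\<dots> \<le> (\<Sum>l\<in>R. \<Sum>m\<in>R. cmod (c l) * cmod (c m) * \<epsilon>)"
    using K by (intro sum_mono) (auto simp: norm_mult E_def[symmetric] intro!: mult_left_mono)
  also have "\<dots> = \<epsilon> * (\<Sum>l\<in>R. cmod (c l))\<^sup>2"
    by (simp add: power2_eq_square sum_product sum_distrib_left mult_ac)
  finally show ?thesis using eq by simp
qed

text \<open>For \<open>g k = 1 / (t - lam k)\<close> these are the entries \<open>\<langle>R u l, u m\<rangle>\<close> with R the resolvent of A at t.\<close>
definition resolvent_gram :: "nat \<Rightarrow> (nat \<Rightarrow> nat \<Rightarrow> complex) \<Rightarrow> (nat \<Rightarrow> real) \<Rightarrow> (nat \<Rightarrow> nat \<Rightarrow> complex) \<Rightarrow> nat \<Rightarrow> nat \<Rightarrow> complex" where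
  "resolvent_gram n P g u l m = (\<Sum>k<n. of_real (g k) * (ip n (u l) (P k) * cnj (ip n (u m) (P k))))"

text \<open>Both bounds on outlier counts are computed coordinatewise in the eigenbasis; this
  identity turns closeness of the Gram matrix to a multiple of the identity into a bound on such
  coordinate sums.\<close>

lemma resolvent_gram_form:
  "(\<Sum>l\<in>R. \<Sum>m\<in>R. c l * cnj (c m) * resolvent_gram n P g u l m)
    = of_real (\<Sum>k<n. g k * (cmod (\<Sum>l\<in>R. c l * ip n (u l) (P k)))\<^sup>2)"
proof -
  define uh where "uh l k = ip n (u l) (P k)" for l k
  have "of_real (g k * (cmod (\<Sum>l\<in>R. c l * uh l k))\<^sup>2)
      = (\<Sum>l\<in>R. \<Sum>m\<in>R. c l * cnj (c m) * (of_real (g k) * (uh l k * cnj (uh m k))))" for k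
    unfolding of_real_mult complex_norm_square cnj_sum sum_product
    by (simp add: sum_distrib_left mult_ac)
  then have "of_real (\<Sum>k<n. g k * (cmod (\<Sum>l\<in>R. c l * uh l k))\<^sup>2)
      = (\<Sum>k<n. \<Sum>l\<in>R. \<Sum>m\<in>R. c l * cnj (c m) * (of_real (g k) * (uh l k * cnj (uh m k))))"
    by (simp only: of_real_sum)
  also have "\<dots> = (\<Sum>l\<in>R. \<Sum>m\<in>R. \<Sum>k<n. c l * cnj (c m) * (of_real (g k) * (uh l k * cnj (uh m k))))"
    by (rule sum_swap_last[symmetric])
  finally show ?thesis by (simp only: resolvent_gram_def uh_def sum_distrib_left)
qed

lemma cmod_diff_scaled_sq:
  "(cmod (x - of_real c * y))\<^sup>2 = (cmod x)\<^sup>2 - 2 * c * Re (cnj x * y) + c\<^sup>2 * (cmod y)\<^sup>2"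
  unfolding cmod_power2 by (simp add: algebra_simps power2_eq_square)

text \<open>On the orthogonal complement of the \<open>u l\<close> with \<open>1 / G \<le> \<theta> l\<close>, the form of \<open>t - A'\<close> is shown to be
  nonnegative by completing the square at \<open>R (\<Sum>l. \<langle>x, u l\<rangle> / G * u l)\<close>.\<close>
lemma count_above_outliers_le:
  fixes G \<epsilon> t :: real
  assumes es: "eigensystem n A P lam" and es': "eigensystem n A' P' lam'" and "finite R"
    and A': "\<And>i j. i < n \<Longrightarrow> j < n \<Longrightarrow> A' i j = A i j + (\<Sum>l\<in>R. of_real (\<theta> l) * u l i * cnj (u l j))"
    and t: "\<And>k. k < n \<Longrightarrow> lam k < t" and G: "0 < G" and e: "0 \<le> \<epsilon>"
    and K: "\<And>l m. l \<in> R \<Longrightarrow> m \<in> R \<Longrightarrow>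
      cmod (resolvent_gram n P (\<lambda>k. 1 / (t - lam k)) u l m - (if l = m then of_real G else 0)) \<le> \<epsilon>"
    and \<theta>: "\<And>l. l \<in> R \<Longrightarrow> \<theta> l < 1 / G \<Longrightarrow> \<theta> l \<le> 1 / G - \<epsilon> * card R / G\<^sup>2"
  shows "count_above n lam' t \<le> card {l \<in> R. 1 / G \<le> \<theta> l}"
proof (rule count_above_le[OF es', of _ u])
  show "finite {l \<in> R. 1 / G \<le> \<theta> l}" using assms(3) by simp
  fix x assume "\<And>l. l \<in> {l \<in> R. 1 / G \<le> \<theta> l} \<Longrightarrow> ip n x (u l) = 0"
  then have d0: "ip n x (u l) = 0" if "l \<in> R" "1 / G \<le> \<theta> l" for l using that by simp
  have P: "orthonormal n n P" using es by (simp add: eigensystem_def)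
  have qp: "qform n A' x = qform n A x + (\<Sum>l\<in>R. \<theta> l * (cmod (ip n x (u l)))\<^sup>2)"
    by (rule qform_rank_perturbation) (rule A')
  define d where "d l = ip n x (u l)" for l
  define xh where "xh k = ip n x (P k)" for k
  define uh where "uh l k = ip n (u l) (P k)" for l k
  define S where "S k = (\<Sum>l\<in>R. d l * uh l k)" for k
  define N where "N = (\<Sum>l\<in>R. (cmod (d l))\<^sup>2)"
  have d_xh: "d l = (\<Sum>k<n. xh k * cnj (uh l k))" for l
    unfolding d_def xh_def uh_def by (rule orthonormal_parseval[OF P])
  \<comment> \<open>One eigen-coordinate of the completed square:
    \<open>S k / (G * (t - lam k))\<close> is the k-th coordinate of the resolvent applied to the
    combination of the \<open>u l\<close> with coefficients \<open>d l / G\<close>.\<close>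
  have sq: "(t - lam k) * (cmod (xh k - of_real (1 / G / (t - lam k)) * S k))\<^sup>2
     = (t - lam k) * (cmod (xh k))\<^sup>2 - 2 / G * Re (cnj (xh k) * S k) + 1 / (t - lam k) * (cmod (S k))\<^sup>2 / G\<^sup>2"
    if "k < n" for k
  proof -
    have "L * (x - 2 * (1 / G / L) * y + (1 / G / L)\<^sup>2 * z) = L * x - 2 / G * y + 1 / L * z / G\<^sup>2"
      if "L > 0" for L x y z :: real
      using that G by (simp add: field_simps power2_eq_square)
    then show ?thesis unfolding cmod_diff_scaled_sq using t[OF that] by (metis diff_gt_0_iff_gt)
  qed
  have "0 \<le> (\<Sum>k<n. (t - lam k) * (cmod (xh k - of_real (1 / G / (t - lam k)) * S k))\<^sup>2)"
    using t by (intro sum_nonneg mult_nonneg_nonneg) (auto simp: less_imp_le)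
  also have "\<dots> = (\<Sum>k<n. (t - lam k) * (cmod (xh k))\<^sup>2 - 2 / G * Re (cnj (xh k) * S k)
      + 1 / (t - lam k) * (cmod (S k))\<^sup>2 / G\<^sup>2)"
    by (intro sum.cong refl sq) simp
  also have "\<dots> = (\<Sum>k<n. (t - lam k) * (cmod (xh k))\<^sup>2) - 2 / G * Re (\<Sum>k<n. cnj (xh k) * S k)
     + (\<Sum>k<n. 1 / (t - lam k) * (cmod (S k))\<^sup>2) / G\<^sup>2"
    by (simp only: sum.distrib sum_subtractf Re_sum sum_distrib_left sum_divide_distrib)
  also have "(\<Sum>k<n. cnj (xh k) * S k) = (\<Sum>l\<in>R. d l * cnj (d l))"
    unfolding S_def d_xh sum_distrib_left cnj_sum by (subst sum.swap) (simp add: mult_ac)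
  also have "\<dots> = of_real N" by (simp add: N_def complex_norm_square[symmetric] del: of_real_power)
  also have "(\<Sum>k<n. 1 / (t - lam k) * (cmod (S k))\<^sup>2)
      = Re (\<Sum>l\<in>R. \<Sum>m\<in>R. d l * cnj (d m) * resolvent_gram n P (\<lambda>k. 1 / (t - lam k)) u l m)"
    unfolding resolvent_gram_form Re_complex_of_real S_def uh_def ..
  also have "\<dots> \<le> G * N + \<epsilon> * (\<Sum>l\<in>R. cmod (d l))\<^sup>2"
    unfolding N_def by (rule near_scalar_form[OF assms(3) e K])
  also have "\<dots> \<le> G * N + \<epsilon> * (card R * N)"
    unfolding N_def using sum_square_le_card[OF assms(3)] e by (intro add_left_mono mult_left_mono)
  finally have *: "0 \<le> (\<Sum>k<n. (t - lam k) * (cmod (xh k))\<^sup>2) - 2 / G * N + (G * N + \<epsilon> * (card R * N)) / G\<^sup>2"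
    using G by (simp add: divide_right_mono)
  \<comment> \<open>For \<open>1 / G \<le> \<theta> l\<close> the term vanishes since
    \<open>d l = 0\<close>; for the other l the gap below \<open>1 / G\<close> pays for the error of
    the Gram matrix.\<close>
  have "(\<Sum>l\<in>R. \<theta> l * (cmod (d l))\<^sup>2) \<le> (\<Sum>l\<in>R. (1 / G - \<epsilon> * card R / G\<^sup>2) * (cmod (d l))\<^sup>2)"
    using \<theta> d0 by (intro sum_mono) (metis d_def linorder_not_le mult_right_mono mult_zero_right norm_zero order.refl zero_le_power2 zero_power2)
  also have "\<dots> = (1 / G - \<epsilon> * card R / G\<^sup>2) * N" by (simp add: N_def sum_distrib_left)
  also have "\<dots> = 2 / G * N - (G * N + \<epsilon> * (card R * N)) / G\<^sup>2" using G by (simp add: field_simps power2_eq_square)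
  also have "\<dots> \<le> (\<Sum>k<n. (t - lam k) * (cmod (xh k))\<^sup>2)" using * by simp
  finally have "(\<Sum>k<n. lam k * (cmod (xh k))\<^sup>2) + (\<Sum>l\<in>R. \<theta> l * (cmod (d l))\<^sup>2) \<le> t * (\<Sum>k<n. (cmod (xh k))\<^sup>2)"
    by (simp add: algebra_simps sum_subtractf sum_distrib_left)
  then show "qform n A' x \<le> t * sqn n x"
    unfolding qp qform_eigensystem[OF es] sqn_parseval[OF P] xh_def d_def by simp
qed

text \<open>The span of the vectors \<open>R u l\<close> with \<open>1 / G < \<theta> l\<close> serves as test space.\<close>
lemma count_above_outliers_ge:
  fixes G \<epsilon> t \<Theta> :: real
  assumes es: "eigensystem n A P lam" and es': "eigensystem n A' P' lam'" and R: "finite R"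
    and A': "\<And>i j. i < n \<Longrightarrow> j < n \<Longrightarrow> A' i j = A i j + (\<Sum>l\<in>R. of_real (\<theta> l) * u l i * cnj (u l j))"
    and t: "\<And>k. k < n \<Longrightarrow> lam k < t" and G: "0 < G" and e: "0 \<le> \<epsilon>" "\<epsilon> \<le> 1"
    and K: "\<And>l m. l \<in> R \<Longrightarrow> m \<in> R \<Longrightarrow>
      cmod (resolvent_gram n P (\<lambda>k. 1 / (t - lam k)) u l m - (if l = m then of_real G else 0)) \<le> \<epsilon>"
    and \<Theta>: "\<And>l. l \<in> R \<Longrightarrow> \<bar>\<theta> l\<bar> \<le> \<Theta>"
    and \<theta>: "\<And>l. l \<in> R \<Longrightarrow> 1 / G < \<theta> l \<Longrightarrow> G + \<epsilon> * (1 + 2 * G * \<Theta> + card R * \<Theta>) * card R < G\<^sup>2 * \<theta> l"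
  shows "card {l \<in> R. 1 / G < \<theta> l} \<le> count_above n lam' t"
proof -
  define I where "I = {l \<in> R. 1 / G < \<theta> l}"
  have I: "finite I" "I \<subseteq> R" using R by (auto simp: I_def)
  have P: "orthonormal n n P" using es by (simp add: eigensystem_def)
  have qp: "qform n A' x = qform n A x + (\<Sum>l\<in>R. \<theta> l * (cmod (ip n x (u l)))\<^sup>2)" for x
    by (rule qform_rank_perturbation) (rule A')
  define uh where "uh l k = ip n (u l) (P k)" for l k
  define g where "g k = 1 / (t - lam k)" for k
  define KK where "KK = resolvent_gram n P g u"
  have K': "cmod (KK l m - (if l = m then of_real G else 0)) \<le> \<epsilon>" if "l \<in> R" "m \<in> R" for l m
    using K[OF that] unfolding KK_def g_def[abs_def] .
  \<comment> \<open>The resolvent applied to \<open>u i\<close>, given by its coordinates in the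
    eigenbasis.\<close>
  define w where "w i j = (\<Sum>k<n. (of_real (g k) * uh i k) * P k j)" for i j
  have "card I \<le> count_above n lam' t"
  proof (rule le_count_above[OF es' I(1), of _ w])
    fix c :: "nat \<Rightarrow> complex" assume c: "\<exists>i\<in>I. c i \<noteq> 0"
    define x where "x = (\<lambda>j. \<Sum>i\<in>I. c i * w i j)"
    define S where "S k = (\<Sum>i\<in>I. c i * uh i k)" for k
    define N where "N = (\<Sum>l\<in>I. (cmod (c l))\<^sup>2)"
    define s where "s = (\<Sum>l\<in>I. cmod (c l))"
    define d where "d l = ip n x (u l)" for l
    have N: "N > 0" using c I(1) unfolding N_def by (auto intro!: sum_pos2)
    have s: "s \<ge> 0" "s\<^sup>2 \<le> card R * N"
    proof -
      show "s \<ge> 0" by (simp add: s_def sum_nonneg)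
      have "s\<^sup>2 \<le> card I * N" unfolding s_def N_def by (rule sum_square_le_card[OF I(1)])
      also have "\<dots> \<le> card R * N" using N card_mono[OF R I(2)] by (intro mult_right_mono) auto
      finally show "s\<^sup>2 \<le> card R * N" .
    qed
    have xh: "ip n x (P k) = of_real (g k) * S k" if "k < n" for k
    proof -
      have "ip n (w i) (P k) = of_real (g k) * uh i k" for i
        unfolding w_def using ip_orthonormal_combination[OF P order.refl that, of "\<lambda>k. of_real (g k) * uh i k"] that by simp
      then show ?thesis by (simp add: x_def ip_sum_left S_def sum_distrib_left mult_ac)
    qed
    \<comment> \<open>Since x is the resolvent applied to a combination of the \<open>u i\<close>,
      its inner products with the \<open>u l\<close> are again made of Gram entries, hence close to
      G times the coefficients.\<close>
    have d: "d l = (\<Sum>i\<in>I. c i * KK i l)" for l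
    proof -
      have "d l = (\<Sum>k<n. ip n x (P k) * cnj (ip n (u l) (P k)))"
        unfolding d_def by (rule orthonormal_parseval[OF P])
      also have "\<dots> = (\<Sum>k<n. of_real (g k) * S k * cnj (uh l k))"
        by (intro sum.cong refl) (simp add: xh uh_def)
      also have "\<dots> = (\<Sum>k<n. \<Sum>i\<in>I. c i * (of_real (g k) * (uh i k * cnj (uh l k))))"
        by (simp add: S_def sum_distrib_left sum_distrib_right mult_ac)
      also have "\<dots> = (\<Sum>i\<in>I. c i * KK i l)"
        by (subst sum.swap) (simp add: KK_def resolvent_gram_def uh_def sum_distrib_left)
      finally show ?thesis .
    qed
    have "(\<Sum>k<n. (t - lam k) * (cmod (ip n x (P k)))\<^sup>2) = (\<Sum>k<n. g k * (cmod (S k))\<^sup>2)"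
    proof (intro sum.cong refl)
      fix k assume "k \<in> {..<n}"
      then show "(t - lam k) * (cmod (ip n x (P k)))\<^sup>2 = g k * (cmod (S k))\<^sup>2"
        using t[of k] by (simp add: xh norm_mult power_mult_distrib) (simp add: g_def power2_eq_square)
    qed
    also have "\<dots> = Re (\<Sum>i\<in>I. \<Sum>m\<in>I. c i * cnj (c m) * KK i m)"
      unfolding KK_def resolvent_gram_form Re_complex_of_real S_def uh_def ..
    also have "\<dots> \<le> G * N + \<epsilon> * s\<^sup>2"
      unfolding N_def s_def by (rule near_scalar_form[OF I(1) e(1)], rule K') (use I(2) in blast)+
    finally have lhs: "(\<Sum>k<n. (t - lam k) * (cmod (ip n x (P k)))\<^sup>2) \<le> G * N + \<epsilon> * s\<^sup>2" .
    have \<Theta>0: "0 \<le> \<Theta>" using c I(2) \<Theta> by force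
    define q where "q l = (if l \<in> I then c l else 0)" for l
    have dq: "cmod (d l - of_real G * q l) \<le> \<epsilon> * s" if l: "l \<in> R" for l
    proof -
      have "d l - of_real G * q l = (\<Sum>i\<in>I. c i * (KK i l - (if i = l then of_real G else 0)))"
      proof -
        have "(\<Sum>i\<in>I. c i * (KK i l - (if i = l then of_real G else 0)))
          = (\<Sum>i\<in>I. c i * KK i l) - (\<Sum>i\<in>I. if i = l then c i * of_real G else 0)"
          unfolding sum_subtractf[symmetric] by (intro sum.cong) (auto simp: algebra_simps)
        then show ?thesis using I(1) by (simp add: d q_def mult.commute)
      qed
      also have "cmod \<dots> \<le> (\<Sum>i\<in>I. cmod (c i) * \<epsilon>)"
        by (intro order.trans[OF norm_sum] sum_mono, unfold norm_mult, intro mult_left_mono K')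
          (use I(2) l in auto)
      finally show ?thesis by (simp add: s_def sum_distrib_left mult.commute)
    qed
    \<comment> \<open>The sum to be bounded runs over all of R, but only l in I carry a coefficient.
      For these \<open>d l\<close> is close to \<open>G * c l\<close>; for the others it is of size
      \<open>\<epsilon> * s\<close>, and a negative \<open>\<theta> l\<close> costs at most
      \<open>\<Theta> * \<epsilon> * s\<^sup>2\<close>.\<close>
    have dl: "\<theta> l * (cmod (d l))\<^sup>2 \<ge> (if l \<in> I then \<theta> l * G\<^sup>2 * (cmod (c l))\<^sup>2 - 2 * G * \<Theta> * \<epsilon> * s * cmod (c l) else 0)
        - \<Theta> * \<epsilon> * s\<^sup>2" if l: "l \<in> R" for l
    proof (cases "l \<in> I")
      case True
      have "0 < 1 / G" using G by simp
      then have th: "0 < \<theta> l" "\<theta> l \<le> \<Theta>"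
        using True \<Theta>[OF l] less_trans[of 0 "1 / G" "\<theta> l"] unfolding I_def by auto
      have "G * cmod (c l) - cmod (d l) \<le> \<epsilon> * s"
        using dq[OF l] norm_triangle_ineq2[of "of_real G * q l" "d l"] True G
        by (simp add: q_def norm_mult norm_minus_commute)
      then have "(G * cmod (c l))\<^sup>2 \<le> (cmod (d l) + \<epsilon> * s)\<^sup>2" using G by (intro power_mono) auto
      \<comment> \<open>Squaring \<open>G * cmod (c l) - \<epsilon> * s \<le> cmod (d l)\<close> is
        legitimate only if the left side is nonnegative; otherwise the claimed lower bound is itself
        nonpositive.\<close>
      moreover have "(G * cmod (c l))\<^sup>2 - 2 * (G * cmod (c l)) * (\<epsilon> * s) \<le> (cmod (d l))\<^sup>2"
      proof (cases "G * cmod (c l) \<le> \<epsilon> * s")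
        case True
        have "(G * cmod (c l)) * (G * cmod (c l)) \<le> (G * cmod (c l)) * (\<epsilon> * s)"
          using True G by (intro mult_left_mono) auto
        moreover have "0 \<le> (G * cmod (c l)) * (\<epsilon> * s)" using G e(1) s(1) by simp
        moreover have "0 \<le> cmod (d l) * cmod (d l)" by simp
        ultimately show ?thesis unfolding power2_eq_square by linarith
      next
        case False
        then have "(G * cmod (c l) - \<epsilon> * s)\<^sup>2 \<le> (cmod (d l))\<^sup>2"
          using \<open>G * cmod (c l) - cmod (d l) \<le> \<epsilon> * s\<close> by (intro power_mono) auto
        moreover have "(G * cmod (c l) - \<epsilon> * s)\<^sup>2 = (G * cmod (c l))\<^sup>2 - 2 * (G * cmod (c l)) * (\<epsilon> * s) + (\<epsilon> * s)\<^sup>2"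
          by (simp add: power2_eq_square algebra_simps)
        ultimately show ?thesis by (smt (verit) zero_le_power2)
      qed
      ultimately have "\<theta> l * ((G * cmod (c l))\<^sup>2 - 2 * (G * cmod (c l)) * (\<epsilon> * s)) \<le> \<theta> l * (cmod (d l))\<^sup>2"
        using th by (intro mult_left_mono) auto
      moreover have "\<theta> l * (2 * (G * cmod (c l)) * (\<epsilon> * s)) \<le> \<Theta> * (2 * (G * cmod (c l)) * (\<epsilon> * s))"
        using th G e(1) s(1) by (intro mult_right_mono) auto
      moreover have "0 \<le> \<Theta> * \<epsilon> * s\<^sup>2" using \<Theta>0 e(1) by simp
      ultimately show ?thesis using True by (simp add: algebra_simps power_mult_distrib)
    next
      case False
      have "cmod (d l) \<le> \<epsilon> * s" using dq[OF l] False by (simp add: q_def)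
      then have "(cmod (d l))\<^sup>2 \<le> (\<epsilon> * s)\<^sup>2" by (intro power_mono) auto
      also have "\<dots> \<le> \<epsilon> * s\<^sup>2"
        using e mult_left_le_one_le[of \<epsilon> \<epsilon>] unfolding power_mult_distrib
        by (intro mult_right_mono) (auto simp: power2_eq_square)
      finally have "\<Theta> * (cmod (d l))\<^sup>2 \<le> \<Theta> * (\<epsilon> * s\<^sup>2)" using \<Theta>0 by (rule mult_left_mono)
      moreover have "- (\<Theta> * (cmod (d l))\<^sup>2) \<le> \<theta> l * (cmod (d l))\<^sup>2"
        using mult_right_mono[of "- \<Theta>" "\<theta> l" "(cmod (d l))\<^sup>2"] \<Theta>[OF l] by auto
      ultimately show ?thesis using False by simp
    qed
    have "(\<Sum>l\<in>I. \<theta> l * G\<^sup>2 * (cmod (c l))\<^sup>2) - 2 * G * \<Theta> * \<epsilon> * s\<^sup>2 - card R * \<Theta> * \<epsilon> * s\<^sup>2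
      = (\<Sum>l\<in>R. (if l \<in> I then \<theta> l * G\<^sup>2 * (cmod (c l))\<^sup>2 - 2 * G * \<Theta> * \<epsilon> * s * cmod (c l) else 0) - \<Theta> * \<epsilon> * s\<^sup>2)"
    proof -
      have "(\<Sum>l\<in>R. if l \<in> I then \<theta> l * G\<^sup>2 * (cmod (c l))\<^sup>2 - 2 * G * \<Theta> * \<epsilon> * s * cmod (c l) else 0)
        = (\<Sum>l\<in>I. \<theta> l * G\<^sup>2 * (cmod (c l))\<^sup>2 - 2 * G * \<Theta> * \<epsilon> * s * cmod (c l))"
        using R I(2) by (intro sum.mono_neutral_cong_right) auto
      also have "\<dots> = (\<Sum>l\<in>I. \<theta> l * G\<^sup>2 * (cmod (c l))\<^sup>2) - 2 * G * \<Theta> * \<epsilon> * s * s"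
        by (simp add: sum_subtractf s_def sum_distrib_left)
      finally show ?thesis by (simp add: sum_subtractf power2_eq_square)
    qed
    also have "\<dots> \<le> (\<Sum>l\<in>R. \<theta> l * (cmod (d l))\<^sup>2)"
      using dl by (intro sum_mono)
    finally have rhs: "(\<Sum>l\<in>I. \<theta> l * G\<^sup>2 * (cmod (c l))\<^sup>2) - (2 * G * \<Theta> + card R * \<Theta>) * \<epsilon> * s\<^sup>2
        \<le> (\<Sum>l\<in>R. \<theta> l * (cmod (d l))\<^sup>2)" by (simp add: algebra_simps)
    \<comment> \<open>Three losses are collected: 1 from the resolvent form,
      \<open>2 * G * \<Theta>\<close> from the cross terms for l in I, and
      \<open>card R * \<Theta>\<close> from the constant loss at every l in R. A further factor
      \<open>card R\<close> converts \<open>s\<^sup>2\<close> into N.\<close>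
    define B where "B = \<epsilon> * (1 + 2 * G * \<Theta> + card R * \<Theta>)"
    have B: "0 \<le> B" using e(1) G \<Theta>0 by (simp add: B_def)
    obtain p where p: "p \<in> I" "c p \<noteq> 0" using c by blast
    have "(\<Sum>l\<in>I. (G + B * card R) * (cmod (c l))\<^sup>2) < (\<Sum>l\<in>I. \<theta> l * G\<^sup>2 * (cmod (c l))\<^sup>2)"
    proof (rule sum_strict_mono_ex1[OF I(1)])
      have *: "G + B * card R < \<theta> l * G\<^sup>2" if "l \<in> I" for l
        using \<theta>[of l] that by (simp add: I_def B_def mult.commute)
      then show "\<forall>l\<in>I. (G + B * card R) * (cmod (c l))\<^sup>2 \<le> \<theta> l * G\<^sup>2 * (cmod (c l))\<^sup>2"
        by (intro ballI mult_right_mono) (auto simp: less_imp_le)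
      show "\<exists>l\<in>I. (G + B * card R) * (cmod (c l))\<^sup>2 < \<theta> l * G\<^sup>2 * (cmod (c l))\<^sup>2"
        using p *[OF p(1)] by (intro bexI[of _ p] mult_strict_right_mono) auto
    qed
    then have "G * N + B * (card R * N) < (\<Sum>l\<in>I. \<theta> l * G\<^sup>2 * (cmod (c l))\<^sup>2)"
      by (simp add: N_def sum_distrib_left algebra_simps sum.distrib)
    moreover have "B * s\<^sup>2 \<le> B * (card R * N)" using s(2) B by (rule mult_left_mono)
    moreover have "B * s\<^sup>2 = \<epsilon> * s\<^sup>2 + (2 * G * \<Theta> + card R * \<Theta>) * \<epsilon> * s\<^sup>2" by (simp add: B_def algebra_simps)
    ultimately have "(\<Sum>k<n. (t - lam k) * (cmod (ip n x (P k)))\<^sup>2) < (\<Sum>l\<in>R. \<theta> l * (cmod (d l))\<^sup>2)"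
      using lhs rhs by linarith
    then have "t * (\<Sum>k<n. (cmod (ip n x (P k)))\<^sup>2)
        < (\<Sum>k<n. lam k * (cmod (ip n x (P k)))\<^sup>2) + (\<Sum>l\<in>R. \<theta> l * (cmod (d l))\<^sup>2)"
      by (simp add: algebra_simps sum_subtractf sum_distrib_left)
    then have "t * sqn n x < qform n A' x"
      unfolding qp qform_eigensystem[OF es] sqn_parseval[OF P] d_def by simp
    then show "t * sqn n (\<lambda>j. \<Sum>i\<in>I. c i * w i j) < qform n A' (\<lambda>j. \<Sum>i\<in>I. c i * w i j)"
      by (simp add: x_def)
  qed
  then show ?thesis by (simp add: I_def)
qed

section \<open>Moments from the logarithmic Sobolev inequality\<close>

text \<open>Applied to g itself, the logarithmic Sobolev inequality bounds the entropy of \<open>g\<^sup>2\<close>; the tangent-line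
  bound \<open>ln t \<le> t - 1\<close> at \<open>t = E g\<^sup>2 / (g * E g)\<close> bounds that entropy from below.\<close>
lemma log_sobolev_second_moment_le:
  fixes g :: "complex \<Rightarrow> real"
  assumes "prob_space \<nu>" and sets: "sets \<nu> = sets borel" and lsi: "log_sobolev \<nu> c" and c: "0 < c"
    and der: "\<And>z. (g has_derivative g' z) (at z)"
    and g: "\<And>z. \<delta> \<le> g z" "\<And>z. g z \<le> B" and \<delta>: "0 < \<delta>"
    and grad: "\<And>z. (g' z 1)\<^sup>2 + (g' z \<i>)\<^sup>2 \<le> K * (g z)\<^sup>2"
  shows "(\<integral>z. (g z)\<^sup>2 \<partial>\<nu>) \<le> (\<integral>z. g z \<partial>\<nu>)\<^sup>2 * exp (2 * c * K)"
proof -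
  interpret prob_space \<nu> by fact
  have g0: "0 < g z" for z using g(1)[of z] \<delta> by linarith
  have "continuous_on UNIV g"
    using der has_derivative_continuous by (intro continuous_at_imp_continuous_on) blast
  then have meas[measurable]: "g \<in> borel_measurable \<nu>"
    using borel_measurable_continuous_onI sets by (metis measurable_cong_sets)
  have int_g: "integrable \<nu> g"
    by (rule integrable_const_bound[where B = B]) (use g0 g(2) in \<open>auto simp: abs_of_pos\<close>)
  have int_g2: "integrable \<nu> (\<lambda>z. (g z)\<^sup>2)"
    by (rule integrable_const_bound[where B = "B\<^sup>2"]) (use g0 g(2) in \<open>auto intro!: AE_I2 power_mono intro: less_imp_le\<close>)
  define m where "m = (\<integral>z. (g z)\<^sup>2 \<partial>\<nu>)"
  define s where "s = (\<integral>z. g z \<partial>\<nu>)"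
  have "\<delta>\<^sup>2 \<le> m"
    unfolding m_def using g(1) \<delta> by (intro integral_ge_const int_g2 AE_I2 power_mono) auto
  then have m: "0 < m" using \<delta> by (smt (verit) zero_less_power)
  have "\<delta> \<le> s" unfolding s_def using g(1) by (intro integral_ge_const int_g AE_I2) auto
  then have s: "0 < s" using \<delta> by simp
  have "0 \<le> K * (g 0)\<^sup>2" using order.trans[OF _ grad[of 0]] by simp
  then have K: "0 \<le> K" using g0[of 0] by (simp add: zero_le_mult_iff)
  have "(\<integral>\<^sup>+ z. ennreal ((g' z 1)\<^sup>2 + (g' z \<i>)\<^sup>2) \<partial>\<nu>) \<le> (\<integral>\<^sup>+ z. ennreal (K * (g z)\<^sup>2) \<partial>\<nu>)"
    using grad by (intro nn_integral_mono ennreal_leI) auto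
  also have "\<dots> = ennreal (\<integral>z. K * (g z)\<^sup>2 \<partial>\<nu>)"
    using int_g2 K by (intro nn_integral_eq_integral) auto
  also have "\<dots> < \<infinity>" by simp
  finally have "integrable \<nu> (\<lambda>z. (g z)\<^sup>2 * ln ((g z)\<^sup>2 / m)) \<and>
      (\<integral>z. (g z)\<^sup>2 * ln ((g z)\<^sup>2 / m) \<partial>\<nu>) \<le> 2 * c * (\<integral>z. (g' z 1)\<^sup>2 + (g' z \<i>)\<^sup>2 \<partial>\<nu>)"
    using lsi der int_g2 unfolding log_sobolev_def Let_def m_def by blast
  then have ent: "integrable \<nu> (\<lambda>z. (g z)\<^sup>2 * ln ((g z)\<^sup>2 / m))"
      "(\<integral>z. (g z)\<^sup>2 * ln ((g z)\<^sup>2 / m) \<partial>\<nu>) \<le> 2 * c * (\<integral>z. (g' z 1)\<^sup>2 + (g' z \<i>)\<^sup>2 \<partial>\<nu>)"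
    by auto
  have "(\<integral>z. (g' z 1)\<^sup>2 + (g' z \<i>)\<^sup>2 \<partial>\<nu>) \<le> (\<integral>z. K * (g z)\<^sup>2 \<partial>\<nu>)"
    using int_g2 K by (intro integral_mono' grad) auto
  also have "\<dots> = K * m" by (simp add: m_def)
  finally have "2 * c * (\<integral>z. (g' z 1)\<^sup>2 + (g' z \<i>)\<^sup>2 \<partial>\<nu>) \<le> 2 * c * (K * m)"
    using c by (intro mult_left_mono) auto
  with ent(2) have upper: "(\<integral>z. (g z)\<^sup>2 * ln ((g z)\<^sup>2 / m) \<partial>\<nu>) \<le> 2 * c * (K * m)"
    by (rule order.trans)
  have pt: "(g z)\<^sup>2 * (ln m - 2 * ln s) - 2 * m / s * g z + 2 * (g z)\<^sup>2 \<le> (g z)\<^sup>2 * ln ((g z)\<^sup>2 / m)" for z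
  proof -
    have "ln (m / (s * g z)) \<le> m / (s * g z) - 1"
      using m s g0[of z] by (intro ln_le_minus_one) simp
    then have "ln m - ln s - ln (g z) \<le> m / (s * g z) - 1"
      using m s g0[of z] by (simp add: ln_div ln_mult)
    then have "(g z)\<^sup>2 * (2 * (ln m - ln s - ln (g z))) \<le> (g z)\<^sup>2 * (2 * (m / (s * g z) - 1))"
      by (intro mult_left_mono) auto
    moreover have "(g z)\<^sup>2 * (2 * (m / (s * g z) - 1)) = 2 * m / s * g z - 2 * (g z)\<^sup>2"
      using g0[of z] s by (simp add: field_simps power2_eq_square)
    moreover have "(g z)\<^sup>2 * ln ((g z)\<^sup>2 / m) = (g z)\<^sup>2 * (2 * ln (g z) - ln m)"
      using m g0[of z] by (simp add: ln_div ln_realpow)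
    ultimately show ?thesis by (simp add: algebra_simps)
  qed
  \<comment> \<open>The last two terms integrate to \<open>- 2 * m\<close> and \<open>2 * m\<close>
    and cancel; this is what the choice of the tangent point achieves.\<close>
  have "m * (ln m - 2 * ln s) = (\<integral>z. (g z)\<^sup>2 * (ln m - 2 * ln s) - 2 * m / s * g z + 2 * (g z)\<^sup>2 \<partial>\<nu>)"
    using int_g int_g2 s by (simp add: m_def[symmetric] s_def[symmetric])
  also have "\<dots> \<le> (\<integral>z. (g z)\<^sup>2 * ln ((g z)\<^sup>2 / m) \<partial>\<nu>)"
    using int_g int_g2 ent(1) pt by (intro integral_mono) auto
  also note upper
  finally have "m * (ln m - 2 * ln s) \<le> m * (2 * c * K)" by (simp add: mult_ac)
  then have "ln m \<le> 2 * ln s + 2 * c * K" using m by simp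
  then have "m \<le> exp (2 * ln s + 2 * c * K)" using m by (metis exp_le_cancel_iff exp_ln)
  also have "\<dots> = s\<^sup>2 * exp (2 * c * K)" using s by (simp add: exp_add exp_double)
  finally show ?thesis by (simp add: m_def s_def)
qed

text \<open>The truncation \<open>F e\<close> of \<open>1 + (cmod z)\<^sup>2\<close> is chosen so that its gradient is bounded by a multiple of
  \<open>F e\<close> itself; applying the previous lemma to \<open>F e\<close> and to its square gives bounds uniform in e.\<close>
lemma assumption_A1_eighth_moment:
  assumes A1: "assumption_A1 \<nu>"
  shows "integrable \<nu> (\<lambda>z. cmod z ^ 8)"
proof -
  from A1 interpret prob_space \<nu> by (simp add: assumption_A1_def)
  have sets: "sets \<nu> = sets borel" and int2: "integrable \<nu> (\<lambda>z. (cmod z)\<^sup>2)" "(\<integral>z. (cmod z)\<^sup>2 \<partial>\<nu>) = 1"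
    using A1 by (auto simp: assumption_A1_def)
  obtain c where c: "0 < c" "log_sobolev \<nu> c" using A1 by (auto simp: assumption_A1_def)
  have [measurable_cong]: "sets \<nu> = sets borel" by fact
  define w where "w z = 1 + z \<bullet> z" for z :: complex
  have w1: "1 \<le> w z" for z by (simp add: w_def)
  have w_eq: "w z = 1 + (cmod z)\<^sup>2" for z by (simp add: w_def power2_norm_eq_inner)
  have w_meas[measurable]: "w \<in> borel_measurable borel" unfolding w_def by measurable
  \<comment> \<open>For 0 < e and e at most 1 the values lie between 1 / 2 and 1 / e and never
    exceed w; as e tends to 0 they tend to w.\<close>
  define F where "F e z = w z / (1 + e * w z)" for e z
  \<comment> \<open>The 2 is the mean of w, which bounds that of \<open>F e\<close>; 8 and 32 are
    the gradient constants of \<open>F e\<close> and of its square, derived below.\<close>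
  define C where "C = (2\<^sup>2 * exp (2 * c * 8))\<^sup>2 * exp (2 * c * 32)"
  have bound: "(\<integral>z. (F e z) ^ 4 \<partial>\<nu>) \<le> C" "integrable \<nu> (\<lambda>z. (F e z) ^ 4)" if e: "0 < e" "e \<le> 1" for e
  proof -
    have den: "1 \<le> 1 + e * w z" "0 < 1 + e * w z" for z
      using e w1[of z] by (auto intro: add_pos_nonneg)
    have F_lower: "1 / 2 \<le> F e z" for z
    proof -
      have "e * w z \<le> w z" using e w1[of z] by (simp add: mult_left_le_one_le)
      then have "1 + e * w z \<le> 2 * w z" using w1[of z] by linarith
      then show ?thesis using den[of z] by (simp add: F_def field_simps)
    qed
    have F_upper: "F e z \<le> 1 / e" for z using den[of z] e by (simp add: F_def field_simps)
    have F_le_w: "F e z \<le> w z" for z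
      using den[of z] w1[of z] e by (simp add: F_def divide_le_eq mult_le_cancel_left1)
    define F' where "F' z h = 2 * (z \<bullet> h) / (1 + e * w z)\<^sup>2" for z h
    have der: "(F e has_derivative F' z) (at z)" for z
      unfolding F_def[abs_def] F'_def[abs_def] w_def using den(2)[of z]
      by (auto intro!: derivative_eq_intros simp: w_def inner_commute field_simps power2_eq_square)
    have grad: "(F' z 1)\<^sup>2 + (F' z \<i>)\<^sup>2 \<le> 8 * (F e z)\<^sup>2" for z
    proof -
      have "(F' z 1)\<^sup>2 + (F' z \<i>)\<^sup>2 = 4 * (z \<bullet> z) / (1 + e * w z) ^ 4"
        by (simp add: F'_def inner_complex_def power_divide power_mult_distrib add_divide_distrib[symmetric])
          (simp add: power2_eq_square algebra_simps)
      also have "\<dots> \<le> 4 * w z / (1 + e * w z) ^ 4"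
        using den[of z] by (intro divide_right_mono) (auto simp: w_def)
      also have "\<dots> \<le> 4 * w z / (1 + e * w z)"
      proof -
        have "(1 + e * w z) ^ 1 \<le> (1 + e * w z) ^ 4" using den[of z] by (intro power_increasing) auto
        then show ?thesis using den[of z] w1[of z] by (intro divide_left_mono) auto
      qed
      also have "\<dots> = 4 * F e z" by (simp add: F_def)
      \<comment> \<open>The lower bound 1 / 2 on \<open>F e\<close> turns the linear bound into the
        quadratic one that the entropy argument requires.\<close>
      also have "\<dots> \<le> 4 * (F e z * (2 * F e z))"
        using F_lower[of z] by (intro mult_left_mono) (auto simp: mult_le_cancel_left1)
      finally show ?thesis by (simp add: power2_eq_square)
    qed
    have s1: "(\<integral>z. (F e z)\<^sup>2 \<partial>\<nu>) \<le> (\<integral>z. F e z \<partial>\<nu>)\<^sup>2 * exp (2 * c * 8)"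
      by (rule log_sobolev_second_moment_le[OF prob_space_axioms sets c(2,1) der F_lower F_upper _ grad]) simp
    have der2: "((\<lambda>z. (F e z)\<^sup>2) has_derivative (\<lambda>h. 2 * F e z * F' z h)) (at z)" for z
      using der[of z] by (auto intro!: derivative_eq_intros)
    have grad2: "(2 * F e z * F' z 1)\<^sup>2 + (2 * F e z * F' z \<i>)\<^sup>2 \<le> 32 * ((F e z)\<^sup>2)\<^sup>2" for z
    proof -
      have "(2 * F e z * F' z 1)\<^sup>2 + (2 * F e z * F' z \<i>)\<^sup>2 = 4 * (F e z)\<^sup>2 * ((F' z 1)\<^sup>2 + (F' z \<i>)\<^sup>2)"
        by (simp add: power_mult_distrib algebra_simps)
      also have "\<dots> \<le> 4 * (F e z)\<^sup>2 * (8 * (F e z)\<^sup>2)" using grad by (intro mult_left_mono) auto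
      finally show ?thesis by (simp add: power2_eq_square)
    qed
    have F0: "0 \<le> F e z" for z using F_lower[of z] by linarith
    have s2: "(\<integral>z. ((F e z)\<^sup>2)\<^sup>2 \<partial>\<nu>) \<le> (\<integral>z. (F e z)\<^sup>2 \<partial>\<nu>)\<^sup>2 * exp (2 * c * 32)"
    proof (rule log_sobolev_second_moment_le[OF prob_space_axioms sets c(2,1) der2 _ _ _ grad2])
      show "(1 / 2)\<^sup>2 \<le> (F e z)\<^sup>2" for z using F_lower by (intro power_mono) auto
      show "(F e z)\<^sup>2 \<le> (1 / e)\<^sup>2" for z using F_upper F0 by (intro power_mono) auto
    qed simp
    have F_meas[measurable]: "F e \<in> borel_measurable borel" unfolding F_def by measurable
    have int_w: "integrable \<nu> w" unfolding w_eq[abs_def] using int2 by simp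
    have "(\<integral>z. F e z \<partial>\<nu>) \<le> (\<integral>z. w z \<partial>\<nu>)"
      using F_le_w w1 by (intro integral_mono' int_w) (auto intro: order.trans[OF zero_le_one])
    also have "\<dots> = 2" unfolding w_eq using int2 prob_space by simp
    finally have "(\<integral>z. F e z \<partial>\<nu>)\<^sup>2 \<le> 2\<^sup>2" using F0 by (intro power_mono) auto
    then have "(\<integral>z. (F e z)\<^sup>2 \<partial>\<nu>) \<le> 2\<^sup>2 * exp (2 * c * 8)"
      using s1 by (smt (verit) exp_ge_zero mult_right_mono)
    then have "(\<integral>z. (F e z)\<^sup>2 \<partial>\<nu>)\<^sup>2 \<le> (2\<^sup>2 * exp (2 * c * 8))\<^sup>2" by (intro power_mono) auto
    then have "(\<integral>z. (F e z)\<^sup>2 \<partial>\<nu>)\<^sup>2 * exp (2 * c * 32) \<le> C"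
      unfolding C_def by (intro mult_right_mono) auto
    then show "(\<integral>z. (F e z) ^ 4 \<partial>\<nu>) \<le> C" using s2 by (simp add: power_mult[symmetric])
    show "integrable \<nu> (\<lambda>z. (F e z) ^ 4)"
      by (rule integrable_const_bound[where B = "(1 / e) ^ 4"])
        (use F0 F_upper in \<open>auto intro!: AE_I2 power_mono simp: power_abs\<close>)
  qed
  define e where "e n = 1 / real (Suc n)" for n
  have e: "0 < e n" "e n \<le> 1" for n by (auto simp: e_def)
  have lim: "(\<lambda>n. ennreal ((F (e n) z) ^ 4)) \<longlonglongrightarrow> ennreal ((w z) ^ 4)" for z
  proof -
    have "e \<longlonglongrightarrow> 0" unfolding e_def by (rule LIMSEQ_Suc[OF lim_const_over_n])
    then have "(\<lambda>n. (w z / (1 + e n * w z)) ^ 4) \<longlonglongrightarrow> (w z / (1 + 0 * w z)) ^ 4"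
      by (intro tendsto_intros) auto
    then show ?thesis unfolding F_def by (intro tendsto_ennrealI) simp
  qed
  \<comment> \<open>Fatou's lemma along e = 1, 1/2, 1/3, ... carries the uniform bound over to the
    untruncated w.\<close>
  have "(\<integral>\<^sup>+ z. ennreal ((w z) ^ 4) \<partial>\<nu>) = (\<integral>\<^sup>+ z. liminf (\<lambda>n. ennreal ((F (e n) z) ^ 4)) \<partial>\<nu>)"
    using lim_imp_Liminf[OF sequentially_bot lim] by simp
  also have "\<dots> \<le> liminf (\<lambda>n. \<integral>\<^sup>+ z. ennreal ((F (e n) z) ^ 4) \<partial>\<nu>)"
    unfolding F_def by (intro nn_integral_liminf) measurable
  also have "\<dots> \<le> liminf (\<lambda>n::nat. ennreal C)"
  proof (intro Liminf_mono always_eventually allI)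
    fix n
    have "(\<integral>\<^sup>+ z. ennreal ((F (e n) z) ^ 4) \<partial>\<nu>) = ennreal (\<integral>z. (F (e n) z) ^ 4 \<partial>\<nu>)"
      using bound(2)[OF e] by (intro nn_integral_eq_integral) auto
    then show "(\<integral>\<^sup>+ z. ennreal ((F (e n) z) ^ 4) \<partial>\<nu>) \<le> ennreal C"
      using bound(1)[OF e] by (simp add: ennreal_leI)
  qed
  also have "\<dots> < \<infinity>" by (simp add: Liminf_const)
  finally have "integrable \<nu> (\<lambda>z. (w z) ^ 4)"
    by (intro integrableI_nonneg) auto
  then show ?thesis
  proof (rule Bochner_Integration.integrable_bound)
    show "AE z in \<nu>. norm (cmod z ^ 8) \<le> norm ((w z) ^ 4)"
    proof (rule AE_I2)
      fix z
      have "((cmod z)\<^sup>2) ^ 4 \<le> (w z) ^ 4" by (intro power_mono) (auto simp: w_eq)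
      then show "norm (cmod z ^ 8) \<le> norm ((w z) ^ 4)"
        using w1[of z] by (simp add: power_mult[symmetric])
    qed
  qed measurable
qed

section \<open>Fourth moments of linear and bilinear forms\<close>

text \<open>The term with \<open>Re (cnj S * D)\<close> keeps its exact form because it will have
  mean zero; the rest is only bounded. The terms with \<open>p\<^sup>2\<close> and
  \<open>p * b\<close> are absorbed through \<open>p\<^sup>2 \<le> a * b\<close>, giving 4 + 2 + 2 =
  8 and 1 + 2 = 3.\<close>

lemma cmod_add_fourth_le:
  "cmod (S + D) ^ 4 \<le> cmod S ^ 4 + 4 * ((cmod S)\<^sup>2 * Re (cnj S * D)) + 8 * ((cmod S)\<^sup>2 * (cmod D)\<^sup>2) + 3 * cmod D ^ 4"
proof -
  define a b p where "a = (cmod S)\<^sup>2" and "b = (cmod D)\<^sup>2" and "p = Re (cnj S * D)"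
  have "\<bar>p\<bar> \<le> cmod S * cmod D" unfolding p_def using abs_Re_le_cmod[of "cnj S * D"] by (simp add: norm_mult)
  then have "p\<^sup>2 \<le> (cmod S * cmod D)\<^sup>2" using abs_le_square_iff[of p "cmod S * cmod D"] by simp
  then have p: "p\<^sup>2 \<le> a * b" by (simp add: a_def b_def power_mult_distrib)
  have "(cmod (S + D))\<^sup>2 = a + 2 * p + b"
    unfolding a_def b_def p_def cmod_power2 by (simp add: power2_eq_square algebra_simps)
  then have "cmod (S + D) ^ 4 = (a + 2 * p + b)\<^sup>2" by (metis numeral_Bit0 power2_eq_square power_add)
  also have "\<dots> = a\<^sup>2 + 4 * p\<^sup>2 + b\<^sup>2 + 4 * (a * p) + 2 * (a * b) + 4 * (p * b)"
    by (simp add: power2_eq_square algebra_simps)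
  also have "4 * (p * b) \<le> 2 * p\<^sup>2 + 2 * b\<^sup>2"
    using zero_le_power2[of "p - b"] by (simp add: power2_diff)
  finally have "cmod (S + D) ^ 4 \<le> a\<^sup>2 + 4 * (a * p) + 8 * (a * b) + 3 * b\<^sup>2" using p by linarith
  moreover have "a\<^sup>2 = cmod S ^ 4" "b\<^sup>2 = cmod D ^ 4" by (simp_all add: a_def b_def power_mult[symmetric])
  ultimately show ?thesis by (simp add: a_def b_def p_def)
qed

text \<open>Supplies integrability of the cross term from that of the two fourth powers.\<close>

lemma cmod_sq_Re_le:
  "(cmod S)\<^sup>2 * \<bar>Re (cnj S * D)\<bar> \<le> cmod S ^ 4 + cmod D ^ 4"
proof -
  define a b where "a = (cmod S)\<^sup>2" and "b = (cmod D)\<^sup>2"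
  have ab: "a\<^sup>2 = cmod S ^ 4" "b\<^sup>2 = cmod D ^ 4" by (simp_all add: a_def b_def power_mult[symmetric])
  have "\<bar>Re (cnj S * D)\<bar> \<le> cmod S * cmod D"
    using abs_Re_le_cmod[of "cnj S * D"] by (simp add: norm_mult)
  also have "\<dots> \<le> (a + b) / 2"
    unfolding a_def b_def using sum_squares_bound[of "cmod S" "cmod D"] by simp
  finally have "a * \<bar>Re (cnj S * D)\<bar> \<le> a * ((a + b) / 2)" unfolding a_def by (intro mult_left_mono) auto
  also have "\<dots> = (a\<^sup>2 + a * b) / 2" by (simp add: power2_eq_square algebra_simps)
  also have "\<dots> \<le> a\<^sup>2 + b\<^sup>2"
  proof -
    have *: "(x + z) / 2 \<le> x + y" if "0 \<le> x" "0 \<le> y" "2 * z \<le> x + y" for x y z :: real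
      using that by argo
    show ?thesis by (rule *) (use sum_squares_bound[of a b] in \<open>simp_all add: mult.assoc\<close>)
  qed
  finally show ?thesis unfolding ab by (simp add: a_def)
qed

text \<open>Bounding cross and mixed term by fourth powers gives 9 = 1 + 4 + 4 and 11 = 4 + 4 +
  3.\<close>

lemma cmod_add_fourth_le':
  "cmod (S + D) ^ 4 \<le> 9 * cmod S ^ 4 + 11 * cmod D ^ 4"
proof -
  have "(cmod S)\<^sup>2 * Re (cnj S * D) \<le> cmod S ^ 4 + cmod D ^ 4"
    using cmod_sq_Re_le[of S D] mult_left_mono[OF abs_ge_self[of "Re (cnj S * D)"], of "(cmod S)\<^sup>2"] by simp
  moreover have "2 * ((cmod S)\<^sup>2 * (cmod D)\<^sup>2) \<le> cmod S ^ 4 + cmod D ^ 4"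
    using sum_squares_bound[of "(cmod S)\<^sup>2" "(cmod D)\<^sup>2"] by (simp add: power_mult[symmetric])
  ultimately show ?thesis using cmod_add_fourth_le[of S D] by linarith
qed

section \<open>Sums with centred cross terms, and linear and bilinear forms\<close>

context prob_space begin

text \<open>Young's inequality with weight \<open>p k\<close> absorbs the mixed term \<open>(cmod S)\<^sup>2 * (cmod D)\<^sup>2\<close>, so that the
  fourth moments obey a closed recursion with growth factor \<open>1 + 4 * p k\<close>.\<close>
lemma fourth_moment_orthogonal_sum:
  fixes D :: "nat \<Rightarrow> 'a \<Rightarrow> complex" and p :: "nat \<Rightarrow> real"
  assumes meas[measurable]: "\<And>k. k < N \<Longrightarrow> D k \<in> borel_measurable M"
    and int: "\<And>k. k < N \<Longrightarrow> integrable M (\<lambda>\<omega>. cmod (D k \<omega>) ^ 4)"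
    and orth: "\<And>k. k < N \<Longrightarrow> integrable M (\<lambda>\<omega>. cmod (\<Sum>j<k. D j \<omega>) ^ 4) \<Longrightarrow>
      expectation (\<lambda>\<omega>. (cmod (\<Sum>j<k. D j \<omega>))\<^sup>2 * Re (cnj (\<Sum>j<k. D j \<omega>) * D k \<omega>)) = 0"
    and p: "\<And>k. k < N \<Longrightarrow> 0 < p k" "(\<Sum>k<N. p k) \<le> 1"
    and K: "\<And>k. k < N \<Longrightarrow> expectation (\<lambda>\<omega>. cmod (D k \<omega>) ^ 4) \<le> (p k)\<^sup>2 * K" "0 \<le> K"
  shows "integrable M (\<lambda>\<omega>. cmod (\<Sum>j<N. D j \<omega>) ^ 4) \<and>
    expectation (\<lambda>\<omega>. cmod (\<Sum>j<N. D j \<omega>) ^ 4) \<le> 7 * exp 4 * K"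
proof -
  \<comment> \<open>With P the partial sum of the weights, the bound is 7 K P exp (4 P): the
    exponential absorbs the factor \<open>1 + 4 * q\<close> of one step, and the linear factor P
    absorbs the new term \<open>7 * q * K\<close>.\<close>
  have "k \<le> N \<Longrightarrow> integrable M (\<lambda>\<omega>. cmod (\<Sum>j<k. D j \<omega>) ^ 4) \<and>
    expectation (\<lambda>\<omega>. cmod (\<Sum>j<k. D j \<omega>) ^ 4) \<le> 7 * K * (\<Sum>j<k. p j) * exp (4 * (\<Sum>j<k. p j))" for k
  proof (induction k)
    case (Suc k)
    then have k: "k < N" and IH: "integrable M (\<lambda>\<omega>. cmod (\<Sum>j<k. D j \<omega>) ^ 4)"
      "expectation (\<lambda>\<omega>. cmod (\<Sum>j<k. D j \<omega>) ^ 4) \<le> 7 * K * (\<Sum>j<k. p j) * exp (4 * (\<Sum>j<k. p j))"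
      by auto
    define S where "S \<omega> = (\<Sum>j<k. D j \<omega>)" for \<omega>
    define P where "P = (\<Sum>j<k. p j)"
    have S_meas[measurable]: "S \<in> borel_measurable M"
      unfolding S_def using k by (intro borel_measurable_sum meas) auto
    have Dk_meas[measurable]: "D k \<in> borel_measurable M" using k by simp
    have intS: "integrable M (\<lambda>\<omega>. cmod (S \<omega>) ^ 4)" using IH by (simp add: S_def)
    note intD = int[OF k]
    have int_sum: "integrable M (\<lambda>\<omega>. cmod (S \<omega> + D k \<omega>) ^ 4)"
      by (rule Bochner_Integration.integrable_bound[of M "\<lambda>\<omega>. 9 * cmod (S \<omega>) ^ 4 + 11 * cmod (D k \<omega>) ^ 4"])
        (use intS intD cmod_add_fourth_le' in \<open>auto intro!: AE_I2\<close>)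
    define cr where "cr \<omega> = (cmod (S \<omega>))\<^sup>2 * Re (cnj (S \<omega>) * D k \<omega>)" for \<omega>
    have int_cross: "integrable M cr"
      unfolding cr_def
    proof (rule Bochner_Integration.integrable_bound[of M "\<lambda>\<omega>. cmod (S \<omega>) ^ 4 + cmod (D k \<omega>) ^ 4"])
      show "AE \<omega> in M. norm ((cmod (S \<omega>))\<^sup>2 * Re (cnj (S \<omega>) * D k \<omega>)) \<le> norm (cmod (S \<omega>) ^ 4 + cmod (D k \<omega>) ^ 4)"
      proof (rule AE_I2)
        fix \<omega>
        let ?s = "cmod (S \<omega>)" and ?d = "cmod (D k \<omega>)"
        show "norm (?s\<^sup>2 * Re (cnj (S \<omega>) * D k \<omega>)) \<le> norm (?s ^ 4 + ?d ^ 4)"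
          using cmod_sq_Re_le[of "S \<omega>" "D k \<omega>"] unfolding real_norm_def abs_mult by simp
      qed
    qed (use intS intD in auto)
    define q where "q = p k"
    have q: "0 < q" "q \<le> 1" "0 \<le> P"
    proof -
      show "0 < q" using p(1)[OF k] by (simp add: q_def)
      have "q \<le> (\<Sum>k<N. p k)" unfolding q_def using k p(1) by (intro member_le_sum) (auto intro: less_imp_le)
      then show "q \<le> 1" using p(2) by simp
      show "0 \<le> P" unfolding P_def using k p(1) by (intro sum_nonneg) (auto intro: less_imp_le)
    qed
    have "expectation (\<lambda>\<omega>. cmod (S \<omega> + D k \<omega>) ^ 4) \<le> expectation (\<lambda>\<omega>. (1 + 4 * q) * cmod (S \<omega>) ^ 4
       + 4 * cr \<omega> + (4 / q + 3) * cmod (D k \<omega>) ^ 4)"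
    proof (rule integral_mono)
      fix \<omega>
      let ?a = "(cmod (S \<omega>))\<^sup>2" and ?b = "(cmod (D k \<omega>))\<^sup>2"
      have "0 \<le> (q * ?a - ?b)\<^sup>2 / q" using q by simp
      also have "\<dots> = q * ?a\<^sup>2 + ?b\<^sup>2 / q - 2 * (?a * ?b)"
        using q by (simp add: field_simps power2_eq_square)
      also have "?a\<^sup>2 = cmod (S \<omega>) ^ 4" by (simp add: power_mult[symmetric])
      also have "?b\<^sup>2 = cmod (D k \<omega>) ^ 4" by (simp add: power_mult[symmetric])
      finally have "8 * (?a * ?b) \<le> 4 * q * cmod (S \<omega>) ^ 4 + 4 / q * cmod (D k \<omega>) ^ 4" by simp
      then show "cmod (S \<omega> + D k \<omega>) ^ 4 \<le> (1 + 4 * q) * cmod (S \<omega>) ^ 4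
          + 4 * cr \<omega> + (4 / q + 3) * cmod (D k \<omega>) ^ 4"
        using cmod_add_fourth_le[of "S \<omega>" "D k \<omega>", folded cr_def] unfolding ring_distribs by linarith
    qed (use int_sum intS intD int_cross in auto)
    also have "\<dots> = (1 + 4 * q) * expectation (\<lambda>\<omega>. cmod (S \<omega>) ^ 4)
        + 4 * expectation cr
        + (4 / q + 3) * expectation (\<lambda>\<omega>. cmod (D k \<omega>) ^ 4)"
      using intS intD int_cross
      by simp
    also have "expectation cr = 0"
      unfolding cr_def S_def by (rule orth[OF k IH(1)])
    also have "(4 / q + 3) * expectation (\<lambda>\<omega>. cmod (D k \<omega>) ^ 4) \<le> (4 / q + 3) * (q\<^sup>2 * K)"
      using K(1)[OF k] q by (intro mult_left_mono) (auto simp: q_def)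
    \<comment> \<open>The squared weight cancels the denominator left by Young's inequality, and
      \<open>q \<le> 1\<close> then bounds 4 q + 3 q^2 by 7 q, which is the origin of the 7.\<close>
    also have "(4 / q + 3) * (q\<^sup>2 * K) = (4 * q + 3 * (q * q)) * K"
      using q by (simp add: field_simps power2_eq_square)
    also have "\<dots> \<le> (7 * q) * K"
      using q K(2) mult_left_le[of q q] by (intro mult_right_mono) auto
    also have "(1 + 4 * q) * expectation (\<lambda>\<omega>. cmod (S \<omega>) ^ 4) \<le> (1 + 4 * q) * (7 * K * P * exp (4 * P))"
      using IH(2) q by (intro mult_left_mono) (auto simp: S_def P_def)
    also have "\<dots> \<le> exp (4 * q) * (7 * K * P * exp (4 * P))"
      using q K(2) exp_ge_add_one_self[of "4 * q"] by (intro mult_right_mono) auto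
    also have "\<dots> = 7 * K * P * exp (4 * (P + q))" by (simp add: exp_add[symmetric] algebra_simps)
    also have "7 * q * K \<le> 7 * K * q * exp (4 * (P + q))"
      using q K(2) mult_left_mono[of 1 "exp (4 * (P + q))" "7 * K * q"] by (simp add: mult_ac)
    finally have "expectation (\<lambda>\<omega>. cmod (S \<omega> + D k \<omega>) ^ 4) \<le> 7 * K * (P + q) * exp (4 * (P + q))"
      by (simp add: algebra_simps)
    then show ?case using int_sum by (simp add: S_def P_def q_def)
  qed simp
  note * = this[OF order.refl]
  have P: "0 \<le> (\<Sum>k<N. p k)" using p(1) by (intro sum_nonneg) (auto intro: less_imp_le)
  have "7 * K * (\<Sum>k<N. p k) * exp (4 * (\<Sum>k<N. p k)) \<le> 7 * K * 1 * exp (4 * 1)"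
    using K(2) p(2) P by (intro mult_mono) auto
  then show ?thesis using * by (auto simp: mult_ac intro: order.trans)
qed

text \<open>Measurability with respect to the coordinates in J, expressed as a factorisation through
  the product space; in this form independence of disjoint blocks of coordinates applies
  directly.\<close>

definition depends_on :: "('i \<Rightarrow> 'a \<Rightarrow> complex) \<Rightarrow> 'i set \<Rightarrow> ('a \<Rightarrow> complex) \<Rightarrow> bool" where
  "depends_on X J Z \<longleftrightarrow> (\<exists>H \<in> borel_measurable (PiM J (\<lambda>_. borel)). Z = (\<lambda>\<omega>. H (restrict (\<lambda>i. X i \<omega>) J)))"

lemma depends_on_const: "depends_on X J (\<lambda>_. c)"
  unfolding depends_on_def by (intro bexI[of _ "\<lambda>_. c"]) auto

lemma depends_on_component: "i \<in> J \<Longrightarrow> depends_on X J (X i)"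
  unfolding depends_on_def by (intro bexI[of _ "\<lambda>y. y i"]) auto

lemma depends_on_compose:
  assumes "depends_on X J Z" "g \<in> borel_measurable borel"
  shows "depends_on X J (\<lambda>\<omega>. g (Z \<omega>))"
proof -
  obtain H where H: "H \<in> borel_measurable (PiM J (\<lambda>_. borel))" "Z = (\<lambda>\<omega>. H (restrict (\<lambda>i. X i \<omega>) J))"
    using assms(1) unfolding depends_on_def by blast
  show ?thesis unfolding depends_on_def H(2)
    by (intro bexI[of _ "\<lambda>y. g (H y)"] refl measurable_compose[OF H(1) assms(2)])
qed

lemma depends_on_add_mult:
  assumes "depends_on X J Z" "depends_on X J Z'"
  shows "depends_on X J (\<lambda>\<omega>. Z \<omega> + Z' \<omega>)" "depends_on X J (\<lambda>\<omega>. Z \<omega> * Z' \<omega>)"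
proof -
  obtain H H' where H: "H \<in> borel_measurable (PiM J (\<lambda>_. borel))" "Z = (\<lambda>\<omega>. H (restrict (\<lambda>i. X i \<omega>) J))"
     "H' \<in> borel_measurable (PiM J (\<lambda>_. borel))" "Z' = (\<lambda>\<omega>. H' (restrict (\<lambda>i. X i \<omega>) J))"
    using assms unfolding depends_on_def by blast
  show "depends_on X J (\<lambda>\<omega>. Z \<omega> + Z' \<omega>)" "depends_on X J (\<lambda>\<omega>. Z \<omega> * Z' \<omega>)"
    unfolding depends_on_def H(2,4) using H(1,3)
    by (intro bexI[of _ "\<lambda>y. H y + H' y"] bexI[of _ "\<lambda>y. H y * H' y"] refl, measurable)+
qed

lemma depends_on_sum:
  assumes "\<And>k. k \<in> A \<Longrightarrow> depends_on X J (Z k)"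
  shows "depends_on X J (\<lambda>\<omega>. \<Sum>k\<in>A. Z k \<omega>)"
  using assms
  by (induction A rule: infinite_finite_induct) (auto intro: depends_on_const depends_on_add_mult)

lemma depends_on_mono:
  assumes "depends_on X J Z" "J \<subseteq> J'"
  shows "depends_on X J' Z"
proof -
  obtain H where H: "H \<in> borel_measurable (PiM J (\<lambda>_. borel))" "Z = (\<lambda>\<omega>. H (restrict (\<lambda>i. X i \<omega>) J))"
    using assms(1) unfolding depends_on_def by blast
  have "(\<lambda>y. H (restrict y J)) \<in> borel_measurable (PiM J' (\<lambda>_. borel))"
    by (rule measurable_compose[OF measurable_restrict_subset[OF assms(2)] H(1)])
  moreover have "Z = (\<lambda>\<omega>. H (restrict (restrict (\<lambda>i. X i \<omega>) J') J))"
    unfolding H(2) using assms(2) by (simp add: Int_absorb1 restrict_restrict)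
  ultimately show ?thesis unfolding depends_on_def by (intro bexI[of _ "\<lambda>y. H (restrict y J)"])
qed

lemma depends_on_indep_var:
  assumes ind: "indep_vars (\<lambda>_. borel) X I" and Z: "depends_on X J Z" and "J \<subseteq> I" "i \<in> I" "i \<notin> J"
    and \<phi>: "\<phi> \<in> borel_measurable borel"
  shows "indep_var borel Z borel (\<lambda>\<omega>. \<phi> (X i \<omega>))"
proof -
  obtain H where H: "H \<in> borel_measurable (PiM J (\<lambda>_. borel))" "Z = (\<lambda>\<omega>. H (restrict (\<lambda>i. X i \<omega>) J))"
    using Z unfolding depends_on_def by blast
  have "indep_var (PiM J (\<lambda>_. borel)) (\<lambda>\<omega>. restrict (\<lambda>i. X i \<omega>) J) (PiM {i} (\<lambda>_. borel)) (\<lambda>\<omega>. restrict (\<lambda>i. X i \<omega>) {i})"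
    using assms by (intro indep_var_restrict[OF ind]) auto
  from indep_var_compose[OF this H(1), of "\<lambda>y. \<phi> (y i)" borel]
  show ?thesis using \<phi> H(2) by (simp add: comp_def measurable_compose[OF measurable_component_singleton])
qed

lemma integrable_of_fourth_moment:
  fixes Z :: "'a \<Rightarrow> complex"
  assumes [measurable]: "Z \<in> borel_measurable M" and "integrable M (\<lambda>\<omega>. cmod (Z \<omega>) ^ 4)" and k: "k \<le> 4"
  shows "integrable M (\<lambda>\<omega>. cmod (Z \<omega>) ^ k)"
proof (rule Bochner_Integration.integrable_bound[of M "\<lambda>\<omega>. 1 + cmod (Z \<omega>) ^ 4"])
  show "AE \<omega> in M. norm (cmod (Z \<omega>) ^ k) \<le> norm (1 + cmod (Z \<omega>) ^ 4)"
  proof (rule AE_I2)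
    fix \<omega>
    show "norm (cmod (Z \<omega>) ^ k) \<le> norm (1 + cmod (Z \<omega>) ^ 4)"
    proof (cases "cmod (Z \<omega>) \<le> 1")
      case True
      then have "cmod (Z \<omega>) ^ k \<le> 1" by (intro power_le_one) auto
      then show ?thesis by (simp add: add_increasing2)
    next
      case False
      then have "cmod (Z \<omega>) ^ k \<le> cmod (Z \<omega>) ^ 4" using k by (intro power_increasing) auto
      then show ?thesis by simp
    qed
  qed
qed (use assms in auto)

text \<open>\<open>J k\<close> holds the coordinates revealed before step k, and \<open>e k\<close>
  is fresh. The earlier sum and \<open>L k\<close> depend on \<open>J k\<close> only, so the cross
  term contains \<open>\<phi> (X (e k) \<omega>)\<close> as an independent centred factor and has
  mean zero, while the fourth moment of each increment factorises.\<close>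

lemma fourth_moment_martingale_transform:
  fixes X :: "'i \<Rightarrow> 'a \<Rightarrow> complex" and L :: "nat \<Rightarrow> 'a \<Rightarrow> complex" and p :: "nat \<Rightarrow> real"
  assumes ind: "indep_vars (\<lambda>_. borel) X I"
    and e: "\<And>k. k < N \<Longrightarrow> e k \<in> I" "\<And>k. k < N \<Longrightarrow> e k \<notin> J k" "\<And>k. k < N \<Longrightarrow> J k \<subseteq> I"
    and J: "\<And>j k. j < k \<Longrightarrow> k < N \<Longrightarrow> insert (e j) (J j) \<subseteq> J k"
    and L: "\<And>k. k < N \<Longrightarrow> depends_on X (J k) (L k)" "\<And>k. k < N \<Longrightarrow> integrable M (\<lambda>\<omega>. cmod (L k \<omega>) ^ 4)"
    and \<phi>[measurable]: "\<phi> \<in> borel_measurable borel"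
    and \<phi>_int: "\<And>k. k < N \<Longrightarrow> integrable M (\<lambda>\<omega>. cmod (\<phi> (X (e k) \<omega>)) ^ 4)"
    and \<phi>_mean: "\<And>k. k < N \<Longrightarrow> expectation (\<lambda>\<omega>. \<phi> (X (e k) \<omega>)) = 0"
    and p: "\<And>k. k < N \<Longrightarrow> 0 < p k" "(\<Sum>k<N. p k) \<le> 1" and K0: "0 \<le> K"
    and K: "\<And>k. k < N \<Longrightarrow> expectation (\<lambda>\<omega>. cmod (L k \<omega>) ^ 4) * expectation (\<lambda>\<omega>. cmod (\<phi> (X (e k) \<omega>)) ^ 4) \<le> (p k)\<^sup>2 * K"
  shows "integrable M (\<lambda>\<omega>. cmod (\<Sum>k<N. L k \<omega> * \<phi> (X (e k) \<omega>)) ^ 4) \<and>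
    expectation (\<lambda>\<omega>. cmod (\<Sum>k<N. L k \<omega> * \<phi> (X (e k) \<omega>)) ^ 4) \<le> 7 * exp 4 * K"
proof (rule fourth_moment_orthogonal_sum[OF _ _ _ p _ K0])
  fix k assume k: "k < N"
  have iv: "indep_var borel Z borel (\<lambda>\<omega>. \<psi> (X (e k) \<omega>))"
    if "depends_on X (J k) Z" "\<psi> \<in> borel_measurable borel" for Z and \<psi> :: "complex \<Rightarrow> complex"
    using depends_on_indep_var[OF ind that(1) e(3)[OF k] e(1,2)[OF k] that(2)] .
  note ivL = iv[OF L(1)[OF k] \<phi>]
  have [measurable]: "L k \<in> borel_measurable M" "(\<lambda>\<omega>. \<phi> (X (e k) \<omega>)) \<in> borel_measurable M"
    using indep_var_rv1[OF ivL] indep_var_rv2[OF ivL] by auto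
  show "(\<lambda>\<omega>. L k \<omega> * \<phi> (X (e k) \<omega>)) \<in> borel_measurable M" by measurable
  have iv4: "indep_var borel (\<lambda>\<omega>. cmod (L k \<omega>) ^ 4) borel (\<lambda>\<omega>. cmod (\<phi> (X (e k) \<omega>)) ^ 4)"
    using indep_var_compose[OF ivL, of "\<lambda>z. cmod z ^ 4" borel "\<lambda>z. cmod z ^ 4" borel] by (simp add: comp_def)
  show "integrable M (\<lambda>\<omega>. cmod (L k \<omega> * \<phi> (X (e k) \<omega>)) ^ 4)"
    using indep_var_integrable[OF iv4 L(2)[OF k] \<phi>_int[OF k]] by (simp add: norm_mult power_mult_distrib)
  show "expectation (\<lambda>\<omega>. cmod (L k \<omega> * \<phi> (X (e k) \<omega>)) ^ 4) \<le> (p k)\<^sup>2 * K"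
    using indep_var_lebesgue_integral[OF iv4 L(2)[OF k] \<phi>_int[OF k]] K[OF k]
    by (simp add: norm_mult power_mult_distrib)
  define S where "S \<omega> = (\<Sum>j<k. L j \<omega> * \<phi> (X (e j) \<omega>))" for \<omega>
  assume "integrable M (\<lambda>\<omega>. cmod (\<Sum>j<k. L j \<omega> * \<phi> (X (e j) \<omega>)) ^ 4)"
  then have intS: "integrable M (\<lambda>\<omega>. cmod (S \<omega>) ^ 4)" by (simp add: S_def)
  have depS: "depends_on X (J k) S"
    unfolding S_def
  proof (intro depends_on_sum depends_on_add_mult(2))
    fix j assume "j \<in> {..<k}"
    then have j: "j < k" "j < N" using k by auto
    show "depends_on X (J k) (L j)" using depends_on_mono[OF L(1)[OF j(2)]] J[OF j(1) k] by auto
    have "e j \<in> J k" using J[OF j(1) k] by simp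
    then show "depends_on X (J k) (\<lambda>\<omega>. \<phi> (X (e j) \<omega>))"
      by (intro depends_on_compose[OF depends_on_component \<phi>])
  qed
  \<comment> \<open>Everything in the cross term except the factor
    \<open>\<phi> (X (e k) \<omega>)\<close>; it depends on \<open>J k\<close> only.\<close>
  define H where "H \<omega> = of_real ((cmod (S \<omega>))\<^sup>2) * cnj (S \<omega>) * L k \<omega>" for \<omega>
  have "depends_on X (J k) (\<lambda>\<omega>. of_real ((cmod (S \<omega>))\<^sup>2) * cnj (S \<omega>))"
    by (rule depends_on_compose[OF depS, of "\<lambda>z. of_real ((cmod z)\<^sup>2) * cnj z"])
      (intro borel_measurable_continuous_onI continuous_intros)
  then have depH: "depends_on X (J k) H"
    unfolding H_def by (rule depends_on_add_mult(2)[OF _ L(1)[OF k]])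
  have [measurable]: "S \<in> borel_measurable M" by (rule indep_var_rv1[OF iv[OF depS \<phi>]])
  have [measurable]: "H \<in> borel_measurable M" by (rule indep_var_rv1[OF iv[OF depH \<phi>]])
  have intH: "integrable M H"
  proof (rule Bochner_Integration.integrable_bound[of M "\<lambda>\<omega>. cmod (S \<omega>) ^ 4 + cmod (L k \<omega>) ^ 4"])
    show "AE \<omega> in M. norm (H \<omega>) \<le> norm (cmod (S \<omega>) ^ 4 + cmod (L k \<omega>) ^ 4)"
    proof (rule AE_I2)
      fix \<omega>
      let ?s = "cmod (S \<omega>)" and ?d = "cmod (L k \<omega>)"
      have "norm (H \<omega>) = ?s ^ 3 * ?d"
        by (simp add: H_def norm_mult power2_eq_square power3_eq_cube)
      also have "\<dots> \<le> ?s ^ 4 + ?d ^ 4"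
      proof (cases "?s \<le> ?d")
        case True
        then have "?s ^ 3 * ?d \<le> ?d ^ 3 * ?d" by (intro mult_right_mono power_mono) auto
        then show ?thesis by (simp add: power_Suc2[symmetric] numeral_eq_Suc add_increasing)
      next
        case False
        then have "?s ^ 3 * ?d \<le> ?s ^ 3 * ?s" by (intro mult_left_mono) auto
        then show ?thesis by (simp add: power_Suc2[symmetric] numeral_eq_Suc add_increasing2)
      qed
      finally show "norm (H \<omega>) \<le> norm (?s ^ 4 + ?d ^ 4)" by simp
    qed
  qed (use intS L(2)[OF k] in auto)
  have int\<phi>: "integrable M (\<lambda>\<omega>. \<phi> (X (e k) \<omega>))"
    using integrable_of_fourth_moment[OF _ \<phi>_int[OF k], of 1] by (simp add: integrable_norm_iff)
  have intH\<phi>: "integrable M (\<lambda>\<omega>. H \<omega> * \<phi> (X (e k) \<omega>))"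
    by (rule indep_var_integrable[OF iv[OF depH \<phi>] intH int\<phi>])
  have "expectation (\<lambda>\<omega>. Re (H \<omega> * \<phi> (X (e k) \<omega>))) = Re (expectation (\<lambda>\<omega>. H \<omega> * \<phi> (X (e k) \<omega>)))"
    using intH\<phi> by (rule integral_Re)
  also have "\<dots> = 0"
    using indep_var_lebesgue_integral[OF iv[OF depH \<phi>] intH int\<phi>] \<phi>_mean[OF k] by simp
  moreover have "Re (H \<omega> * \<phi> (X (e k) \<omega>)) = (cmod (S \<omega>))\<^sup>2 * Re (cnj (S \<omega>) * (L k \<omega> * \<phi> (X (e k) \<omega>)))" for \<omega>
  proof -
    have "Re (of_real c * z) = c * Re z" for c and z :: complex by simp
    then show ?thesis unfolding H_def mult.assoc by blast
  qed
  ultimately show "expectation (\<lambda>\<omega>. (cmod (\<Sum>j<k. L j \<omega> * \<phi> (X (e j) \<omega>)))\<^sup>2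
      * Re (cnj (\<Sum>j<k. L j \<omega> * \<phi> (X (e j) \<omega>)) * (L k \<omega> * \<phi> (X (e k) \<omega>)))) = 0"
    unfolding S_def[symmetric] by (simp only:)
qed

text \<open>Weights guided by \<open>(cmod (a i))\<^sup>2\<close> make the bound depend on B and not
  on the number of terms. Each weight is at least half of
  \<open>(cmod (a (e k)))\<^sup>2 / B\<close>, so squaring costs a factor 4, whence 28 = 7 *
  4.\<close>

lemma fourth_moment_linear_form:
  fixes X :: "'i \<Rightarrow> 'a \<Rightarrow> complex" and a :: "'i \<Rightarrow> complex"
  assumes ind: "indep_vars (\<lambda>_. borel) X I" and A: "finite A" "A \<subseteq> I"
    and \<phi>: "\<phi> \<in> borel_measurable borel"
    and \<phi>_int: "\<And>i. i \<in> A \<Longrightarrow> integrable M (\<lambda>\<omega>. cmod (\<phi> (X i \<omega>)) ^ 4)"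
    and \<phi>_mean: "\<And>i. i \<in> A \<Longrightarrow> expectation (\<lambda>\<omega>. \<phi> (X i \<omega>)) = 0"
    and \<kappa>: "\<And>i. i \<in> A \<Longrightarrow> expectation (\<lambda>\<omega>. cmod (\<phi> (X i \<omega>)) ^ 4) \<le> \<kappa>" "0 \<le> \<kappa>"
    and B: "(\<Sum>i\<in>A. (cmod (a i))\<^sup>2) \<le> B" "0 < B"
  shows "integrable M (\<lambda>\<omega>. cmod (\<Sum>i\<in>A. a i * \<phi> (X i \<omega>)) ^ 4) \<and>
    expectation (\<lambda>\<omega>. cmod (\<Sum>i\<in>A. a i * \<phi> (X i \<omega>)) ^ 4) \<le> 28 * exp 4 * \<kappa> * B\<^sup>2"
proof -
  define N where "N = card A"
  obtain e where e: "bij_betw e {..<N} A"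
    using ex_bij_betw_nat_finite[OF A(1)] by (auto simp: N_def lessThan_atLeast0)
  have eA: "e k \<in> A" if "k < N" for k using e that by (auto simp: bij_betw_def)
  have inj: "inj_on e {..<N}" using e by (simp add: bij_betw_def)
  define p where "p k = ((cmod (a (e k)))\<^sup>2 / B + 1 / N) / 2" for k \<comment> \<open>\<open>1 / N\<close> only makes the weights positive\<close>
  have p0: "0 < p k" if "k < N" for k
    using that B(2) by (auto simp: p_def intro!: add_nonneg_pos)
  have "(\<Sum>k<N. (cmod (a (e k)))\<^sup>2) = (\<Sum>i\<in>A. (cmod (a i))\<^sup>2)"
    by (rule sum.reindex_bij_betw[OF e])
  then have "(\<Sum>k<N. (cmod (a (e k)))\<^sup>2 / B) \<le> 1"
    using B by (simp add: sum_divide_distrib[symmetric])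
  moreover have "(\<Sum>k<N. 1 / real N) \<le> 1" by simp
  ultimately have p1: "(\<Sum>k<N. p k) \<le> 1"
    by (simp add: p_def sum_divide_distrib[symmetric] sum.distrib)
  have "integrable M (\<lambda>\<omega>. cmod (\<Sum>k<N. a (e k) * \<phi> (X (e k) \<omega>)) ^ 4) \<and>
    expectation (\<lambda>\<omega>. cmod (\<Sum>k<N. a (e k) * \<phi> (X (e k) \<omega>)) ^ 4) \<le> 7 * exp 4 * (4 * B\<^sup>2 * \<kappa>)"
  proof (rule fourth_moment_martingale_transform[OF ind, where J = "\<lambda>k. e ` {..<k}" and p = p])
    fix k assume k: "k < N"
    show "e k \<notin> e ` {..<k}" using inj k by (auto dest: inj_onD)
    show "e ` {..<k} \<subseteq> I" "e k \<in> I" using eA A(2) k by (auto intro: order.strict_trans)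
    have "(cmod (a (e k)))\<^sup>2 \<le> 2 * B * p k" using B(2) by (simp add: p_def field_simps)
    then have "((cmod (a (e k)))\<^sup>2)\<^sup>2 \<le> (2 * B * p k)\<^sup>2" by (intro power_mono) auto
    then have "cmod (a (e k)) ^ 4 \<le> 4 * B\<^sup>2 * (p k)\<^sup>2" by (simp add: power_mult[symmetric] power_mult_distrib)
    then have "cmod (a (e k)) ^ 4 * expectation (\<lambda>\<omega>. cmod (\<phi> (X (e k) \<omega>)) ^ 4) \<le> (4 * B\<^sup>2 * (p k)\<^sup>2) * \<kappa>"
      using \<kappa>(1)[OF eA[OF k]] by (intro mult_mono) auto
    then show "expectation (\<lambda>\<omega>. cmod (a (e k)) ^ 4) * expectation (\<lambda>\<omega>. cmod (\<phi> (X (e k) \<omega>)) ^ 4)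
        \<le> (p k)\<^sup>2 * (4 * B\<^sup>2 * \<kappa>)" by (simp add: prob_space mult_ac)
    show "depends_on X (e ` {..<k}) (\<lambda>_. a (e k))" by (rule depends_on_const)
    show "integrable M (\<lambda>\<omega>. cmod (a (e k)) ^ 4)" by simp
    show "integrable M (\<lambda>\<omega>. cmod (\<phi> (X (e k) \<omega>)) ^ 4)" "expectation (\<lambda>\<omega>. \<phi> (X (e k) \<omega>)) = 0"
      using \<phi>_int \<phi>_mean eA[OF k] by auto
    show "0 < p k" by (rule p0[OF k])
  next
    fix j k assume "j < k" "k < N"
    then show "insert (e j) (e ` {..<j}) \<subseteq> e ` {..<k}" by auto
  next
    show "(\<Sum>k<N. p k) \<le> 1" by (rule p1)
    show "0 \<le> 4 * B\<^sup>2 * \<kappa>" using \<kappa>(2) by simp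
  qed (rule \<phi>)
  then show ?thesis using sum.reindex_bij_betw[OF e, of "\<lambda>i. a i * \<phi> (X i _)"] by (simp add: mult_ac)
qed

text \<open>The inner linear forms are the predictable coefficients of the outer variables;
  \<open>e k\<close> is fresh because it avoids every \<open>A j\<close> with j up to k. All inner
  forms obey the same moment bound, so equal weights 1 / N serve, and their inverse square is the
  factor \<open>real N ^ 2\<close>.\<close>

lemma fourth_moment_bilinear_form:
  fixes X :: "'i \<Rightarrow> 'a \<Rightarrow> complex" and R :: "nat \<Rightarrow> 'i \<Rightarrow> complex"
  assumes ind: "indep_vars (\<lambda>_. borel) X I"
    and X_int: "\<And>i. i \<in> I \<Longrightarrow> integrable M (\<lambda>\<omega>. cmod (X i \<omega>) ^ 4)"
    and X_mean: "\<And>i. i \<in> I \<Longrightarrow> expectation (X i) = 0"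
    and \<kappa>: "\<And>i. i \<in> I \<Longrightarrow> expectation (\<lambda>\<omega>. cmod (X i \<omega>) ^ 4) \<le> \<kappa>" "0 \<le> \<kappa>"
    and e: "\<And>k. k < N \<Longrightarrow> e k \<in> I" "inj_on e {..<N}"
    and A: "\<And>k. k < N \<Longrightarrow> finite (A k)" "\<And>k. k < N \<Longrightarrow> A k \<subseteq> I" "\<And>j k. j \<le> k \<Longrightarrow> k < N \<Longrightarrow> e k \<notin> A j"
    and B: "\<And>k. k < N \<Longrightarrow> (\<Sum>i\<in>A k. (cmod (R k i))\<^sup>2) \<le> B" "0 < B"
  shows "integrable M (\<lambda>\<omega>. cmod (\<Sum>k<N. (\<Sum>i\<in>A k. R k i * X i \<omega>) * cnj (X (e k) \<omega>)) ^ 4) \<and>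
    expectation (\<lambda>\<omega>. cmod (\<Sum>k<N. (\<Sum>i\<in>A k. R k i * X i \<omega>) * cnj (X (e k) \<omega>)) ^ 4)
      \<le> 7 * exp 4 * (real N ^ 2 * (28 * exp 4 * \<kappa> * B\<^sup>2 * \<kappa>))"
proof (rule fourth_moment_martingale_transform[OF ind, where J = "\<lambda>k. A k \<union> (\<Union>j<k. insert (e j) (A j))" and p = "\<lambda>_. 1 / real N"])
  fix k assume k: "k < N"
  have lin: "integrable M (\<lambda>\<omega>. cmod (\<Sum>i\<in>A k. R k i * X i \<omega>) ^ 4) \<and>
    expectation (\<lambda>\<omega>. cmod (\<Sum>i\<in>A k. R k i * X i \<omega>) ^ 4) \<le> 28 * exp 4 * \<kappa> * B\<^sup>2"
  proof (rule fourth_moment_linear_form[OF ind A(1,2)[OF k], of "\<lambda>z. z"])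
    fix i assume "i \<in> A k"
    then have i: "i \<in> I" using A(2)[OF k] by blast
    show "integrable M (\<lambda>\<omega>. cmod (X i \<omega>) ^ 4)" by (rule X_int[OF i])
    show "expectation (\<lambda>\<omega>. X i \<omega>) = 0" by (rule X_mean[OF i])
    show "expectation (\<lambda>\<omega>. cmod (X i \<omega>) ^ 4) \<le> \<kappa>" by (rule \<kappa>(1)[OF i])
  qed (use \<kappa>(2) B(1)[OF k] B(2) in simp_all)
  show "e k \<notin> A k \<union> (\<Union>j<k. insert (e j) (A j))"
  proof (intro notI, elim UnE UN_E insertE)
    assume "e k \<in> A k"
    then show False using A(3)[of k k] k by simp
  next
    fix j assume "j \<in> {..<k}" "e k = e j"
    then show False using inj_onD[OF e(2), of k j] k by simp
  next
    fix j assume "j \<in> {..<k}" "e k \<in> A j"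
    then show False using A(3)[of j k] k by simp
  qed
  show "A k \<union> (\<Union>j<k. insert (e j) (A j)) \<subseteq> I"
  proof (intro Un_least UN_least insert_subsetI)
    show "A k \<subseteq> I" by (rule A(2)[OF k])
  next
    fix j assume "j \<in> {..<k}"
    then have "j < N" using k by simp
    then show "e j \<in> I" "A j \<subseteq> I" using e(1) A(2) by blast+
  qed
  show "depends_on X (A k \<union> (\<Union>j<k. insert (e j) (A j))) (\<lambda>\<omega>. \<Sum>i\<in>A k. R k i * X i \<omega>)"
    by (intro depends_on_sum depends_on_add_mult depends_on_const depends_on_component) auto
  show "integrable M (\<lambda>\<omega>. cmod (\<Sum>i\<in>A k. R k i * X i \<omega>) ^ 4)" using lin by blast
  have "expectation (\<lambda>\<omega>. cmod (\<Sum>i\<in>A k. R k i * X i \<omega>) ^ 4) * expectation (\<lambda>\<omega>. cmod (cnj (X (e k) \<omega>)) ^ 4)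
    \<le> 28 * exp 4 * \<kappa> * B\<^sup>2 * \<kappa>"
    using lin \<kappa>(1)[OF e(1)[OF k]] \<kappa>(2) by (intro mult_mono) auto
  then show "expectation (\<lambda>\<omega>. cmod (\<Sum>i\<in>A k. R k i * X i \<omega>) ^ 4) * expectation (\<lambda>\<omega>. cmod (cnj (X (e k) \<omega>)) ^ 4)
    \<le> (1 / real N)\<^sup>2 * (real N ^ 2 * (28 * exp 4 * \<kappa> * B\<^sup>2 * \<kappa>))"
    using k by (simp add: power_divide)
  show "expectation (\<lambda>\<omega>. cnj (X (e k) \<omega>)) = 0" using X_mean[OF e(1)[OF k]] by simp
next
  fix j k assume "j < k" "k < N"
  then have "insert (e i) (A i) \<subseteq> (\<Union>j<k. insert (e j) (A j))" if "i \<le> j" for i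
    using that by (intro UN_upper) auto
  then show "insert (e j) (A j \<union> (\<Union>j<j. insert (e j) (A j))) \<subseteq> A k \<union> (\<Union>j<k. insert (e j) (A j))"
    by (intro insert_subsetI Un_least UN_least) (auto dest: less_imp_le)
next
  fix k assume k: "k < N"
  show "e k \<in> I" by (rule e(1)[OF k])
  show "integrable M (\<lambda>\<omega>. cmod (cnj (X (e k) \<omega>)) ^ 4)" using X_int[OF e(1)[OF k]] by simp
  show "0 < 1 / real N" using k by simp
qed (use \<kappa>(2) in \<open>auto intro: borel_measurable_continuous_onI continuous_intros\<close>)

end

section \<open>Almost sure convergence of quadratic forms\<close>

context prob_space begin

text \<open>The sum over n of the fourth powers has finite expectation, hence is finite almost
  surely, and its terms tend to zero; no joint law across different n enters. The shift by
  \<open>Suc\<close> avoids the index 0, where the bound would divide by zero.\<close>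

lemma AE_tendsto_zero_of_fourth_moments:
  fixes Z :: "nat \<Rightarrow> 'a \<Rightarrow> complex"
  assumes int: "\<And>n. 1 \<le> n \<Longrightarrow> integrable M (\<lambda>\<omega>. cmod (Z n \<omega>) ^ 4)"
    and le: "\<And>n. 1 \<le> n \<Longrightarrow> expectation (\<lambda>\<omega>. cmod (Z n \<omega>) ^ 4) \<le> C / (real n)\<^sup>2"
  shows "AE \<omega> in M. (\<lambda>n. Z n \<omega>) \<longlonglongrightarrow> 0"
proof -
  have "(\<integral>\<^sup>+ \<omega>. (\<Sum>n. ennreal (cmod (Z (Suc n) \<omega>) ^ 4)) \<partial>M) = (\<Sum>n. \<integral>\<^sup>+ \<omega>. ennreal (cmod (Z (Suc n) \<omega>) ^ 4) \<partial>M)"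
    using borel_measurable_integrable[OF int] by (intro nn_integral_suminf measurable_compose[OF _ measurable_ennreal]) auto
  also have "\<dots> \<le> (\<Sum>n. ennreal (C / (real (Suc n))\<^sup>2))"
  proof (intro suminf_le)
    fix n
    have "(\<integral>\<^sup>+ \<omega>. ennreal (cmod (Z (Suc n) \<omega>) ^ 4) \<partial>M) = ennreal (expectation (\<lambda>\<omega>. cmod (Z (Suc n) \<omega>) ^ 4))"
      using int[of "Suc n"] by (intro nn_integral_eq_integral) auto
    then show "(\<integral>\<^sup>+ \<omega>. ennreal (cmod (Z (Suc n) \<omega>) ^ 4) \<partial>M) \<le> ennreal (C / (real (Suc n))\<^sup>2)"
      using le[of "Suc n"] by (simp add: ennreal_leI del: of_nat_Suc)
  qed auto
  also have "\<dots> < \<infinity>"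
  proof -
    have "summable (\<lambda>n. C * inverse ((real (Suc n))\<^sup>2))"
      using summable_Suc_iff[of "\<lambda>n. inverse ((real n)\<^sup>2)"] inverse_power_summable[of 2, where 'a = real]
      by (intro summable_mult) (simp del: of_nat_Suc)
    then have s: "summable (\<lambda>n. C / (real (Suc n))\<^sup>2)" by (simp add: divide_inverse)
    have "0 \<le> expectation (\<lambda>\<omega>. cmod (Z 1 \<omega>) ^ 4)" by (intro integral_nonneg_AE AE_I2) simp
    from order.trans[OF this le[of 1]] have C: "0 \<le> C" by simp
    then have "(\<Sum>n. ennreal (C / (real (Suc n))\<^sup>2)) = ennreal (\<Sum>n. C / (real (Suc n))\<^sup>2)"
      using C by (intro suminf_ennreal2 s) simp
    then show ?thesis by simp
  qed
  finally have "(\<integral>\<^sup>+ \<omega>. (\<Sum>n. ennreal (cmod (Z (Suc n) \<omega>) ^ 4)) \<partial>M) \<noteq> \<infinity>" by simp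
  then have "AE \<omega> in M. (\<Sum>n. ennreal (cmod (Z (Suc n) \<omega>) ^ 4)) \<noteq> \<infinity>"
    using borel_measurable_integrable[OF int]
    by (intro nn_integral_PInf_AE borel_measurable_suminf measurable_compose[OF _ measurable_ennreal]) auto
  then show ?thesis
  proof (rule AE_mp, intro AE_I2 impI)
    fix \<omega> assume "(\<Sum>n. ennreal (cmod (Z (Suc n) \<omega>) ^ 4)) \<noteq> \<infinity>"
    then have "summable (\<lambda>n. cmod (Z (Suc n) \<omega>) ^ 4)"
      by (intro summable_suminf_not_top) (simp_all add: infinity_ennreal_def)
    then have "(\<lambda>n. cmod (Z (Suc n) \<omega>) ^ 4) \<longlonglongrightarrow> 0" by (rule summable_LIMSEQ_zero)
    then have "(\<lambda>n. root 4 (cmod (Z (Suc n) \<omega>) ^ 4)) \<longlonglongrightarrow> root 4 0" by (rule tendsto_real_root)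
    then have "(\<lambda>n. cmod (Z (Suc n) \<omega>)) \<longlonglongrightarrow> 0" by (simp add: real_root_power_cancel)
    then have "(\<lambda>n. Z (Suc n) \<omega>) \<longlonglongrightarrow> 0" by (simp add: tendsto_norm_zero_iff)
    then show "(\<lambda>n. Z n \<omega>) \<longlonglongrightarrow> 0" by (rule LIMSEQ_imp_Suc)
  qed
qed

end

section \<open>Entries of the random vectors\<close>

locale iid_entries = prob_space M for M :: "'a measure" +
  fixes x :: "nat \<Rightarrow> nat \<Rightarrow> nat \<Rightarrow> 'a \<Rightarrow> complex" and r :: nat and \<nu> :: "complex measure"
  assumes A1: "assumption_A1 \<nu>"
    and x_meas: "\<And>n i k. x n i k \<in> borel_measurable M"
    and x_law: "\<And>n i k. i \<in> {1..r} \<Longrightarrow> k < n \<Longrightarrow> distr M borel (x n i k) = \<nu>"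
    and x_indep: "\<And>n. indep_vars (\<lambda>_. borel) (\<lambda>(i, k). x n i k) ({1..r} \<times> {..<n})"
begin

lemma entry_integral:
  fixes f :: "complex \<Rightarrow> 'b :: {banach, second_countable_topology}"
  assumes "f \<in> borel_measurable borel" "i \<in> {1..r}" "k < n"
  shows "integrable M (\<lambda>\<omega>. f (x n i k \<omega>)) \<longleftrightarrow> integrable \<nu> f"
    "expectation (\<lambda>\<omega>. f (x n i k \<omega>)) = (\<integral>z. f z \<partial>\<nu>)"
  using integrable_distr_eq[OF x_meas assms(1), of n i k] integral_distr[OF x_meas assms(1), of n i k]
  unfolding x_law[OF assms(2,3)] by auto

text \<open>Both summands are nonnegative, so one constant bounds the fourth moments of the entries
  and of their centred squared moduli alike.\<close>

definition \<kappa> :: real where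
  "\<kappa> = (\<integral>z. cmod z ^ 4 \<partial>\<nu>) + (\<integral>z. cmod (of_real ((cmod z)\<^sup>2 - 1)) ^ 4 \<partial>\<nu>)"

lemma entry_moments:
  assumes "i \<in> {1..r}" "k < n"
  shows "integrable M (\<lambda>\<omega>. cmod (x n i k \<omega>) ^ 4)" "expectation (x n i k) = 0"
    "expectation (\<lambda>\<omega>. cmod (x n i k \<omega>) ^ 4) \<le> \<kappa>"
    "integrable M (\<lambda>\<omega>. cmod (complex_of_real ((cmod (x n i k \<omega>))\<^sup>2 - 1)) ^ 4)"
    "expectation (\<lambda>\<omega>. complex_of_real ((cmod (x n i k \<omega>))\<^sup>2 - 1)) = 0"
    "expectation (\<lambda>\<omega>. cmod (complex_of_real ((cmod (x n i k \<omega>))\<^sup>2 - 1)) ^ 4) \<le> \<kappa>"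
proof -
  from A1 interpret nu: prob_space \<nu> by (simp add: assumption_A1_def)
  have sets[measurable_cong]: "sets \<nu> = sets borel" using A1 by (simp add: assumption_A1_def)
  have i8: "integrable \<nu> (\<lambda>z. cmod z ^ 8)" by (rule assumption_A1_eighth_moment[OF A1])
  have i4: "integrable \<nu> (\<lambda>z. cmod z ^ 4)"
  proof (rule Bochner_Integration.integrable_bound[of \<nu> "\<lambda>z. 1 + cmod z ^ 8"])
    show "AE z in \<nu>. norm (cmod z ^ 4) \<le> norm (1 + cmod z ^ 8)"
    proof (rule AE_I2)
      fix z :: complex
      have "2 * cmod z ^ 4 \<le> 1 + (cmod z ^ 4)\<^sup>2" using sum_squares_bound[of 1 "cmod z ^ 4"] by simp
      moreover have "cmod z ^ 4 \<le> 2 * cmod z ^ 4" by simp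
      ultimately have "cmod z ^ 4 \<le> 1 + (cmod z ^ 4)\<^sup>2" by (rule order.trans[rotated])
      then show "norm (cmod z ^ 4) \<le> norm (1 + cmod z ^ 8)" by (simp add: power_mult[symmetric])
    qed
  qed (use i8 in auto)
  have c4: "integrable \<nu> (\<lambda>z. cmod (complex_of_real ((cmod z)\<^sup>2 - 1)) ^ 4)"
  proof (rule Bochner_Integration.integrable_bound[of \<nu> "\<lambda>z. 9 * cmod z ^ 8 + 11"])
    show "AE z in \<nu>. norm (cmod (complex_of_real ((cmod z)\<^sup>2 - 1)) ^ 4) \<le> norm (9 * cmod z ^ 8 + 11)"
    proof (rule AE_I2)
      fix z :: complex
      \<comment> \<open>The general bound with D = -1 reduces the centred square to the eighth
        moment.\<close>
      have "cmod (of_real ((cmod z)\<^sup>2) + (- 1)) ^ 4 \<le> 9 * cmod (of_real ((cmod z)\<^sup>2)) ^ 4 + 11 * cmod (- 1) ^ 4"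
        by (rule cmod_add_fourth_le')
      then show "norm (cmod (complex_of_real ((cmod z)\<^sup>2 - 1)) ^ 4) \<le> norm (9 * cmod z ^ 8 + 11)"
        by (simp add: norm_power power_mult[symmetric])
    qed
  qed (use i8 in auto)
  have nonneg: "0 \<le> (\<integral>z. cmod z ^ 4 \<partial>\<nu>)" "0 \<le> (\<integral>z. cmod (complex_of_real ((cmod z)\<^sup>2 - 1)) ^ 4 \<partial>\<nu>)"
    by (intro integral_nonneg_AE AE_I2, simp)+
  show "integrable M (\<lambda>\<omega>. cmod (x n i k \<omega>) ^ 4)" "expectation (\<lambda>\<omega>. cmod (x n i k \<omega>) ^ 4) \<le> \<kappa>"
    using entry_integral[of "\<lambda>z. cmod z ^ 4", OF _ assms] i4 nonneg by (auto simp: \<kappa>_def)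
  show "integrable M (\<lambda>\<omega>. cmod (complex_of_real ((cmod (x n i k \<omega>))\<^sup>2 - 1)) ^ 4)"
    "expectation (\<lambda>\<omega>. cmod (complex_of_real ((cmod (x n i k \<omega>))\<^sup>2 - 1)) ^ 4) \<le> \<kappa>"
    using entry_integral[of "\<lambda>z. cmod (complex_of_real ((cmod z)\<^sup>2 - 1)) ^ 4", OF _ assms] c4 nonneg
    unfolding \<kappa>_def by (simp_all del: of_real_diff)
  show "expectation (x n i k) = 0"
    using entry_integral(2)[of "\<lambda>z. z", OF _ assms] A1 by (simp add: assumption_A1_def)
  have "(\<integral>z. complex_of_real ((cmod z)\<^sup>2 - 1) \<partial>\<nu>) = complex_of_real (\<integral>z. (cmod z)\<^sup>2 - 1 \<partial>\<nu>)"
    by (rule integral_complex_of_real)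
  also have "(\<integral>z. (cmod z)\<^sup>2 - 1 \<partial>\<nu>) = 0"
    using A1 nu.prob_space by (subst Bochner_Integration.integral_diff) (auto simp: assumption_A1_def)
  finally show "expectation (\<lambda>\<omega>. complex_of_real ((cmod (x n i k \<omega>))\<^sup>2 - 1)) = 0"
    using entry_integral(2)[of "\<lambda>z. complex_of_real ((cmod z)\<^sup>2 - 1)", OF _ assms] by (simp del: of_real_diff)
qed

lemma \<kappa>_nonneg: "0 \<le> \<kappa>"
  unfolding \<kappa>_def by (intro add_nonneg_nonneg integral_nonneg_AE AE_I2) auto

definition scaled :: "nat \<Rightarrow> 'a \<Rightarrow> nat \<Rightarrow> nat \<Rightarrow> complex" where
  "scaled n \<omega> i = (\<lambda>k. x n i k \<omega> / of_real (sqrt (real n)))"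

text \<open>The coefficient of \<open>x n i a \<omega> * cnj (x n l b \<omega>)\<close> is the (b,
  a) entry of the matrix with eigenbasis P and eigenvalues g; the factor 1 / n comes from the two
  normalisations by the square root of n.\<close>

lemma resolvent_gram_scaled:
  assumes "1 \<le> n"
  shows "resolvent_gram n P g (scaled n \<omega>) i l =
    (\<Sum>b<n. (\<Sum>a<n. (\<Sum>k<n. of_real (g k) * (cnj (P k a) * P k b)) * x n i a \<omega>) * cnj (x n l b \<omega>)) / of_nat n"
proof -
  have s: "complex_of_real (sqrt (real n)) * complex_of_real (sqrt (real n)) = of_nat n"
    unfolding of_real_mult[symmetric] by simp
  have "resolvent_gram n P g (scaled n \<omega>) i l
    = (\<Sum>k<n. of_real (g k) * ((\<Sum>a<n. x n i a \<omega> * cnj (P k a)) * (\<Sum>b<n. cnj (x n l b \<omega>) * P k b))) / of_nat n"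
  proof -
    have ip: "ip n (scaled n \<omega> i) (P k) = (\<Sum>a<n. x n i a \<omega> * cnj (P k a)) / of_real (sqrt (real n))" for i k
      by (simp add: ip_def scaled_def sum_divide_distrib)
    have "ip n (scaled n \<omega> i) (P k) * cnj (ip n (scaled n \<omega> l) (P k))
      = ((\<Sum>a<n. x n i a \<omega> * cnj (P k a)) * (\<Sum>b<n. cnj (x n l b \<omega>) * P k b)) / of_nat n" for k
      unfolding ip complex_cnj_divide complex_cnj_complex_of_real times_divide_times_eq s by simp
    then show ?thesis unfolding resolvent_gram_def by (simp only: times_divide_eq_right sum_divide_distrib)
  qed
  also have "(\<Sum>k<n. of_real (g k) * ((\<Sum>a<n. x n i a \<omega> * cnj (P k a)) * (\<Sum>b<n. cnj (x n l b \<omega>) * P k b)))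
      = (\<Sum>k<n. \<Sum>b<n. \<Sum>a<n. of_real (g k) * (cnj (P k a) * P k b) * x n i a \<omega> * cnj (x n l b \<omega>))"
    unfolding sum_product
    by (subst sum.swap) (simp add: sum_distrib_left mult_ac)
  also have "\<dots> = (\<Sum>b<n. \<Sum>a<n. \<Sum>k<n. of_real (g k) * (cnj (P k a) * P k b) * x n i a \<omega> * cnj (x n l b \<omega>))"
    by (rule sum_swap_last[symmetric])
  finally show ?thesis by (simp add: sum_distrib_right)
qed

end

text \<open>For fixed b the entries \<open>R a b\<close> are, up to conjugation, the matrix with
  eigenvalues g applied to the b-th unit vector. Its norm is at most the operator norm, hence at
  most \<beta>, uniformly in n.\<close>

lemma orthonormal_function_bounds:
  assumes P: "orthonormal n n P" and g: "\<And>k. k < n \<Longrightarrow> \<bar>g k\<bar> \<le> \<beta>" and b: "b < n"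
  defines "R \<equiv> \<lambda>a b. (\<Sum>k<n. complex_of_real (g k) * (cnj (P k a) * P k b))"
  shows "(\<Sum>a<n. (cmod (R a b))\<^sup>2) \<le> \<beta>\<^sup>2"
proof -
  define y where "y = (\<lambda>a. \<Sum>k\<in>{..<n}. (of_real (g k) * cnj (P k b)) * P k a)"
  have "cnj (R a b) = y a" for a by (simp add: R_def y_def mult_ac)
  then have "cmod (R a b) = cmod (y a)" for a by (metis complex_mod_cnj)
  then have "(\<Sum>a<n. (cmod (R a b))\<^sup>2) = sqn n y" by (simp add: sqn_def)
  also have "\<dots> = (\<Sum>k<n. (cmod (of_real (g k) * cnj (P k b)))\<^sup>2)"
    unfolding sqn_parseval[OF P] y_def using ip_orthonormal_combination[OF P order.refl] by simp
  also have "\<dots> \<le> (\<Sum>k<n. \<beta>\<^sup>2 * (cmod (P k b))\<^sup>2)"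
    using power_mono[OF g, of _ 2] by (intro sum_mono) (auto simp: norm_mult power_mult_distrib intro!: mult_right_mono)
  also have "\<dots> = \<beta>\<^sup>2 * (\<Sum>k<n. (cmod (P k b))\<^sup>2)" by (simp add: sum_distrib_left)
  also have "(\<Sum>k<n. (cmod (P k b))\<^sup>2) = 1"
  proof -
    have "of_real (\<Sum>k<n. (cmod (P k b))\<^sup>2) = (\<Sum>k<n. P k b * cnj (P k b))"
      by (simp add: complex_norm_square[symmetric])
    also have "\<dots> = 1" using orthonormal_rows[OF P b b] by simp
    finally show ?thesis by (metis of_real_eq_1_iff)
  qed
  finally show ?thesis by simp
qed

section \<open>Quadratic forms in the random vectors\<close>

context iid_entries begin

lemma entry_pair_moments:
  assumes "p \<in> {1..r} \<times> {..<n}"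
  shows "integrable M (\<lambda>\<omega>. cmod ((\<lambda>(i, k). x n i k) p \<omega>) ^ 4)" "expectation ((\<lambda>(i, k). x n i k) p) = 0"
    "expectation (\<lambda>\<omega>. cmod ((\<lambda>(i, k). x n i k) p \<omega>) ^ 4) \<le> \<kappa>"
    "integrable M (\<lambda>\<omega>. cmod (complex_of_real ((cmod ((\<lambda>(i, k). x n i k) p \<omega>))\<^sup>2 - 1)) ^ 4)"
    "expectation (\<lambda>\<omega>. complex_of_real ((cmod ((\<lambda>(i, k). x n i k) p \<omega>))\<^sup>2 - 1)) = 0"
    "expectation (\<lambda>\<omega>. cmod (complex_of_real ((cmod ((\<lambda>(i, k). x n i k) p \<omega>))\<^sup>2 - 1)) ^ 4) \<le> \<kappa>"
proof -
  obtain i k where p: "p = (i, k)" "i \<in> {1..r}" "k < n" using assms by auto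
  note m = entry_moments[OF p(2,3)]
  show "integrable M (\<lambda>\<omega>. cmod ((\<lambda>(i, k). x n i k) p \<omega>) ^ 4)" "expectation ((\<lambda>(i, k). x n i k) p) = 0"
    "expectation (\<lambda>\<omega>. cmod ((\<lambda>(i, k). x n i k) p \<omega>) ^ 4) \<le> \<kappa>"
    "integrable M (\<lambda>\<omega>. cmod (complex_of_real ((cmod ((\<lambda>(i, k). x n i k) p \<omega>))\<^sup>2 - 1)) ^ 4)"
    "expectation (\<lambda>\<omega>. complex_of_real ((cmod ((\<lambda>(i, k). x n i k) p \<omega>))\<^sup>2 - 1)) = 0"
    "expectation (\<lambda>\<omega>. cmod (complex_of_real ((cmod ((\<lambda>(i, k). x n i k) p \<omega>))\<^sup>2 - 1)) ^ 4) \<le> \<kappa>"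
    unfolding p(1) prod.case by (fact m)+
qed

lemma sum_Pair_image: "(\<Sum>p\<in>Pair i ` A. f p) = (\<Sum>a\<in>A. f (i, a))"
  by (subst sum.reindex) (auto simp: inj_on_def)

text \<open>For i different from l the coordinates (i, a) and (l, b) never meet, so each
  \<open>x n l b\<close> is fresh with respect to all inner sums.\<close>

lemma fourth_moment_off_diagonal:
  assumes i: "i \<in> {1..r}" and l: "l \<in> {1..r}" and "i \<noteq> l"
    and B: "\<And>b. b < n \<Longrightarrow> (\<Sum>a<n. (cmod (R a b))\<^sup>2) \<le> B" "0 < B"
  shows "integrable M (\<lambda>\<omega>. cmod (\<Sum>b<n. (\<Sum>a<n. R a b * x n i a \<omega>) * cnj (x n l b \<omega>)) ^ 4) \<and>
    expectation (\<lambda>\<omega>. cmod (\<Sum>b<n. (\<Sum>a<n. R a b * x n i a \<omega>) * cnj (x n l b \<omega>)) ^ 4)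
      \<le> 7 * exp 4 * (real n ^ 2 * (28 * exp 4 * \<kappa> * B\<^sup>2 * \<kappa>))"
proof -
  let ?X = "\<lambda>(i, k). x n i k"
  have "integrable M (\<lambda>\<omega>. cmod (\<Sum>b<n. (\<Sum>p\<in>Pair i ` {..<n}. R (snd p) b * ?X p \<omega>) * cnj (?X (l, b) \<omega>)) ^ 4) \<and>
    expectation (\<lambda>\<omega>. cmod (\<Sum>b<n. (\<Sum>p\<in>Pair i ` {..<n}. R (snd p) b * ?X p \<omega>) * cnj (?X (l, b) \<omega>)) ^ 4)
      \<le> 7 * exp 4 * (real n ^ 2 * (28 * exp 4 * \<kappa> * B\<^sup>2 * \<kappa>))"
  proof (rule fourth_moment_bilinear_form[OF x_indep entry_pair_moments(1-3) \<kappa>_nonneg])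
    fix b assume "b < n"
    then show "(\<Sum>p\<in>Pair i ` {..<n}. (cmod (R (snd p) b))\<^sup>2) \<le> B" using B(1) by (simp add: sum_Pair_image)
  qed (use i l \<open>i \<noteq> l\<close> B(2) in \<open>auto simp: inj_on_def\<close>)
  then show ?thesis unfolding sum_Pair_image by simp
qed

text \<open>When both vectors coincide, the sum is split into a < b, a = b and a > b. For a < b the
  outer variable is fresh; Hermitian symmetry makes the part a > b its conjugate; after subtraction
  of the trace, the diagonal is a linear form in the centred variables
  \<open>(cmod x)\<^sup>2 - 1\<close>.\<close>

lemma fourth_moment_diagonal:
  assumes i: "i \<in> {1..r}" and B: "\<And>b. b < n \<Longrightarrow> (\<Sum>a<n. (cmod (R a b))\<^sup>2) \<le> B" "0 < B"
    and herm: "\<And>a b. R a b = cnj (R b a)" and n: "1 \<le> n"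
  shows "integrable M (\<lambda>\<omega>. cmod ((\<Sum>b<n. (\<Sum>a<n. R a b * x n i a \<omega>) * cnj (x n i b \<omega>)) - (\<Sum>a<n. R a a)) ^ 4) \<and>
    expectation (\<lambda>\<omega>. cmod ((\<Sum>b<n. (\<Sum>a<n. R a b * x n i a \<omega>) * cnj (x n i b \<omega>)) - (\<Sum>a<n. R a a)) ^ 4)
      \<le> 144 * (7 * exp 4 * (real n ^ 2 * (28 * exp 4 * \<kappa> * B\<^sup>2 * \<kappa>))) + 11 * (28 * exp 4 * \<kappa> * (real n * B)\<^sup>2)"
proof -
  let ?X = "\<lambda>(i, k). x n i k"
  define T1 where "T1 \<omega> = (\<Sum>b<n. (\<Sum>a<b. R a b * x n i a \<omega>) * cnj (x n i b \<omega>))" for \<omega>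
  define T3 where "T3 \<omega> = (\<Sum>a<n. R a a * of_real ((cmod (x n i a \<omega>))\<^sup>2 - 1))" for \<omega>
  have row: "(\<Sum>a<b. (cmod (R a b))\<^sup>2) \<le> B" if "b < n" for b
    using sum_mono2[of "{..<n}" "{..<b}" "\<lambda>a. (cmod (R a b))\<^sup>2"] B(1)[OF that] that by simp
  have "integrable M (\<lambda>\<omega>. cmod (\<Sum>b<n. (\<Sum>p\<in>Pair i ` {..<b}. R (snd p) b * ?X p \<omega>) * cnj (?X (i, b) \<omega>)) ^ 4) \<and>
    expectation (\<lambda>\<omega>. cmod (\<Sum>b<n. (\<Sum>p\<in>Pair i ` {..<b}. R (snd p) b * ?X p \<omega>) * cnj (?X (i, b) \<omega>)) ^ 4)
      \<le> 7 * exp 4 * (real n ^ 2 * (28 * exp 4 * \<kappa> * B\<^sup>2 * \<kappa>))"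
  proof (rule fourth_moment_bilinear_form[OF x_indep entry_pair_moments(1-3) \<kappa>_nonneg])
    fix b assume "b < n"
    then show "(\<Sum>p\<in>Pair i ` {..<b}. (cmod (R (snd p) b))\<^sup>2) \<le> B" using row by (simp add: sum_Pair_image)
  qed (use i B(2) in \<open>auto simp: inj_on_def\<close>)
  then have T1: "integrable M (\<lambda>\<omega>. cmod (T1 \<omega>) ^ 4)"
    "expectation (\<lambda>\<omega>. cmod (T1 \<omega>) ^ 4) \<le> 7 * exp 4 * (real n ^ 2 * (28 * exp 4 * \<kappa> * B\<^sup>2 * \<kappa>))"
    unfolding sum_Pair_image T1_def by simp_all
  have "(cmod (R a a))\<^sup>2 \<le> B" if "a < n" for a
    using member_le_sum[of a "{..<n}" "\<lambda>c. (cmod (R c a))\<^sup>2"] B(1)[OF that] that by simp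
  \<comment> \<open>A crude bound, but its square is of order \<open>n\<^sup>2\<close>, like the
    contribution of the off-diagonal part.\<close>
  then have diag: "(\<Sum>a<n. (cmod (R a a))\<^sup>2) \<le> real n * B"
    using sum_bounded_above[of "{..<n}" "\<lambda>a. (cmod (R a a))\<^sup>2" B] by simp
  have "integrable M (\<lambda>\<omega>. cmod (\<Sum>p\<in>Pair i ` {..<n}. R (snd p) (snd p) * of_real ((cmod (?X p \<omega>))\<^sup>2 - 1)) ^ 4) \<and>
    expectation (\<lambda>\<omega>. cmod (\<Sum>p\<in>Pair i ` {..<n}. R (snd p) (snd p) * of_real ((cmod (?X p \<omega>))\<^sup>2 - 1)) ^ 4)
      \<le> 28 * exp 4 * \<kappa> * (real n * B)\<^sup>2"
  proof (rule fourth_moment_linear_form[OF x_indep, where \<phi> = "\<lambda>z. of_real ((cmod z)\<^sup>2 - 1)"])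
    fix p assume "p \<in> Pair i ` {..<n}"
    then have "p \<in> {1..r} \<times> {..<n}" using i by auto
    note m = entry_pair_moments(4-6)[OF this]
    show "integrable M (\<lambda>\<omega>. cmod (complex_of_real ((cmod (?X p \<omega>))\<^sup>2 - 1)) ^ 4)" by (rule m)
    show "expectation (\<lambda>\<omega>. complex_of_real ((cmod (?X p \<omega>))\<^sup>2 - 1)) = 0" by (rule m)
    show "expectation (\<lambda>\<omega>. cmod (complex_of_real ((cmod (?X p \<omega>))\<^sup>2 - 1)) ^ 4) \<le> \<kappa>" by (rule m)
  next
    show "(\<Sum>p\<in>Pair i ` {..<n}. (cmod (R (snd p) (snd p)))\<^sup>2) \<le> real n * B"
      using diag by (simp add: sum_Pair_image)
    show "(\<lambda>z. complex_of_real ((cmod z)\<^sup>2 - 1)) \<in> borel_measurable borel" by measurable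
    show "0 < real n * B" using n B(2) by simp
  qed (use i \<kappa>_nonneg in auto)
  then have T3: "integrable M (\<lambda>\<omega>. cmod (T3 \<omega>) ^ 4)"
    "expectation (\<lambda>\<omega>. cmod (T3 \<omega>) ^ 4) \<le> 28 * exp 4 * \<kappa> * (real n * B)\<^sup>2"
    unfolding sum_Pair_image T3_def by (simp_all del: of_real_diff)
  define T where "T \<omega> = (\<Sum>b<n. (\<Sum>a<n. R a b * x n i a \<omega>) * cnj (x n i b \<omega>)) - (\<Sum>a<n. R a a)" for \<omega>
  have T_eq: "T \<omega> = (T1 \<omega> + cnj (T1 \<omega>)) + T3 \<omega>" for \<omega>
  proof -
    define f where "f a b = R a b * x n i a \<omega> * cnj (x n i b \<omega>)" for a b
    have f: "cnj (f a b) = f b a" for a b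
      using herm[of b a] by (simp add: f_def mult_ac)
    have split: "(\<Sum>a<n. f a b) = (\<Sum>a<b. f a b) + f b b + (\<Sum>a\<in>{b<..<n}. f a b)" if "b < n" for b
    proof -
      have "{..<n} = {..<b} \<union> {b} \<union> {b<..<n}" using that by auto
      then have "(\<Sum>a<n. f a b) = f b b + (\<Sum>a\<in>{..<b} \<union> {b<..<n}. f a b)" by simp
      also have "(\<Sum>a\<in>{..<b} \<union> {b<..<n}. f a b) = (\<Sum>a<b. f a b) + (\<Sum>a\<in>{b<..<n}. f a b)"
        by (rule sum.union_disjoint) auto
      finally show ?thesis by (simp add: ac_simps)
    qed
    have "(\<Sum>b<n. \<Sum>a\<in>{b<..<n}. f a b) = (\<Sum>b<n. \<Sum>a<n. if b < a then f a b else 0)"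
      by (intro sum.cong refl sum.mono_neutral_cong_left) auto
    also have "\<dots> = (\<Sum>a<n. \<Sum>b<n. if b < a then f a b else 0)" by (rule sum.swap)
    also have "\<dots> = (\<Sum>a<n. \<Sum>b<a. f a b)"
      by (intro sum.cong refl sum.mono_neutral_cong_right) auto
    also have "\<dots> = cnj (\<Sum>b<n. \<Sum>a<b. f a b)" by (simp add: f)
    finally have upper: "(\<Sum>b<n. \<Sum>a\<in>{b<..<n}. f a b) = cnj (\<Sum>b<n. \<Sum>a<b. f a b)" .
    have "(\<Sum>b<n. \<Sum>a<n. f a b) = (\<Sum>b<n. \<Sum>a<b. f a b) + (\<Sum>b<n. f b b) + (\<Sum>b<n. \<Sum>a\<in>{b<..<n}. f a b)"
      using split by (simp add: sum.distrib)
    moreover have "f b b = R b b + R b b * of_real ((cmod (x n i b \<omega>))\<^sup>2 - 1)" for b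
      by (simp add: f_def mult.assoc complex_norm_square[symmetric] algebra_simps)
    moreover have "T1 \<omega> = (\<Sum>b<n. \<Sum>a<b. f a b)" by (simp add: T1_def f_def sum_distrib_right)
    moreover have "T \<omega> = (\<Sum>b<n. \<Sum>a<n. f a b) - (\<Sum>a<n. R a a)" by (simp add: T_def f_def sum_distrib_right)
    ultimately show ?thesis using upper by (simp add: T3_def sum.distrib del: of_real_diff)
  qed
  \<comment> \<open>Here 144 = 9 * 16, where 16 is the fourth power of the 2 from adding
    \<open>T1\<close> and its conjugate.\<close>
  have T_le: "cmod (T \<omega>) ^ 4 \<le> 144 * cmod (T1 \<omega>) ^ 4 + 11 * cmod (T3 \<omega>) ^ 4" for \<omega>
  proof -
    have "cmod (T1 \<omega> + cnj (T1 \<omega>)) \<le> 2 * cmod (T1 \<omega>)"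
      using norm_triangle_ineq[of "T1 \<omega>" "cnj (T1 \<omega>)"] by simp
    then have "cmod (T1 \<omega> + cnj (T1 \<omega>)) ^ 4 \<le> (2 * cmod (T1 \<omega>)) ^ 4" by (intro power_mono) auto
    also have "\<dots> = 16 * cmod (T1 \<omega>) ^ 4" by (simp add: power_mult_distrib)
    finally show ?thesis unfolding T_eq using cmod_add_fourth_le'[of "T1 \<omega> + cnj (T1 \<omega>)" "T3 \<omega>"] by linarith
  qed
  have bound_int: "integrable M (\<lambda>\<omega>. 144 * cmod (T1 \<omega>) ^ 4 + 11 * cmod (T3 \<omega>) ^ 4)"
    using T1(1) T3(1) by simp
  have [measurable]: "T \<in> borel_measurable M"
    unfolding T_def
    by (intro borel_measurable_diff borel_measurable_sum borel_measurable_times borel_measurable_const x_meas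
        measurable_compose[OF x_meas borel_measurable_continuous_onI] continuous_intros)
  have T: "integrable M (\<lambda>\<omega>. cmod (T \<omega>) ^ 4)"
    by (rule Bochner_Integration.integrable_bound[OF bound_int]) (use T_le in \<open>auto intro!: AE_I2\<close>)
  have "expectation (\<lambda>\<omega>. cmod (T \<omega>) ^ 4) \<le> expectation (\<lambda>\<omega>. 144 * cmod (T1 \<omega>) ^ 4 + 11 * cmod (T3 \<omega>) ^ 4)"
    by (intro integral_mono T bound_int T_le)
  also have "\<dots> = 144 * expectation (\<lambda>\<omega>. cmod (T1 \<omega>) ^ 4) + 11 * expectation (\<lambda>\<omega>. cmod (T3 \<omega>) ^ 4)"
    using T1(1) T3(1) by simp
  also have "\<dots> \<le> 144 * (7 * exp 4 * (real n ^ 2 * (28 * exp 4 * \<kappa> * B\<^sup>2 * \<kappa>))) + 11 * (28 * exp 4 * \<kappa> * (real n * B)\<^sup>2)"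
    using T1(2) T3(2) by (intro add_mono mult_left_mono) auto
  finally show ?thesis using T unfolding T_def by blast
qed

text \<open>The mean of the form is the normalised trace of the matrix with eigenvalues g if i = l,
  and zero otherwise. The trace does not see the eigenbasis: it is the average of g, which tends to
  G.\<close>

lemma AE_resolvent_gram_tendsto:
  assumes P: "\<And>n. orthonormal n n (P n)" and g: "\<And>n k. k < n \<Longrightarrow> \<bar>g n k\<bar> \<le> \<beta>"
    and i: "i \<in> {1..r}" and l: "l \<in> {1..r}"
    and G: "(\<lambda>n. (\<Sum>k<n. g n k) / real n) \<longlonglongrightarrow> G"
  shows "AE \<omega> in M. (\<lambda>n. resolvent_gram n (P n) (g n) (scaled n \<omega>) i l) \<longlonglongrightarrow> of_real (if i = l then G else 0)"
proof -
  \<comment> \<open>The added 1 keeps B positive even for \<beta> = 0.\<close>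
  define B where "B = \<beta>\<^sup>2 + 1"
  have B: "0 < B" by (simp add: B_def add_nonneg_pos)
  define R where "R n a b = (\<Sum>k<n. complex_of_real (g n k) * (cnj (P n k a) * P n k b))" for n a b
  have R_B: "(\<Sum>a<n. (cmod (R n a b))\<^sup>2) \<le> B" if "b < n" for n b
    using orthonormal_function_bounds[OF P g that] unfolding R_def B_def by (simp add: add_increasing2)
  have R_herm: "R n a b = cnj (R n b a)" for n a b by (simp add: R_def mult_ac)
  have R_tr: "(\<Sum>a<n. R n a a) = of_real (\<Sum>k<n. g n k)" for n
  proof -
    have "(\<Sum>a<n. R n a a) = (\<Sum>k<n. of_real (g n k) * ip n (P n k) (P n k))"
      unfolding R_def ip_def sum_distrib_left by (subst sum.swap) (simp add: mult_ac)
    also have "\<dots> = (\<Sum>k<n. of_real (g n k))"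
      using P[of n] by (intro sum.cong) (auto simp: orthonormal_def)
    finally show ?thesis by simp
  qed
  define C1 where "C1 = 7 * exp 4 * (28 * exp 4 * \<kappa> * B\<^sup>2 * \<kappa>)"
  define C where "C = 144 * C1 + 11 * (28 * exp 4 * \<kappa> * B\<^sup>2)"
  have C1: "0 \<le> C1" "C1 \<le> C" using \<kappa>_nonneg by (auto simp: C1_def C_def)
  define c where "c n = (if i = l then (\<Sum>k<n. g n k) / real n else 0)" for n
  define Z where "Z n \<omega> = resolvent_gram n (P n) (g n) (scaled n \<omega>) i l - of_real (c n)" for n \<omega>
  define T where "T n \<omega> = (\<Sum>b<n. (\<Sum>a<n. R n a b * x n i a \<omega>) * cnj (x n l b \<omega>)) - (if i = l then (\<Sum>a<n. R n a a) else 0)" for n \<omega>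
  have Z_T: "Z n \<omega> = T n \<omega> / of_nat n" if "1 \<le> n" for n \<omega>
    unfolding Z_def T_def c_def resolvent_gram_scaled[OF that] R_tr by (simp add: R_def diff_divide_distrib)
  have T: "integrable M (\<lambda>\<omega>. cmod (T n \<omega>) ^ 4)" "expectation (\<lambda>\<omega>. cmod (T n \<omega>) ^ 4) \<le> C * (real n)\<^sup>2"
    if n: "1 \<le> n" for n
  proof -
    have "integrable M (\<lambda>\<omega>. cmod (T n \<omega>) ^ 4) \<and> expectation (\<lambda>\<omega>. cmod (T n \<omega>) ^ 4) \<le> C * (real n)\<^sup>2"
    proof (cases "i = l")
      case True
      then show ?thesis
        using fourth_moment_diagonal[OF i R_B B R_herm n]
        unfolding T_def C_def C1_def by (simp add: algebra_simps power_mult_distrib)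
    next
      case False
      have "C1 * (real n)\<^sup>2 \<le> C * (real n)\<^sup>2" using C1 by (intro mult_right_mono) auto
      then show ?thesis
        using fourth_moment_off_diagonal[where R = "R n", OF i l False R_B B] False
        unfolding T_def C1_def by (auto simp: mult_ac)
    qed
    then show "integrable M (\<lambda>\<omega>. cmod (T n \<omega>) ^ 4)" "expectation (\<lambda>\<omega>. cmod (T n \<omega>) ^ 4) \<le> C * (real n)\<^sup>2" by auto
  qed
  have "AE \<omega> in M. (\<lambda>n. Z n \<omega>) \<longlonglongrightarrow> 0"
  proof (rule AE_tendsto_zero_of_fourth_moments)
    fix n :: nat assume n: "1 \<le> n"
    have Z4: "cmod (Z n \<omega>) ^ 4 = cmod (T n \<omega>) ^ 4 / real n ^ 4" for \<omega>
      by (simp add: Z_T[OF n] norm_divide power_divide)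
    show "integrable M (\<lambda>\<omega>. cmod (Z n \<omega>) ^ 4)" unfolding Z4 using T(1)[OF n] by simp
    have "expectation (\<lambda>\<omega>. cmod (Z n \<omega>) ^ 4) \<le> C * (real n)\<^sup>2 / real n ^ 4"
      unfolding Z4 using T(2)[OF n] by (simp add: divide_right_mono)
    also have "\<dots> = C / (real n)\<^sup>2" using n by (simp add: field_simps power2_eq_square power4_eq_xxxx)
    finally show "expectation (\<lambda>\<omega>. cmod (Z n \<omega>) ^ 4) \<le> C / (real n)\<^sup>2" .
  qed
  then show ?thesis
  proof (rule AE_mp, intro AE_I2 impI)
    fix \<omega> assume "(\<lambda>n. Z n \<omega>) \<longlonglongrightarrow> 0"
    moreover have "c \<longlonglongrightarrow> (if i = l then G else 0)" unfolding c_def using G by simp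
    ultimately have "(\<lambda>n. Z n \<omega> + of_real (c n)) \<longlonglongrightarrow> 0 + of_real (if i = l then G else 0)"
      by (intro tendsto_add tendsto_of_real)
    then show "(\<lambda>n. resolvent_gram n (P n) (g n) (scaled n \<omega>) i l) \<longlonglongrightarrow> of_real (if i = l then G else 0)"
      by (simp add: Z_def)
  qed
qed

end

section \<open>Gram--Schmidt orthonormalisation\<close>

lemma gs_aux_snoc: "gs_aux ws (vs @ [v]) = gs_aux ws vs @ [gs_next (gs_aux ws vs) v]"
  by (induction vs arbitrary: ws) auto

lemma length_gs_aux: "length (gs_aux ws vs) = length ws + length vs"
  by (induction vs arbitrary: ws) auto

text \<open>The first i output vectors depend on the first i inputs only, which opens the list
  version of Gram--Schmidt to induction on i.\<close>

lemma gs_aux_eq_map: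
  assumes "i \<le> r"
  shows "gs_aux [] (map v [1..<i + 1]) = map (gram_schmidt_c r v) [1..<i + 1]"
proof (rule nth_equalityI)
  have step: "gs_aux [] (map v [1..<Suc k + 1]) = gs_aux [] (map v [1..<k + 1]) @ [gs_next (gs_aux [] (map v [1..<k + 1])) (v (Suc k))]" for k
    using gs_aux_snoc[of "[]" "map v [1..<k + 1]" "v (Suc k)"] by simp
  have pre: "gs_aux [] (map v [1..<k + 1]) ! j = gs_aux [] (map v [1..<i + 1]) ! j" if "i \<le> k" "j < i" for j k
    using that
  proof (induction k rule: dec_induct)
    case (step k)
    have "j < length (gs_aux [] (map v [1..<k + 1]))" using step by (simp add: length_gs_aux)
    then show ?case using step gs_aux_snoc[of "[]" "map v [1..<k + 1]" "v (Suc k)"] by (simp add: nth_append)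
  qed simp
  fix j assume "j < length (gs_aux [] (map v [1..<i + 1]))"
  then have j: "j < i" by (simp add: length_gs_aux del: upt_Suc)
  then have "map (gram_schmidt_c r v) [1..<i + 1] ! j = gs_aux [] (map v [1..<r + 1]) ! j"
    by (simp add: gram_schmidt_c_def del: upt_Suc)
  then show "gs_aux [] (map v [1..<i + 1]) ! j = map (gram_schmidt_c r v) [1..<i + 1] ! j"
    using pre[OF assms j] by simp
qed (simp add: length_gs_aux)

lemma gram_schmidt_c_rec:
  assumes "i \<in> {1..r}"
  shows "gram_schmidt_c r v i = gs_next (map (gram_schmidt_c r v) [1..<i]) (v i)"
proof -
  obtain k where k: "i = Suc k" using assms by (cases i) auto
  have "gram_schmidt_c r v i = map (gram_schmidt_c r v) [1..<i + 1] ! k"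
    using k by (simp add: nth_append)
  also have "\<dots> = gs_aux [] (map v [1..<k + 1] @ [v i]) ! k"
    using gs_aux_eq_map[of i r v] assms k by simp
  also have "\<dots> = gs_next (gs_aux [] (map v [1..<k + 1])) (v i)"
    unfolding gs_aux_snoc by (simp add: nth_append length_gs_aux)
  finally show ?thesis using gs_aux_eq_map[of k r v] assms k by simp
qed

lemma gs_next_index:
  assumes "dim_vec v = n" "\<And>q. q \<in> set ws \<Longrightarrow> dim_vec q = n"
  shows "dim_vec (gs_next ws v) = n"
    "l < n \<Longrightarrow> gs_next ws v $ l = of_real (1 / sqrt (sqn n (\<lambda>l. v $ l - (\<Sum>q\<leftarrow>ws. ip n (($) v) (($) q) * q $ l))))
       * (v $ l - (\<Sum>q\<leftarrow>ws. ip n (($) v) (($) q) * q $ l))"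
proof -
  show "dim_vec (gs_next ws v) = n" by (simp add: gs_next_def Let_def assms)
  assume l: "l < n"
  have c: "cinner_vec v q = ip n (($) v) (($) q)" for q by (simp add: cinner_vec_def ip_def assms)
  have "vnorm (vec n (\<lambda>l. v $ l - (\<Sum>q\<leftarrow>ws. ip n (($) v) (($) q) * q $ l)))
    = sqrt (sqn n (\<lambda>l. v $ l - (\<Sum>q\<leftarrow>ws. ip n (($) v) (($) q) * q $ l)))"
    by (simp add: vnorm_def sqn_def)
  then show "gs_next ws v $ l = of_real (1 / sqrt (sqn n (\<lambda>l. v $ l - (\<Sum>q\<leftarrow>ws. ip n (($) v) (($) q) * q $ l))))
       * (v $ l - (\<Sum>q\<leftarrow>ws. ip n (($) v) (($) q) * q $ l))"
    using l by (simp add: gs_next_def Let_def assms(1) c)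
qed

lemma complex_cnj_of_bool: "cnj (of_bool b) = of_bool b"
  by simp

lemma ip_cong: "(\<And>j. j < n \<Longrightarrow> x j = x' j) \<Longrightarrow> (\<And>j. j < n \<Longrightarrow> y j = y' j) \<Longrightarrow> ip n x y = ip n x' y'"
  by (simp add: ip_def)

text \<open>The inputs are asymptotically orthonormal, so in the limit the procedure changes
  nothing: the i-th output is a combination of the \<open>v n m\<close> whose coefficients tend to
  those of \<open>v n i\<close>. The representation holds for every n: where a remainder vanishes, 1
  / 0 = 0 makes the coefficients zero, and this happens for finitely many n only.\<close>

lemma gram_schmidt_c_asymptotics:
  fixes v :: "nat \<Rightarrow> nat \<Rightarrow> complex vec"
  assumes dim: "\<And>n i. dim_vec (v n i) = n"
    and lim: "\<And>i j. i \<in> {1..r} \<Longrightarrow> j \<in> {1..r} \<Longrightarrow> (\<lambda>n. ip n (($) (v n i)) (($) (v n j))) \<longlonglongrightarrow> of_bool (i = j)"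
    and "i \<in> {1..r}"
  shows "(\<forall>n. dim_vec (gram_schmidt_c r (v n) i) = n) \<and>
    (\<exists>c. (\<forall>m\<in>{1..r}. (\<lambda>n. c n m) \<longlonglongrightarrow> of_bool (i = m)) \<and>
      (\<forall>n. \<forall>l<n. gram_schmidt_c r (v n) i $ l = (\<Sum>m\<in>{1..r}. c n m * v n m $ l)))"
  using assms(3)
proof (induction i rule: less_induct)
  case (less i)
  define u where "u n = gram_schmidt_c r (v n)" for n
  have "\<forall>j\<in>{1..<i}. \<exists>c. (\<forall>m\<in>{1..r}. (\<lambda>n. c n m) \<longlonglongrightarrow> of_bool (j = m)) \<and>
      (\<forall>n. \<forall>l<n. u n j $ l = (\<Sum>m\<in>{1..r}. c n m * v n m $ l))"
    using less by (simp add: u_def)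
  from bchoice[OF this] obtain c where c: "\<And>j m. j \<in> {1..<i} \<Longrightarrow> m \<in> {1..r} \<Longrightarrow> (\<lambda>n. c j n m) \<longlonglongrightarrow> of_bool (j = m)"
      "\<And>j n l. j \<in> {1..<i} \<Longrightarrow> l < n \<Longrightarrow> u n j $ l = (\<Sum>m\<in>{1..r}. c j n m * v n m $ l)"
    by blast
  have udim: "dim_vec (u n j) = n" if "j \<in> {1..<i}" for n j
    using less that by (simp add: u_def)
  define h where "h j n = ip n (($) (v n i)) (($) (u n j))" for j n
  have h_lim: "(\<lambda>n. h j n) \<longlonglongrightarrow> 0" if j: "j \<in> {1..<i}" for j
  proof -
    have "h j n = (\<Sum>m\<in>{1..r}. cnj (c j n m) * ip n (($) (v n i)) (($) (v n m)))" for n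
      unfolding h_def ip_sum_right[symmetric] using c(2)[OF j] by (intro ip_cong) auto
    moreover have "(\<lambda>n. \<Sum>m\<in>{1..r}. cnj (c j n m) * ip n (($) (v n i)) (($) (v n m)))
        \<longlonglongrightarrow> (\<Sum>m\<in>{1..r}. cnj (of_bool (j = m)) * of_bool (i = m))"
      using c(1)[OF j] less.prems by (intro tendsto_intros lim) auto
    moreover have "(\<Sum>m\<in>{1..r}. cnj (of_bool (j = m)) * of_bool (i = m)) = (0 :: complex)"
      using j by (intro sum.neutral) auto
    ultimately show ?thesis by simp
  qed
  \<comment> \<open>Coefficients of the unnormalised remainder \<open>w n\<close>, found by
    inserting the representations of the earlier output vectors.\<close>
  define a where "a n m = of_bool (i = m) - (\<Sum>j\<in>{1..<i}. h j n * c j n m)" for n m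
  have a_lim: "(\<lambda>n. a n m) \<longlonglongrightarrow> of_bool (i = m)" if m: "m \<in> {1..r}" for m
  proof -
    have "(\<lambda>n. a n m) \<longlonglongrightarrow> of_bool (i = m) - (\<Sum>j\<in>{1..<i}. 0 * of_bool (j = m))"
      unfolding a_def using m by (intro tendsto_intros h_lim c(1)) auto
    then show ?thesis by simp
  qed
  define w where "w n l = v n i $ l - (\<Sum>q\<leftarrow>map (u n) [1..<i]. ip n (($) (v n i)) (($) q) * q $ l)" for n l
  have w: "w n l = (\<Sum>m\<in>{1..r}. a n m * v n m $ l)" if "l < n" for n l
  proof -
    have "w n l = v n i $ l - (\<Sum>j\<in>{1..<i}. h j n * u n j $ l)"
      by (simp add: w_def h_def comp_def interv_sum_list_conv_sum_set_nat)
    also have "(\<Sum>j\<in>{1..<i}. h j n * u n j $ l) = (\<Sum>j\<in>{1..<i}. \<Sum>m\<in>{1..r}. h j n * c j n m * v n m $ l)"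
      using c(2) that by (intro sum.cong refl) (simp add: sum_distrib_left mult.assoc)
    also have "\<dots> = (\<Sum>m\<in>{1..r}. (\<Sum>j\<in>{1..<i}. h j n * c j n m) * v n m $ l)"
      by (subst sum.swap) (simp add: sum_distrib_right)
    also have "v n i $ l = (\<Sum>m\<in>{1..r}. of_bool (i = m) * v n m $ l)"
      using less.prems by (simp add: of_bool_def if_distrib[where f = "\<lambda>x. x * _"] cong: if_cong)
    finally show ?thesis by (simp add: a_def algebra_simps sum_subtractf)
  qed
  have w_lim: "(\<lambda>n. sqn n (w n)) \<longlonglongrightarrow> 1"
  proof -
    have "of_real (sqn n (w n)) = (\<Sum>m\<in>{1..r}. a n m * (\<Sum>m'\<in>{1..r}. cnj (a n m') * ip n (($) (v n m)) (($) (v n m'))))" for n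
    proof -
      have "of_real (sqn n (w n)) = ip n (w n) (w n)" by (simp add: sqn_def ip_self)
      also have "\<dots> = ip n (\<lambda>l. \<Sum>m\<in>{1..r}. a n m * v n m $ l) (\<lambda>l. \<Sum>m\<in>{1..r}. a n m * v n m $ l)"
        using w by (intro ip_cong)
      finally show ?thesis unfolding ip_sum_left ip_sum_right .
    qed
    moreover have "(\<lambda>n. \<Sum>m\<in>{1..r}. a n m * (\<Sum>m'\<in>{1..r}. cnj (a n m') * ip n (($) (v n m)) (($) (v n m'))))
      \<longlonglongrightarrow> (\<Sum>m\<in>{1..r}. of_bool (i = m) * (\<Sum>m'\<in>{1..r}. cnj (of_bool (i = m')) * of_bool (m = m')))"
      by (intro tendsto_intros a_lim lim) auto
    moreover have "(\<Sum>m\<in>{1..r}. of_bool (i = m) * (\<Sum>m'\<in>{1..r}. cnj (of_bool (i = m')) * of_bool (m = m'))) = (1 :: complex)"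
      using less.prems by (simp add: of_bool_def if_distrib[where f = "\<lambda>x. x * _"] if_distrib[where f = cnj] cong: if_cong)
    ultimately have "(\<lambda>n. complex_of_real (sqn n (w n))) \<longlonglongrightarrow> of_real 1" by simp
    then show ?thesis by (simp only: tendsto_of_real_iff)
  qed
  then have norm_lim: "(\<lambda>n. complex_of_real (1 / sqrt (sqn n (w n)))) \<longlonglongrightarrow> of_real (1 / sqrt 1)"
    by (intro tendsto_intros) auto
  have rec: "u n i = gs_next (map (u n) [1..<i]) (v n i)" for n
    unfolding u_def by (rule gram_schmidt_c_rec[OF less.prems])
  have "dim_vec (u n i) = n" for n
    unfolding rec by (rule gs_next_index(1)[OF dim]) (auto simp: udim)
  moreover have "u n i $ l = (\<Sum>m\<in>{1..r}. (of_real (1 / sqrt (sqn n (w n))) * a n m) * v n m $ l)" if "l < n" for n l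
  proof -
    have "u n i $ l = of_real (1 / sqrt (sqn n (w n))) * w n l"
      unfolding rec w_def by (rule gs_next_index(2)[OF dim _ that]) (auto simp: udim)
    then show ?thesis by (simp add: w[OF that] sum_distrib_left mult.assoc)
  qed
  moreover have "(\<lambda>n. of_real (1 / sqrt (sqn n (w n))) * a n m) \<longlonglongrightarrow> of_bool (i = m)" if "m \<in> {1..r}" for m
    using tendsto_mult[OF norm_lim a_lim[OF that]] by simp
  ultimately show ?case
    by (intro conjI allI exI[of _ "\<lambda>n m. of_real (1 / sqrt (sqn n (w n))) * a n m"]) (auto simp: u_def)
qed

lemma resolvent_gram_cong:
  assumes "\<And>i l. l < n \<Longrightarrow> u i l = u' i l"
  shows "resolvent_gram n P g u i l = resolvent_gram n P g u' i l"
  unfolding resolvent_gram_def using assms by (simp add: ip_def)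

text \<open>Gram entries are sesquilinear in the vectors and the number r of coefficients is fixed,
  so the limit is taken termwise with the coefficients replaced by their limits.\<close>

lemma gram_schmidt_c_resolvent_gram_tendsto:
  fixes v :: "nat \<Rightarrow> nat \<Rightarrow> complex vec"
  assumes dim: "\<And>n i. dim_vec (v n i) = n"
    and lim: "\<And>i j. i \<in> {1..r} \<Longrightarrow> j \<in> {1..r} \<Longrightarrow> (\<lambda>n. ip n (($) (v n i)) (($) (v n j))) \<longlonglongrightarrow> of_bool (i = j)"
    and gram: "\<And>i j. i \<in> {1..r} \<Longrightarrow> j \<in> {1..r} \<Longrightarrow>
      (\<lambda>n. resolvent_gram n (P n) (g n) (\<lambda>i. ($) (v n i)) i j) \<longlonglongrightarrow> of_real (if i = j then G else 0)"
    and i: "i \<in> {1..r}" and j: "j \<in> {1..r}"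
  shows "(\<lambda>n. resolvent_gram n (P n) (g n) (\<lambda>i. ($) (gram_schmidt_c r (v n) i)) i j) \<longlonglongrightarrow> of_real (if i = j then G else 0)"
proof -
  define u where "u n = gram_schmidt_c r (v n)" for n
  obtain c where c: "\<And>m. m \<in> {1..r} \<Longrightarrow> (\<lambda>n. c n m) \<longlonglongrightarrow> of_bool (i = m)"
     "\<And>n l. l < n \<Longrightarrow> u n i $ l = (\<Sum>m\<in>{1..r}. c n m * v n m $ l)"
    using gram_schmidt_c_asymptotics[OF dim lim i] unfolding u_def by blast
  obtain d where d: "\<And>m. m \<in> {1..r} \<Longrightarrow> (\<lambda>n. d n m) \<longlonglongrightarrow> of_bool (j = m)"
     "\<And>n l. l < n \<Longrightarrow> u n j $ l = (\<Sum>m\<in>{1..r}. d n m * v n m $ l)"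
    using gram_schmidt_c_asymptotics[OF dim lim j] unfolding u_def by blast
  have ipc: "ip n (($) (u n i)) (P n k) = (\<Sum>m\<in>{1..r}. c n m * ip n (($) (v n m)) (P n k))" for n k
    unfolding ip_sum_left[symmetric] using c(2) by (intro ip_cong) auto
  have ipd: "ip n (($) (u n j)) (P n k) = (\<Sum>m\<in>{1..r}. d n m * ip n (($) (v n m)) (P n k))" for n k
    unfolding ip_sum_left[symmetric] using d(2) by (intro ip_cong) auto
  have "resolvent_gram n (P n) (g n) (\<lambda>i. ($) (u n i)) i j
    = (\<Sum>m\<in>{1..r}. \<Sum>m'\<in>{1..r}. c n m * cnj (d n m') * resolvent_gram n (P n) (g n) (\<lambda>i. ($) (v n i)) m m')" for n
  proof -
    have "resolvent_gram n (P n) (g n) (\<lambda>i. ($) (u n i)) i j = (\<Sum>k<n. \<Sum>m\<in>{1..r}. \<Sum>m'\<in>{1..r}.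
        c n m * cnj (d n m') * (of_real (g n k) * (ip n (($) (v n m)) (P n k) * cnj (ip n (($) (v n m')) (P n k)))))"
      unfolding resolvent_gram_def ipc ipd cnj_sum sum_product by (simp add: sum_distrib_left mult_ac)
    also have "\<dots> = (\<Sum>m\<in>{1..r}. \<Sum>m'\<in>{1..r}. \<Sum>k<n.
        c n m * cnj (d n m') * (of_real (g n k) * (ip n (($) (v n m)) (P n k) * cnj (ip n (($) (v n m')) (P n k)))))"
      by (rule sum_swap_last[symmetric])
    finally show ?thesis by (simp only: resolvent_gram_def sum_distrib_left)
  qed
  moreover have "(\<lambda>n. \<Sum>m\<in>{1..r}. \<Sum>m'\<in>{1..r}. c n m * cnj (d n m') * resolvent_gram n (P n) (g n) (\<lambda>i. ($) (v n i)) m m')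
     \<longlonglongrightarrow> (\<Sum>m\<in>{1..r}. \<Sum>m'\<in>{1..r}. of_bool (i = m) * cnj (of_bool (j = m')) * of_real (if m = m' then G else 0))"
    by (intro tendsto_intros c(1) d(1) gram)
  moreover have "(\<Sum>m\<in>{1..r}. \<Sum>m'\<in>{1..r}. of_bool (i = m) * cnj (of_bool (j = m')) * of_real (if m = m' then G else 0))
      = complex_of_real (if i = j then G else 0)"
  proof -
    have pick: "(\<Sum>m\<in>{1..r}. of_bool (k = m) * f m) = f k" if "k \<in> {1..r}" for k and f :: "nat \<Rightarrow> complex"
    proof -
      have "(\<Sum>m\<in>{1..r}. of_bool (k = m) * f m) = (\<Sum>m\<in>{1..r}. if m = k then f m else 0)"
        by (intro sum.cong) auto
      then show ?thesis using that by simp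
    qed
    have "(\<Sum>m\<in>{1..r}. \<Sum>m'\<in>{1..r}. of_bool (i = m) * cnj (of_bool (j = m')) * of_real (if m = m' then G else 0))
      = (\<Sum>m\<in>{1..r}. of_bool (i = m) * (\<Sum>m'\<in>{1..r}. of_bool (j = m') * of_real (if m = m' then G else 0)))"
      by (simp only: sum_distrib_left mult.assoc complex_cnj_of_bool)
    then show ?thesis by (simp only: pick[OF i] pick[OF j])
  qed
  ultimately show ?thesis unfolding u_def by simp
qed

section \<open>Asymptotic eigenvalue counts\<close>

text \<open>R is finite and the conditions on \<epsilon> in the two counting bounds come from strict
  inequalities that hold at \<epsilon> = 0, so one positive \<epsilon> satisfies all of them; the
  Gram matrix is eventually that close to its limit.\<close>

lemma eventually_count_outliers:
  assumes es: "\<And>n. eigensystem n (A n) (P n) (lam n)" and es': "\<And>n. eigensystem n (A' n) (P' n) (lam' n)"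
    and R: "finite R"
    and A': "\<And>n i j. i < n \<Longrightarrow> j < n \<Longrightarrow> A' n i j = A n i j + (\<Sum>l\<in>R. of_real (\<theta> l) * u n l i * cnj (u n l j))"
    and t: "eventually (\<lambda>n. \<forall>k<n. lam n k < t) sequentially" and G: "0 < G"
    and K: "\<And>l m. l \<in> R \<Longrightarrow> m \<in> R \<Longrightarrow>
      (\<lambda>n. resolvent_gram n (P n) (\<lambda>k. 1 / (t - lam n k)) (u n) l m) \<longlonglongrightarrow> of_real (if l = m then G else 0)"
  shows "eventually (\<lambda>n. card {l \<in> R. 1 / G < \<theta> l} \<le> count_above n (lam' n) t \<and>
    count_above n (lam' n) t \<le> card {l \<in> R. 1 / G \<le> \<theta> l}) sequentially"
proof -
  define \<Theta> where "\<Theta> = (\<Sum>l\<in>R. \<bar>\<theta> l\<bar>)"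
  have \<Theta>: "\<bar>\<theta> l\<bar> \<le> \<Theta>" if "l \<in> R" for l
    unfolding \<Theta>_def using that R by (intro member_le_sum) auto
  have "eventually (\<lambda>\<epsilon> :: real. \<theta> l < 1 / G \<longrightarrow> \<theta> l < 1 / G - \<epsilon> * card R / G\<^sup>2) (at_right 0)" for l
  proof (cases "\<theta> l < 1 / G")
    case True
    have "((\<lambda>\<epsilon> :: real. 1 / G - \<epsilon> * card R / G\<^sup>2) \<longlongrightarrow> 1 / G - 0 * real (card R) / G\<^sup>2) (at_right 0)"
      using G by (intro tendsto_intros) auto
    from order_tendstoD(1)[OF this, of "\<theta> l"] True show ?thesis by (auto elim: eventually_mono)
  qed simp
  moreover have "eventually (\<lambda>\<epsilon> :: real. 1 / G < \<theta> l \<longrightarrow> G + \<epsilon> * (1 + 2 * G * \<Theta> + card R * \<Theta>) * card R < G\<^sup>2 * \<theta> l) (at_right 0)" for l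
  proof (cases "1 / G < \<theta> l")
    case True
    then have "G\<^sup>2 * (1 / G) < G\<^sup>2 * \<theta> l" using G by (intro mult_strict_left_mono) auto
    then have "G < G\<^sup>2 * \<theta> l" using G by (simp add: power2_eq_square)
    moreover have "((\<lambda>\<epsilon>. G + \<epsilon> * (1 + 2 * G * \<Theta> + card R * \<Theta>) * card R) \<longlongrightarrow>
        G + 0 * (1 + 2 * G * \<Theta> + card R * \<Theta>) * card R) (at_right 0)"
      by (intro tendsto_intros)
    ultimately show ?thesis using order_tendstoD(2)[of _ _ _ "G\<^sup>2 * \<theta> l"] by (auto elim: eventually_mono)
  qed simp
  ultimately have ev1: "eventually (\<lambda>\<epsilon>. \<forall>l\<in>R. (\<theta> l < 1 / G \<longrightarrow> \<theta> l < 1 / G - \<epsilon> * card R / G\<^sup>2) \<and>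
      (1 / G < \<theta> l \<longrightarrow> G + \<epsilon> * (1 + 2 * G * \<Theta> + card R * \<Theta>) * card R < G\<^sup>2 * \<theta> l)) (at_right (0 :: real))"
    by (intro eventually_ball_finite[OF R] ballI eventually_conj)
  have ev2: "eventually (\<lambda>\<epsilon>. 0 < \<epsilon> \<and> \<epsilon> \<le> 1) (at_right (0 :: real))"
    unfolding eventually_at_right_field by (intro exI[of _ 1]) auto
  have "\<exists>\<epsilon> :: real. (\<forall>l\<in>R. (\<theta> l < 1 / G \<longrightarrow> \<theta> l < 1 / G - \<epsilon> * card R / G\<^sup>2) \<and>
      (1 / G < \<theta> l \<longrightarrow> G + \<epsilon> * (1 + 2 * G * \<Theta> + card R * \<Theta>) * card R < G\<^sup>2 * \<theta> l)) \<and> 0 < \<epsilon> \<and> \<epsilon> \<le> 1"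
    by (rule eventually_happens'[OF trivial_limit_at_right_real eventually_conj[OF ev1 ev2]])
  then obtain \<epsilon> :: real where \<epsilon>: "0 < \<epsilon>" "\<epsilon> \<le> 1"
    "\<And>l. l \<in> R \<Longrightarrow> \<theta> l < 1 / G \<Longrightarrow> \<theta> l \<le> 1 / G - \<epsilon> * card R / G\<^sup>2"
    "\<And>l. l \<in> R \<Longrightarrow> 1 / G < \<theta> l \<Longrightarrow> G + \<epsilon> * (1 + 2 * G * \<Theta> + card R * \<Theta>) * card R < G\<^sup>2 * \<theta> l"
    by (auto intro: less_imp_le)
  have "eventually (\<lambda>n. \<forall>l\<in>R. \<forall>m\<in>R. cmod (resolvent_gram n (P n) (\<lambda>k. 1 / (t - lam n k)) (u n) l m - (if l = m then of_real G else 0)) \<le> \<epsilon>) sequentially"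
  proof (intro eventually_ball_finite[OF R] ballI)
    fix l m assume lm: "l \<in> R" "m \<in> R"
    show "eventually (\<lambda>n. cmod (resolvent_gram n (P n) (\<lambda>k. 1 / (t - lam n k)) (u n) l m - (if l = m then of_real G else 0)) \<le> \<epsilon>) sequentially"
      using tendstoD[OF K[OF lm] \<epsilon>(1)] by eventually_elim (cases "l = m"; simp add: dist_norm)
  qed
  then show ?thesis using t
  proof eventually_elim
    case (elim n)
    have Kn: "cmod (resolvent_gram n (P n) (\<lambda>k. 1 / (t - lam n k)) (u n) l m - (if l = m then of_real G else 0)) \<le> \<epsilon>"
      if "l \<in> R" "m \<in> R" for l m using elim(1) that by blast
    have tn: "\<And>k. k < n \<Longrightarrow> lam n k < t" using elim(2) by blast
    show ?case
    proof
      show "card {l \<in> R. 1 / G < \<theta> l} \<le> count_above n (lam' n) t"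
        by (rule count_above_outliers_ge[OF es es' R A' tn G _ \<epsilon>(2) Kn \<Theta> \<epsilon>(4)]) (use \<epsilon>(1) in auto)
      show "count_above n (lam' n) t \<le> card {l \<in> R. 1 / G \<le> \<theta> l}"
        by (rule count_above_outliers_le[OF es es' R A' tn G _ Kn \<epsilon>(3)]) (use \<epsilon>(1) in auto)
    qed
  qed
qed

section \<open>Reading ordered eigenvalues from counts\<close>

lemma eigensystem_uminus:
  assumes "eigensystem n A P lam"
  shows "eigensystem n (\<lambda>i j. - A i j) P (\<lambda>k. - lam k)"
  using assms by (auto simp: eigensystem_def sum_negf)

text \<open>With indices from 0, the entry at \<open>n - 1 - q\<close> is the (q + 1)-st largest,
  and it exceeds t exactly if at least q + 1 entries do. The last two clauses treat the negated
  list, whose (q + 1)-st largest entry is \<open>- xs ! q\<close>.\<close>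

lemma count_above_sorted:
  assumes "sorted xs" "length xs = n" "q < n"
  shows "count_above n (\<lambda>k. xs ! k) t \<le> q \<Longrightarrow> xs ! (n - 1 - q) \<le> t"
    "Suc q \<le> count_above n (\<lambda>k. xs ! k) t \<Longrightarrow> t < xs ! (n - 1 - q)"
    "count_above n (\<lambda>k. - xs ! k) t \<le> q \<Longrightarrow> - t \<le> xs ! q"
    "Suc q \<le> count_above n (\<lambda>k. - xs ! k) t \<Longrightarrow> xs ! q < - t"
proof -
  have mono: "xs ! i \<le> xs ! j" if "i \<le> j" "j < n" for i j
    using sorted_nth_mono[OF assms(1)] that assms(2) by simp
  show "xs ! (n - 1 - q) \<le> t" if c: "count_above n (\<lambda>k. xs ! k) t \<le> q"
  proof (rule ccontr)
    assume "\<not> xs ! (n - 1 - q) \<le> t"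
    then have "{n - 1 - q..<n} \<subseteq> {k. k < n \<and> t < xs ! k}"
      using mono[of "n - 1 - q"] by force
    then have "card {n - 1 - q..<n} \<le> count_above n (\<lambda>k. xs ! k) t"
      unfolding count_above_def by (intro card_mono) auto
    then show False using c assms(3) by simp
  qed
  show "t < xs ! (n - 1 - q)" if c: "Suc q \<le> count_above n (\<lambda>k. xs ! k) t"
  proof (rule ccontr)
    assume a: "\<not> t < xs ! (n - 1 - q)"
    have "{k. k < n \<and> t < xs ! k} \<subseteq> {n - q..<n}"
    proof
      fix k assume k: "k \<in> {k. k < n \<and> t < xs ! k}"
      have "\<not> k \<le> n - 1 - q" using mono[of k "n - 1 - q"] k a assms(3) by auto
      then show "k \<in> {n - q..<n}" using k by auto
    qed
    then have "count_above n (\<lambda>k. xs ! k) t \<le> card {n - q..<n}"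
      unfolding count_above_def by (intro card_mono) auto
    then show False using c assms(3) by simp
  qed
  show "- t \<le> xs ! q" if c: "count_above n (\<lambda>k. - xs ! k) t \<le> q"
  proof (rule ccontr)
    assume a: "\<not> - t \<le> xs ! q"
    have "{..q} \<subseteq> {k. k < n \<and> t < - xs ! k}"
    proof
      fix k assume "k \<in> {..q}"
      then show "k \<in> {k. k < n \<and> t < - xs ! k}" using mono[of k q] a assms(3) by auto
    qed
    then have "card {..q} \<le> count_above n (\<lambda>k. - xs ! k) t"
      unfolding count_above_def by (intro card_mono) auto
    then show False using c by simp
  qed
  show "xs ! q < - t" if c: "Suc q \<le> count_above n (\<lambda>k. - xs ! k) t"
  proof (rule ccontr)
    assume a: "\<not> xs ! q < - t"
    have "{k. k < n \<and> t < - xs ! k} \<subseteq> {..<q}"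
    proof
      fix k assume k: "k \<in> {k. k < n \<and> t < - xs ! k}"
      have "\<not> q \<le> k" using mono[of q k] k a by auto
      then show "k \<in> {..<q}" by simp
    qed
    then have "count_above n (\<lambda>k. - xs ! k) t \<le> card {..<q}"
      unfolding count_above_def by (intro card_mono) auto
    then show False using c by simp
  qed
qed

text \<open>Every point outside the support has a null neighbourhood, which contains an interval
  around the point with rational endpoints; countably many null intervals have a null union.\<close>

lemma AE_msupport:
  assumes "real_distribution \<mu>"
  shows "AE x in \<mu>. x \<in> msupport \<mu>" "msupport \<mu> \<noteq> {}"
proof -
  interpret real_distribution \<mu> by fact
  define Q where "Q = {(p, q). p \<in> \<rat> \<and> q \<in> \<rat> \<and> emeasure \<mu> {p<..<q} = 0}"
  have "countable (\<rat> \<times> \<rat> :: (real \<times> real) set)" by (intro countable_SIGMA countable_rat)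
  then have Q: "countable Q" by (rule countable_subset[rotated]) (auto simp: Q_def)
  have "(\<Union>(p, q)\<in>Q. {p<..<q}) \<in> null_sets \<mu>"
    by (intro null_sets_UN' Q) (auto simp: Q_def null_sets_def)
  then have "AE x in \<mu>. x \<notin> (\<Union>(p, q)\<in>Q. {p<..<q})" by (rule AE_not_in)
  then show AE: "AE x in \<mu>. x \<in> msupport \<mu>"
  proof (rule AE_mp, intro AE_I2 impI)
    fix x assume x: "x \<notin> (\<Union>(p, q)\<in>Q. {p<..<q})"
    show "x \<in> msupport \<mu>"
      unfolding msupport_def
    proof (intro CollectI allI impI, rule ccontr)
      fix e :: real assume e: "0 < e" "\<not> 0 < emeasure \<mu> (ball x e)"
      obtain p where p: "p \<in> \<rat>" "x - e < p" "p < x" using Rats_dense_in_real[of "x - e" x] e(1) by auto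
      obtain q where q: "q \<in> \<rat>" "x < q" "q < x + e" using Rats_dense_in_real[of x "x + e"] e(1) by auto
      have "emeasure \<mu> {p<..<q} \<le> emeasure \<mu> (ball x e)"
        using p q by (intro emeasure_mono) (auto simp: dist_real_def)
      then have "(p, q) \<in> Q" using e(2) p(1) q(1) by (auto simp: Q_def)
      then show False using x p q by auto
    qed
  qed
  show "msupport \<mu> \<noteq> {}"
  proof
    assume "msupport \<mu> = {}"
    then have "AE x in \<mu>. False" using AE by simp
    then show False by (simp add: AE_False)
  qed
qed

lemma integral_spectral_measure:
  fixes f :: "real \<Rightarrow> real"
  assumes "length (eigs_sorted A) = n" "1 \<le> n" "f \<in> borel_measurable borel"
  shows "(\<integral>x. f x \<partial>spectral_measure A) = (\<Sum>k<n. f (eigs_sorted A ! k)) / real n"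
proof -
  let ?xs = "eigs_sorted A"
  have ne: "mset ?xs \<noteq> {#}" using assms(1,2) by auto
  have "(\<integral>x. f x \<partial>spectral_measure A) = (\<integral>x. f x \<partial>measure_pmf (pmf_of_multiset (mset ?xs)))"
    unfolding spectral_measure_def using assms(3) by (subst integral_distr) auto
  also have "\<dots> = (\<Sum>a\<in>set ?xs. f a * pmf (pmf_of_multiset (mset ?xs)) a)"
    by (rule integral_measure_pmf_real) (auto simp: set_pmf_of_multiset[OF ne])
  also have "\<dots> = (\<Sum>a\<in>set ?xs. real (count (mset ?xs) a) * f a) / real n"
    using assms(1) by (simp add: pmf_of_multiset[OF ne] sum_divide_distrib mult.commute)
  also have "(\<Sum>a\<in>set ?xs. real (count (mset ?xs) a) * f a) = (\<Sum>x\<leftarrow>?xs. f x)"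
  proof -
    \<comment> \<open>Stated for any finite A containing the entries, so that A stays fixed while
      the list grows in the induction.\<close>
    have "(\<Sum>x\<leftarrow>xs. f x) = (\<Sum>a\<in>A. real (count (mset xs) a) * f a)" if "finite A" "set xs \<subseteq> A" for xs A
      using that(2)
    proof (induction xs)
      case (Cons y ys)
      have "(\<Sum>a\<in>A. real (count (mset (y # ys)) a) * f a)
        = (\<Sum>a\<in>A. real (count (mset ys) a) * f a) + (\<Sum>a\<in>A. if a = y then f a else 0)"
        unfolding sum.distrib[symmetric] by (intro sum.cong) (auto simp: algebra_simps)
      then show ?case using Cons that(1) by simp
    qed simp
    from this[of "set ?xs" ?xs] show ?thesis by simp
  qed
  also have "\<dots> = (\<Sum>k<n. f (?xs ! k))"
    using assms(1) by (simp add: sum_list_sum_nth lessThan_atLeast0)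
  finally show ?thesis .
qed

lemma spectral_average_tendsto:
  fixes f :: "real \<Rightarrow> real"
  assumes H1: "hypothesis_H1 X \<mu>" and len: "\<And>n. length (eigs_sorted (X n)) = n"
    and f: "\<And>x. isCont f x" "\<And>x. \<bar>f x\<bar> \<le> B"
  shows "(\<lambda>n. (\<Sum>k<n. f (eigs_sorted (X n) ! k)) / real n) \<longlonglongrightarrow> (\<integral>x. f x \<partial>\<mu>)"
proof -
  have rd: "real_distribution (spectral_measure (X n))" for n
    unfolding spectral_measure_def by (rule prob_space.real_distribution_distr) (auto intro: measure_pmf.prob_space_axioms)
  have "(\<lambda>n. \<integral>x. f x \<partial>spectral_measure (X n)) \<longlonglongrightarrow> (\<integral>x. f x \<partial>\<mu>)"
    using H1 f by (intro weak_conv_imp_integral_bdd_continuous_conv[of _ _ _ B] rd) (auto simp: hypothesis_H1_def)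
  moreover have "f \<in> borel_measurable borel"
    using f(1) by (intro borel_measurable_continuous_onI continuous_at_imp_continuous_on) auto
  \<comment> \<open>The index n = 0 is excluded: there the list is empty and the measure is no
    average over eigenvalues.\<close>
  then have "eventually (\<lambda>n. (\<integral>x. f x \<partial>spectral_measure (X n)) = (\<Sum>k<n. f (eigs_sorted (X n) ! k)) / real n) sequentially"
    using integral_spectral_measure[OF len] by (intro eventually_sequentiallyI[of 1]) auto
  ultimately show ?thesis by (rule Lim_transform_eventually)
qed

text \<open>The shape of the Stieltjes transform beyond an edge: L is its limit at the edge,
  extended-real because it may be infinite. A supercritical \<theta> has 1 / \<theta> < L, and the
  level 1 / \<theta> is attained at exactly one point; otherwise the function stays below that
  level.\<close>

lemma decreasing_branch:
  fixes \<Gamma> :: "real \<Rightarrow> real"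
  assumes pos: "\<And>z. \<beta> < z \<Longrightarrow> 0 < \<Gamma> z" and dec: "\<And>z w. \<beta> < z \<Longrightarrow> z < w \<Longrightarrow> \<Gamma> w < \<Gamma> z"
    and cont: "continuous_on {\<beta><..} \<Gamma>" and lim: "(\<Gamma> \<longlongrightarrow> 0) at_top"
  defines "L \<equiv> SUP z\<in>{\<beta><..}. ereal (\<Gamma> z)"
  shows "((\<lambda>z. ereal (\<Gamma> z)) \<longlongrightarrow> L) (at_right \<beta>)" "0 < L"
    "0 < \<theta> \<Longrightarrow> ereal (1 / \<theta>) < L \<Longrightarrow> \<exists>\<rho>>\<beta>. \<Gamma> \<rho> = 1 / \<theta> \<and> (\<forall>z>\<beta>. (z < \<rho> \<longrightarrow> 1 / \<theta> < \<Gamma> z) \<and> (\<rho> < z \<longrightarrow> \<Gamma> z < 1 / \<theta>))"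
    "0 < \<theta> \<Longrightarrow> \<not> ereal (1 / \<theta>) < L \<Longrightarrow> \<beta> < z \<Longrightarrow> \<Gamma> z < 1 / \<theta>"
proof -
  have lt: "ereal (\<Gamma> z) < L" if z: "\<beta> < z" for z
  proof -
    obtain w where w: "\<beta> < w" "w < z" using dense[OF z] by blast
    have "ereal (\<Gamma> z) < ereal (\<Gamma> w)" using dec[OF w] by simp
    also have "\<dots> \<le> L" unfolding L_def using w by (intro SUP_upper) auto
    finally show ?thesis .
  qed
  show "((\<lambda>z. ereal (\<Gamma> z)) \<longlongrightarrow> L) (at_right \<beta>)"
  proof (rule order_tendstoI)
    fix l assume "l < L"
    then obtain w where w: "\<beta> < w" "l < ereal (\<Gamma> w)" unfolding L_def by (auto simp: less_SUP_iff)
    have "l < ereal (\<Gamma> z)" if "\<beta> < z" "z < w" for z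
      using w(2) dec[OF that] by (metis ereal_less_eq(3) less_imp_le less_le_trans)
    then show "eventually (\<lambda>z. l < ereal (\<Gamma> z)) (at_right \<beta>)"
      using w(1) unfolding eventually_at_right_field by blast
  next
    fix l assume l: "L < l"
    show "eventually (\<lambda>z. ereal (\<Gamma> z) < l) (at_right \<beta>)"
      using lt l unfolding eventually_at_right_field by (intro exI[of _ "\<beta> + 1"]) (auto intro: less_trans)
  qed
  show "0 < L" using lt[of "\<beta> + 1"] pos[of "\<beta> + 1"] by (metis ereal_less(2) less_add_one less_trans)
  show "\<Gamma> z < 1 / \<theta>" if "0 < \<theta>" "\<not> ereal (1 / \<theta>) < L" "\<beta> < z"
    using lt[OF that(3)] that(2) by (metis ereal_less_eq(3) less_le_trans linorder_not_less not_less_iff_gr_or_eq)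
  show "\<exists>\<rho>>\<beta>. \<Gamma> \<rho> = 1 / \<theta> \<and> (\<forall>z>\<beta>. (z < \<rho> \<longrightarrow> 1 / \<theta> < \<Gamma> z) \<and> (\<rho> < z \<longrightarrow> \<Gamma> z < 1 / \<theta>))"
    if \<theta>: "0 < \<theta>" and L: "ereal (1 / \<theta>) < L"
  proof -
    \<comment> \<open>A point above the level comes from the supremum, a point y below it from the
      decay at infinity; the intermediate value theorem acts between them.\<close>
    obtain w where w: "\<beta> < w" "1 / \<theta> < \<Gamma> w" using L unfolding L_def by (auto simp: less_SUP_iff)
    have "eventually (\<lambda>z. \<Gamma> z < 1 / \<theta>) at_top" using order_tendstoD(2)[OF lim] \<theta> by simp
    then obtain y where y: "w < y" "\<Gamma> y < 1 / \<theta>"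
      using eventually_happens'[OF trivial_limit_at_top_linorder eventually_conj[OF eventually_gt_at_top[of w]]] by blast
    have "continuous_on {w..y} \<Gamma>" by (rule continuous_on_subset[OF cont]) (use w(1) in auto)
    then obtain \<rho> where \<rho>: "w \<le> \<rho>" "\<rho> \<le> y" "\<Gamma> \<rho> = 1 / \<theta>"
      using IVT2'[of \<Gamma> y "1 / \<theta>" w] w y by auto
    then show ?thesis using dec w(1) by (intro exI[of _ \<rho>]) (auto simp: \<rho>(3)[symmetric] simp del: \<rho>(3))
  qed
qed

text \<open>Taking \<open>h x = - x\<close> instead of \<open>h x = x\<close> reduces the lower edge of the spectrum to the upper one.\<close>
lemma resolvent_integral:
  fixes h :: "real \<Rightarrow> real"
  assumes "prob_space \<mu>" and [measurable]: "h \<in> borel_measurable \<mu>" and h: "AE x in \<mu>. \<alpha> \<le> h x \<and> h x \<le> \<beta>"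
  defines "\<Gamma> \<equiv> \<lambda>z. \<integral>x. 1 / (z - h x) \<partial>\<mu>"
  shows "\<beta> < z \<Longrightarrow> 0 < \<Gamma> z" "\<beta> < z \<Longrightarrow> z < w \<Longrightarrow> \<Gamma> w < \<Gamma> z"
    "continuous_on {\<beta><..} \<Gamma>" "(\<Gamma> \<longlongrightarrow> 0) at_top"
proof -
  interpret prob_space \<mu> by fact
  have int: "integrable \<mu> (\<lambda>x. 1 / (z - h x))" if "\<beta> < z" for z
  proof (rule integrable_const_bound[where B = "1 / (z - \<beta>)"])
    show "AE x in \<mu>. norm (1 / (z - h x)) \<le> 1 / (z - \<beta>)"
      using h by eventually_elim (use that in \<open>auto intro!: frac_le\<close>)
  qed measurable
  have lower: "1 / (z - \<alpha>) \<le> \<Gamma> z" if "\<beta> < z" for z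
    unfolding \<Gamma>_def
  proof (rule integral_ge_const[OF int[OF that]])
    show "AE x in \<mu>. 1 / (z - \<alpha>) \<le> 1 / (z - h x)"
      using h by eventually_elim (use that in \<open>auto intro!: frac_le\<close>)
  qed
  have upper: "\<Gamma> z \<le> 1 / (z - \<beta>)" if "\<beta> < z" for z
    unfolding \<Gamma>_def
  proof (rule integral_le_const[OF int[OF that]])
    show "AE x in \<mu>. 1 / (z - h x) \<le> 1 / (z - \<beta>)"
      using h by eventually_elim (use that in \<open>auto intro!: frac_le\<close>)
  qed
  have \<alpha>\<beta>: "\<alpha> \<le> \<beta>"
  proof -
    have "AE x in \<mu>. \<alpha> \<le> \<beta>" using h by eventually_elim auto
    then show ?thesis by simp
  qed
  show pos: "0 < \<Gamma> z" if "\<beta> < z" for z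
    using lower[OF that] that \<alpha>\<beta> by (smt (verit) zero_less_divide_1_iff)
  \<comment> \<open>The lower bound yields strict monotonicity and the upper bound local Lipschitz
    continuity, without differentiation under the integral.\<close>
  have diff: "(w - z) / ((z - \<alpha>) * (w - \<alpha>)) \<le> \<Gamma> z - \<Gamma> w \<and> \<Gamma> z - \<Gamma> w \<le> (w - z) / ((z - \<beta>) * (w - \<beta>))"
    if zw: "\<beta> < z" "z \<le> w" for z w
  proof -
    have w: "\<beta> < w" using zw by simp
    have eq: "\<Gamma> z - \<Gamma> w = (\<integral>x. 1 / (z - h x) - 1 / (w - h x) \<partial>\<mu>)"
      unfolding \<Gamma>_def using int[OF zw(1)] int[OF w] by simp
    have int2: "integrable \<mu> (\<lambda>x. 1 / (z - h x) - 1 / (w - h x))"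
      using int[OF zw(1)] int[OF w] by simp
    have pt: "1 / (z - y) - 1 / (w - y) = (w - z) / ((z - y) * (w - y))" if "y \<le> \<beta>" for y
      using that zw by (simp add: field_simps)
    have "(w - z) / ((z - \<alpha>) * (w - \<alpha>)) \<le> \<Gamma> z - \<Gamma> w"
      unfolding eq
    proof (rule integral_ge_const[OF int2])
      show "AE x in \<mu>. (w - z) / ((z - \<alpha>) * (w - \<alpha>)) \<le> 1 / (z - h x) - 1 / (w - h x)"
        using h
      proof eventually_elim
        case (elim x)
        then show ?case unfolding pt[OF conjunct2[OF elim]]
          using zw by (intro divide_left_mono mult_mono mult_pos_pos) auto
      qed
    qed
    moreover have "\<Gamma> z - \<Gamma> w \<le> (w - z) / ((z - \<beta>) * (w - \<beta>))"
      unfolding eq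
    proof (rule integral_le_const[OF int2])
      show "AE x in \<mu>. 1 / (z - h x) - 1 / (w - h x) \<le> (w - z) / ((z - \<beta>) * (w - \<beta>))"
        using h
      proof eventually_elim
        case (elim x)
        then show ?case unfolding pt[OF conjunct2[OF elim]]
          using zw by (intro divide_left_mono mult_mono mult_pos_pos) auto
      qed
    qed
    ultimately show ?thesis by blast
  qed
  show "\<Gamma> w < \<Gamma> z" if zw: "\<beta> < z" "z < w" for z w
  proof -
    have "0 < (w - z) / ((z - \<alpha>) * (w - \<alpha>))" using zw \<alpha>\<beta> by (intro divide_pos_pos mult_pos_pos) auto
    then show ?thesis using diff[of z w] zw by linarith
  qed
  show "continuous_on {\<beta><..} \<Gamma>"
  proof (intro continuous_at_imp_continuous_on ballI)
    fix z assume "z \<in> {\<beta><..}"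
    then have z: "\<beta> < z" by simp
    \<comment> \<open>To the right of the midpoint all denominators stay above
      \<open>m - \<beta>\<close>.\<close>
    define m where "m = (z + \<beta>) / 2"
    have m: "\<beta> < m" "m < z" using z by (auto simp: m_def)
    have ineq: "\<bar>\<Gamma> y - \<Gamma> z\<bar> \<le> \<bar>y - z\<bar> / (m - \<beta>)\<^sup>2" if y: "m < y" for y
    proof -
      have *: "\<bar>\<Gamma> p - \<Gamma> q\<bar> \<le> (q - p) / (m - \<beta>)\<^sup>2" if pq: "m < p" "p \<le> q" for p q
      proof -
        have "(q - p) / ((p - \<beta>) * (q - \<beta>)) \<le> (q - p) / (m - \<beta>)\<^sup>2"
          unfolding power2_eq_square using pq m by (intro divide_left_mono mult_mono mult_pos_pos) auto
        moreover have "0 \<le> (q - p) / ((p - \<alpha>) * (q - \<alpha>))"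
          using pq m \<alpha>\<beta> by (intro divide_nonneg_nonneg mult_nonneg_nonneg) auto
        ultimately show ?thesis using diff[of p q] pq m by (simp add: abs_le_iff)
      qed
      show ?thesis using *[of y z] *[of z y] y m by (cases "y \<le> z") (auto simp: abs_minus_commute)
    qed
    have "((\<lambda>y. \<bar>y - z\<bar> / (m - \<beta>)\<^sup>2) \<longlongrightarrow> \<bar>z - z\<bar> / (m - \<beta>)\<^sup>2) (at z)"
      using m by (intro tendsto_intros) auto
    then have lim0: "((\<lambda>y. \<bar>y - z\<bar> / (m - \<beta>)\<^sup>2) \<longlongrightarrow> 0) (at z)" by simp
    have "eventually (\<lambda>y. m < y) (at z)" using order_tendstoD(1)[OF tendsto_ident_at m(2)] .
    then have "eventually (\<lambda>y. norm (\<Gamma> y - \<Gamma> z) \<le> \<bar>y - z\<bar> / (m - \<beta>)\<^sup>2) (at z)"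
      by eventually_elim (use ineq in simp)
    then have "((\<lambda>y. \<Gamma> y - \<Gamma> z) \<longlongrightarrow> 0) (at z)" by (rule Lim_null_comparison[OF _ lim0])
    then show "isCont \<Gamma> z" unfolding isCont_def by (rule LIM_zero_cancel)
  qed
  show "(\<Gamma> \<longlongrightarrow> 0) at_top"
  proof (rule Lim_null_comparison)
    have "eventually (\<lambda>z. \<beta> < z) at_top" by (rule eventually_gt_at_top)
    then show "eventually (\<lambda>z. norm (\<Gamma> z) \<le> 1 / (z - \<beta>)) at_top"
    proof eventually_elim
      case (elim z)
      then show ?case using upper[OF elim] pos[OF elim] by simp
    qed
    show "((\<lambda>z. 1 / (z - \<beta>)) \<longlongrightarrow> 0) at_top" by real_asymp
  qed
qed

section \<open>Location of the outliers\<close>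

lemma AE_msupport_bounds:
  assumes "real_distribution \<mu>" "compact (msupport \<mu>)"
  shows "Inf (msupport \<mu>) \<in> msupport \<mu>" "Sup (msupport \<mu>) \<in> msupport \<mu>"
    "AE x in \<mu>. Inf (msupport \<mu>) \<le> x \<and> x \<le> Sup (msupport \<mu>)"
proof -
  note ne = AE_msupport(2)[OF assms(1)]
  have cl: "closed (msupport \<mu>)" by (rule compact_imp_closed[OF assms(2)])
  note bd = bounded_imp_bdd_above[OF compact_imp_bounded[OF assms(2)]] bounded_imp_bdd_below[OF compact_imp_bounded[OF assms(2)]]
  show "Inf (msupport \<mu>) \<in> msupport \<mu>" by (rule closed_contains_Inf[OF ne bd(2) cl])
  show "Sup (msupport \<mu>) \<in> msupport \<mu>" by (rule closed_contains_Sup[OF ne bd(1) cl])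
  show "AE x in \<mu>. Inf (msupport \<mu>) \<le> x \<and> x \<le> Sup (msupport \<mu>)"
    using AE_msupport(1)[OF assms(1)] by eventually_elim (auto intro: cInf_lower cSup_upper bd)
qed

text \<open>Moves the comparison with a critical value, defined with 1 / \<infinity> = 0, to the
  scale of the limit L.\<close>

lemma theta_threshold:
  fixes L :: ereal
  assumes "0 < L"
  shows "0 \<le> (if L = \<infinity> then 0 else 1 / real_of_ereal L)"
    "0 < \<theta> \<Longrightarrow> (if L = \<infinity> then 0 else 1 / real_of_ereal L) < \<theta> \<longleftrightarrow> ereal (1 / \<theta>) < L"
  using assms by (cases L; simp add: field_simps)+

text \<open>The critical values are defined by limits at the edges, which monotonicity turns into
  suprema. The reflected integral at s equals \<open>- stieltjes \<mu> (- s)\<close>, so the limit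
  from the left at a is minus a limit from the right at - a.\<close>

lemma stieltjes_edges:
  assumes rd: "real_distribution \<mu>" and cpt: "compact (msupport \<mu>)"
  defines "a \<equiv> Inf (msupport \<mu>)" and "b \<equiv> Sup (msupport \<mu>)"
  defines "Lu \<equiv> SUP z\<in>{b<..}. ereal (stieltjes \<mu> z)" and "Ll \<equiv> SUP s\<in>{- a<..}. ereal (\<integral>x. 1 / (s - (- x)) \<partial>\<mu>)"
  shows "0 < Lu" "0 < Ll" "theta_up \<mu> = (if Lu = \<infinity> then 0 else 1 / real_of_ereal Lu)"
    "theta_low \<mu> = - (if Ll = \<infinity> then 0 else 1 / real_of_ereal Ll)"
proof -
  interpret real_distribution \<mu> by fact
  have AE: "AE x in \<mu>. a \<le> x \<and> x \<le> b" using AE_msupport_bounds(3)[OF rd cpt] by (simp add: a_def b_def)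
  have AE': "AE x in \<mu>. - b \<le> - x \<and> - x \<le> - a" using AE by eventually_elim auto
  have m: "(\<lambda>x. x) \<in> borel_measurable \<mu>" "uminus \<in> borel_measurable \<mu>" by measurable
  note u = resolvent_integral[OF prob_space_axioms m(1) AE, folded stieltjes_def]
  note l = resolvent_integral[OF prob_space_axioms m(2) AE']
  note lu = decreasing_branch(1,2)[OF u(1,2,3,4), folded Lu_def]
  note ll = decreasing_branch(1,2)[OF l(1,2,3,4), folded Ll_def]
  show Lu: "0 < Lu" by (rule lu(2))
  show Ll: "0 < Ll" by (rule ll(2))
  have "Lim (at_right b) (\<lambda>z. ereal (stieltjes \<mu> z)) = Lu"
    by (rule tendsto_Lim[OF _ lu(1)]) simp
  then show "theta_up \<mu> = (if Lu = \<infinity> then 0 else 1 / real_of_ereal Lu)"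
    by (simp add: theta_up_def Let_def b_def)
  have neg: "(\<integral>x. 1 / (s - (- x)) \<partial>\<mu>) = - stieltjes \<mu> (- s)" for s
  proof -
    have "1 / (- s - x) = - (1 / (s - (- x)))" for x :: real by (simp add: minus_divide_right)
    then show ?thesis unfolding stieltjes_def by simp
  qed
  have "((\<lambda>s. - ereal (\<integral>x. 1 / (s - (- x)) \<partial>\<mu>)) \<longlongrightarrow> - Ll) (at_right (- a))"
    using ll(1) by (intro tendsto_uminus_ereal)
  then have "((\<lambda>z. ereal (stieltjes \<mu> z)) \<longlongrightarrow> - Ll) (at_left a)"
    unfolding neg by (simp add: filterlim_at_left_to_right)
  then have "Lim (at_left a) (\<lambda>z. ereal (stieltjes \<mu> z)) = - Ll"
    by (intro tendsto_Lim) simp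
  moreover have "- Ll = - \<infinity> \<longleftrightarrow> Ll = \<infinity>" by (cases Ll) auto
  ultimately show "theta_low \<mu> = - (if Ll = \<infinity> then 0 else 1 / real_of_ereal Ll)"
    by (simp add: theta_low_def Let_def a_def)
qed

text \<open>Brings supercritical and subcritical \<theta> into one form: the threshold is below
  \<theta> before \<open>rho\<close> and above it beyond. For subcritical \<theta> no z lies between
  b and \<open>rho\<close>, so only the second comparison has content.\<close>

lemma rho_positive:
  assumes rd: "real_distribution \<mu>" and cpt: "compact (msupport \<mu>)" and \<theta>: "0 < \<theta>"
  defines "b \<equiv> Sup (msupport \<mu>)"
  shows "b \<le> rho \<mu> \<theta>" "\<And>z. b < z \<Longrightarrow> z < rho \<mu> \<theta> \<Longrightarrow> 1 / (\<integral>x. 1 / (z - x) \<partial>\<mu>) < \<theta>"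
    "\<And>z. b < z \<Longrightarrow> rho \<mu> \<theta> < z \<Longrightarrow> \<theta> < 1 / (\<integral>x. 1 / (z - x) \<partial>\<mu>)"
proof -
  interpret real_distribution \<mu> by fact
  define a where "a = Inf (msupport \<mu>)"
  define Lu where "Lu = (SUP z\<in>{b<..}. ereal (stieltjes \<mu> z))"
  have AE: "AE x in \<mu>. a \<le> x \<and> x \<le> b" using AE_msupport_bounds(3)[OF rd cpt] by (simp add: a_def b_def)
  have m: "(\<lambda>x. x) \<in> borel_measurable \<mu>" by measurable
  note u = resolvent_integral[OF prob_space_axioms m AE, folded stieltjes_def]
  have br1: "\<exists>\<rho>>b. stieltjes \<mu> \<rho> = 1 / \<theta> \<and> (\<forall>z>b. (z < \<rho> \<longrightarrow> 1 / \<theta> < stieltjes \<mu> z) \<and> (\<rho> < z \<longrightarrow> stieltjes \<mu> z < 1 / \<theta>))"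
    if "ereal (1 / \<theta>) < Lu"
    by (rule decreasing_branch(3)[OF u(1,2,3,4) \<theta> that[unfolded Lu_def]])
  have br2: "stieltjes \<mu> z < 1 / \<theta>" if "\<not> ereal (1 / \<theta>) < Lu" "b < z" for z
    by (rule decreasing_branch(4)[OF u(1,2,3,4) \<theta> that(1)[unfolded Lu_def] that(2)])
  note e = stieltjes_edges[OF rd cpt, folded b_def, folded Lu_def]
  have up: "theta_up \<mu> < \<theta> \<longleftrightarrow> ereal (1 / \<theta>) < Lu" unfolding e(3) by (rule theta_threshold(2)[OF e(1) \<theta>])
  have low: "\<not> \<theta> < theta_low \<mu>" using theta_threshold(1)[OF e(2)] \<theta> unfolding e(4) by linarith
  have inv: "1 / stieltjes \<mu> z < \<theta> \<longleftrightarrow> 1 / \<theta> < stieltjes \<mu> z" "\<theta> < 1 / stieltjes \<mu> z \<longleftrightarrow> stieltjes \<mu> z < 1 / \<theta>" if "b < z" for z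
    using u(1)[OF that] \<theta> by (auto simp: field_simps)
  have main: "b \<le> rho \<mu> \<theta> \<and> (\<forall>z>b. (z < rho \<mu> \<theta> \<longrightarrow> 1 / stieltjes \<mu> z < \<theta>) \<and> (rho \<mu> \<theta> < z \<longrightarrow> \<theta> < 1 / stieltjes \<mu> z))"
  proof (cases "theta_up \<mu> < \<theta>")
    case True
    then obtain \<rho> where \<rho>: "b < \<rho>" "stieltjes \<mu> \<rho> = 1 / \<theta>"
      "\<And>z. b < z \<Longrightarrow> (z < \<rho> \<longrightarrow> 1 / \<theta> < stieltjes \<mu> z) \<and> (\<rho> < z \<longrightarrow> stieltjes \<mu> z < 1 / \<theta>)"
      using br1 up by blast
    have "rho \<mu> \<theta> = (THE z. z > b \<and> stieltjes \<mu> z = 1 / \<theta>)" using True by (simp add: rho_def Let_def b_def)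
    also have "\<dots> = \<rho>"
    proof (rule the_equality)
      fix z assume z: "b < z \<and> stieltjes \<mu> z = 1 / \<theta>"
      then show "z = \<rho>" using \<rho>(3)[of z] by (cases z \<rho> rule: linorder_cases) auto
    qed (use \<rho> in simp)
    finally show ?thesis using \<rho> inv by auto
  next
    case False
    then have "rho \<mu> \<theta> = b" using low \<theta> by (simp add: rho_def Let_def b_def)
    then show ?thesis using br2 False up inv by auto
  qed
  show "b \<le> rho \<mu> \<theta>" using main by blast
  show "1 / (\<integral>x. 1 / (z - x) \<partial>\<mu>) < \<theta>" if "b < z" "z < rho \<mu> \<theta>" for z
    using main that unfolding stieltjes_def by blast
  show "\<theta> < 1 / (\<integral>x. 1 / (z - x) \<partial>\<mu>)" if "b < z" "rho \<mu> \<theta> < z" for z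
    using main that unfolding stieltjes_def by blast
qed

text \<open>The mirror image under x to - x: the edge is - a, the strength - \<theta> is positive
  and the limit sits at \<open>- rho \<mu> \<theta>\<close>.\<close>

lemma rho_negative:
  assumes rd: "real_distribution \<mu>" and cpt: "compact (msupport \<mu>)" and \<theta>: "\<theta> < 0"
  defines "a \<equiv> Inf (msupport \<mu>)"
  shows "- a \<le> - rho \<mu> \<theta>" "\<And>s. - a < s \<Longrightarrow> s < - rho \<mu> \<theta> \<Longrightarrow> 1 / (\<integral>x. 1 / (s - (- x)) \<partial>\<mu>) < - \<theta>"
    "\<And>s. - a < s \<Longrightarrow> - rho \<mu> \<theta> < s \<Longrightarrow> - \<theta> < 1 / (\<integral>x. 1 / (s - (- x)) \<partial>\<mu>)"
proof -
  interpret real_distribution \<mu> by fact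
  define b where "b = Sup (msupport \<mu>)"
  define \<Gamma> where "\<Gamma> s = (\<integral>x. 1 / (s - (- x)) \<partial>\<mu>)" for s
  define Ll where "Ll = (SUP s\<in>{- a<..}. ereal (\<Gamma> s))"
  have AE: "AE x in \<mu>. - b \<le> - x \<and> - x \<le> - a"
    using AE_msupport_bounds(3)[OF rd cpt] by eventually_elim (auto simp: a_def b_def)
  have m: "uminus \<in> borel_measurable \<mu>" by measurable
  note u = resolvent_integral[OF prob_space_axioms m AE, folded \<Gamma>_def]
  note e = stieltjes_edges[OF rd cpt, folded a_def \<Gamma>_def, folded Ll_def]
  have \<theta>': "0 < - \<theta>" using \<theta> by simp
  have br1: "\<exists>\<rho>>- a. \<Gamma> \<rho> = 1 / (- \<theta>) \<and> (\<forall>s>- a. (s < \<rho> \<longrightarrow> 1 / (- \<theta>) < \<Gamma> s) \<and> (\<rho> < s \<longrightarrow> \<Gamma> s < 1 / (- \<theta>)))"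
    if "ereal (1 / (- \<theta>)) < Ll"
    by (rule decreasing_branch(3)[OF u(1,2,3,4) \<theta>' that[unfolded Ll_def]])
  have br2: "\<Gamma> s < 1 / (- \<theta>)" if "\<not> ereal (1 / (- \<theta>)) < Ll" "- a < s" for s
    by (rule decreasing_branch(4)[OF u(1,2,3,4) \<theta>' that(1)[unfolded Ll_def] that(2)])
  have low: "\<theta> < theta_low \<mu> \<longleftrightarrow> ereal (1 / (- \<theta>)) < Ll"
    unfolding e(4) using theta_threshold(2)[OF e(2) \<theta>'] by linarith
  have up: "\<not> theta_up \<mu> < \<theta>" using theta_threshold(1)[OF e(1)] \<theta> unfolding e(3) by linarith
  have inv: "1 / \<Gamma> s < - \<theta> \<longleftrightarrow> 1 / (- \<theta>) < \<Gamma> s" "- \<theta> < 1 / \<Gamma> s \<longleftrightarrow> \<Gamma> s < 1 / (- \<theta>)" if "- a < s" for s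
  proof -
    have "1 / x < t \<longleftrightarrow> 1 / t < x" "t < 1 / x \<longleftrightarrow> x < 1 / t" if "0 < x" "0 < t" for x t :: real
      using that by (auto simp: field_simps)
    then show "1 / \<Gamma> s < - \<theta> \<longleftrightarrow> 1 / (- \<theta>) < \<Gamma> s" "- \<theta> < 1 / \<Gamma> s \<longleftrightarrow> \<Gamma> s < 1 / (- \<theta>)"
      using u(1)[OF that] \<theta>' by blast+
  qed
  have st: "stieltjes \<mu> z = - \<Gamma> (- z)" for z
  proof -
    have "1 / (z - x) = - (1 / (- z - (- x)))" for x :: real by (simp add: minus_divide_right)
    then show ?thesis unfolding stieltjes_def \<Gamma>_def by simp
  qed
  have main: "- a \<le> - rho \<mu> \<theta> \<and> (\<forall>s>- a. (s < - rho \<mu> \<theta> \<longrightarrow> 1 / \<Gamma> s < - \<theta>) \<and> (- rho \<mu> \<theta> < s \<longrightarrow> - \<theta> < 1 / \<Gamma> s))"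
  proof (cases "\<theta> < theta_low \<mu>")
    case True
    then obtain \<rho> where \<rho>: "- a < \<rho>" "\<Gamma> \<rho> = 1 / (- \<theta>)"
      "\<And>s. - a < s \<Longrightarrow> (s < \<rho> \<longrightarrow> 1 / (- \<theta>) < \<Gamma> s) \<and> (\<rho> < s \<longrightarrow> \<Gamma> s < 1 / (- \<theta>))"
      using br1 low by blast
    have "rho \<mu> \<theta> = (THE z. z < a \<and> stieltjes \<mu> z = 1 / \<theta>)" using True up by (simp add: rho_def Let_def a_def)
    also have "\<dots> = - \<rho>"
    proof (rule the_equality)
      fix z assume "z < a \<and> stieltjes \<mu> z = 1 / \<theta>"
      then have z: "- a < - z" "\<Gamma> (- z) = 1 / (- \<theta>)" by (auto simp: st)
      then have "- z = \<rho>" using \<rho>(3)[of "- z"] by (cases "- z" \<rho> rule: linorder_cases) auto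
      then show "z = - \<rho>" by simp
    qed (use \<rho>(1,2) in \<open>simp add: st\<close>)
    finally show ?thesis using \<rho> inv by auto
  next
    case False
    then have "rho \<mu> \<theta> = a" using up \<theta> by (simp add: rho_def Let_def a_def)
    then show ?thesis using br2 False low inv by auto
  qed
  show "- a \<le> - rho \<mu> \<theta>" using main by blast
  show "1 / (\<integral>x. 1 / (s - (- x)) \<partial>\<mu>) < - \<theta>" if "- a < s" "s < - rho \<mu> \<theta>" for s
    using main that unfolding \<Gamma>_def by blast
  show "- \<theta> < 1 / (\<integral>x. 1 / (s - (- x)) \<partial>\<mu>)" if "- a < s" "- rho \<mu> \<theta> < s" for s
    using main that unfolding \<Gamma>_def by blast
qed

section \<open>Eigenvalue counts on both sides of a limit\<close>

lemma count_above_antimono: "s \<le> t \<Longrightarrow> count_above n lam t \<le> count_above n lam s"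
  unfolding count_above_def by (intro card_mono) auto

text \<open>Gram matrices are known to converge at rational points only; since counts are monotone
  in t, a rational s between t and the limit suffices. Below the edge \<beta> the Gram matrix gives
  no information, and the bulk of A supplies the eigenvalues.\<close>

lemma eventually_count_near_outlier:
  assumes es: "\<And>n. eigensystem n (A n) (P n) (lam n)" and es': "\<And>n. eigensystem n (A' n) (P' n) (lam' n)"
    and R: "finite R"
    and A': "\<And>n i j. i < n \<Longrightarrow> j < n \<Longrightarrow> A' n i j = A n i j + (\<Sum>l\<in>R. of_real (\<theta> l) * u n l i * cnj (u n l j))"
    and top: "\<And>t. \<beta> < t \<Longrightarrow> eventually (\<lambda>n. \<forall>k<n. lam n k < t) sequentially"
    and bulk: "\<And>t N. t < \<beta> \<Longrightarrow> eventually (\<lambda>n. N \<le> count_above n (lam n) t) sequentially"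
    and \<Gamma>: "\<And>t. \<beta> < t \<Longrightarrow> 0 < \<Gamma> t"
    and K: "\<And>t l m. t \<in> \<rat> \<Longrightarrow> \<beta> < t \<Longrightarrow> l \<in> R \<Longrightarrow> m \<in> R \<Longrightarrow>
      (\<lambda>n. resolvent_gram n (P n) (\<lambda>k. 1 / (t - lam n k)) (u n) l m) \<longlonglongrightarrow> of_real (if l = m then \<Gamma> t else 0)"
    and \<rho>: "\<beta> \<le> \<rho>" and above: "\<And>t. \<rho> < t \<Longrightarrow> card {l \<in> R. 1 / \<Gamma> t \<le> \<theta> l} \<le> q"
    and below: "\<And>t. \<beta> < t \<Longrightarrow> t < \<rho> \<Longrightarrow> Suc q \<le> card {l \<in> R. 1 / \<Gamma> t < \<theta> l}"
  shows "\<rho> < t \<Longrightarrow> eventually (\<lambda>n. count_above n (lam' n) t \<le> q) sequentially"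
    "t < \<rho> \<Longrightarrow> eventually (\<lambda>n. Suc q \<le> count_above n (lam' n) t) sequentially"
proof -
  have ev: "eventually (\<lambda>n. card {l \<in> R. 1 / \<Gamma> t < \<theta> l} \<le> count_above n (lam' n) t \<and>
    count_above n (lam' n) t \<le> card {l \<in> R. 1 / \<Gamma> t \<le> \<theta> l}) sequentially" if "t \<in> \<rat>" "\<beta> < t" for t
    by (rule eventually_count_outliers[OF es es' R A' top[OF that(2)] \<Gamma>[OF that(2)] K[OF that]])
  show "eventually (\<lambda>n. count_above n (lam' n) t \<le> q) sequentially" if t: "\<rho> < t"
  proof -
    obtain s where s: "s \<in> \<rat>" "\<rho> < s" "s < t" using Rats_dense_in_real[OF t] by blast
    have "\<beta> < s" using s(2) \<rho> by simp
    from ev[OF s(1) this] show ?thesis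
    proof eventually_elim
      case (elim n)
      then show ?case using above[OF s(2)] count_above_antimono[of s t n "lam' n"] s(3) by linarith
    qed
  qed
  show "eventually (\<lambda>n. Suc q \<le> count_above n (lam' n) t) sequentially" if t: "t < \<rho>"
  proof (cases "t < \<beta>")
    case True
    \<comment> \<open>The extra \<open>card R\<close> compensates for the most by which the
      perturbation can lower the count.\<close>
    from bulk[OF True, of "Suc q + card R"] show ?thesis
    proof eventually_elim
      case (elim n)
      then show ?case using count_above_rank_perturbation[OF es es' R A', of n t] by linarith
    qed
  next
    case False
    then have "max t \<beta> < \<rho>" using t by simp
    then obtain s where s: "s \<in> \<rat>" "max t \<beta> < s" "s < \<rho>" using Rats_dense_in_real by blast
    then have s': "\<beta> < s" "t \<le> s" by auto
    from ev[OF s(1) s'(1)] show ?thesis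
    proof eventually_elim
      case (elim n)
      then show ?case using below[OF s'(1) s(3)] count_above_antimono[OF s'(2), of n "lam' n"] by linarith
    qed
  qed
qed

lemma nth_tendsto_of_counts:
  fixes xs :: "nat \<Rightarrow> real list"
  assumes xs: "\<And>n. sorted (xs n)" "\<And>n. length (xs n) = n"
  shows "(\<And>t. \<rho> < t \<Longrightarrow> eventually (\<lambda>n. count_above n (\<lambda>k. xs n ! k) t \<le> q) sequentially) \<Longrightarrow>
      (\<And>t. t < \<rho> \<Longrightarrow> eventually (\<lambda>n. Suc q \<le> count_above n (\<lambda>k. xs n ! k) t) sequentially) \<Longrightarrow>
      (\<lambda>n. xs n ! (n - 1 - q)) \<longlonglongrightarrow> \<rho>"
    "(\<And>t. - \<rho> < t \<Longrightarrow> eventually (\<lambda>n. count_above n (\<lambda>k. - xs n ! k) t \<le> q) sequentially) \<Longrightarrow>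
      (\<And>t. t < - \<rho> \<Longrightarrow> eventually (\<lambda>n. Suc q \<le> count_above n (\<lambda>k. - xs n ! k) t) sequentially) \<Longrightarrow>
      (\<lambda>n. xs n ! q) \<longlonglongrightarrow> \<rho>"
proof -
  note c = count_above_sorted[OF xs]
  have big: "eventually (\<lambda>n. q < n) sequentially" by (rule eventually_gt_at_top)
  show "(\<lambda>n. xs n ! (n - 1 - q)) \<longlonglongrightarrow> \<rho>"
    if "\<And>t. \<rho> < t \<Longrightarrow> eventually (\<lambda>n. count_above n (\<lambda>k. xs n ! k) t \<le> q) sequentially"
      "\<And>t. t < \<rho> \<Longrightarrow> eventually (\<lambda>n. Suc q \<le> count_above n (\<lambda>k. xs n ! k) t) sequentially"
  proof (rule order_tendstoI)
    fix l assume "l < \<rho>"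
    from that(2)[OF this] big show "eventually (\<lambda>n. l < xs n ! (n - 1 - q)) sequentially"
      by eventually_elim (rule c(2))
  next
    fix l assume "\<rho> < l"
    then obtain t where t: "\<rho> < t" "t < l" using dense by blast
    from that(1)[OF t(1)] big show "eventually (\<lambda>n. xs n ! (n - 1 - q) < l) sequentially"
    proof eventually_elim
      case (elim n)
      then show ?case using c(1)[of q n t] t(2) by simp
    qed
  qed
  show "(\<lambda>n. xs n ! q) \<longlonglongrightarrow> \<rho>"
    if "\<And>t. - \<rho> < t \<Longrightarrow> eventually (\<lambda>n. count_above n (\<lambda>k. - xs n ! k) t \<le> q) sequentially"
      "\<And>t. t < - \<rho> \<Longrightarrow> eventually (\<lambda>n. Suc q \<le> count_above n (\<lambda>k. - xs n ! k) t) sequentially"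
  proof (rule order_tendstoI)
    fix l assume "l < \<rho>"
    then obtain t where t: "l < t" "t < \<rho>" using dense by blast
    then have "- \<rho> < - t" by simp
    from that(1)[OF this] big show "eventually (\<lambda>n. l < xs n ! q) sequentially"
    proof eventually_elim
      case (elim n)
      then show ?case using c(3)[of q n "- t"] t(1) by simp
    qed
  next
    fix l assume "\<rho> < l"
    then have "- l < - \<rho>" by simp
    from that(2)[OF this] big show "eventually (\<lambda>n. xs n ! q < l) sequentially"
    proof eventually_elim
      case (elim n)
      then show ?case using c(4)[of q n "- l"] by simp
    qed
  qed
qed

text \<open>The continuous function f vanishes where h is at most t, is at most 1, and is positive
  near the support point p, so its integral I is positive. The sum of f over the spectrum grows like
  \<open>I * n\<close> and is a lower bound for the count.\<close>

lemma eventually_count_bulk: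
  fixes h :: "real \<Rightarrow> real"
  assumes H1: "hypothesis_H1 X \<mu>" and len: "\<And>n. length (eigs_sorted (X n)) = n"
    and h: "\<And>x. isCont h x" and p: "p \<in> msupport \<mu>" "t < h p"
  shows "eventually (\<lambda>n. N \<le> count_above n (\<lambda>k. h (eigs_sorted (X n) ! k)) t) sequentially"
proof -
  interpret real_distribution \<mu> using H1 by (simp add: hypothesis_H1_def)
  define f where "f x = min 1 (max 0 (h x - t))" for x
  have f_cont: "isCont f x" for x unfolding f_def using h by (intro continuous_intros)
  have f01: "0 \<le> f x" "f x \<le> 1" for x by (auto simp: f_def)
  have f_meas[measurable]: "f \<in> borel_measurable borel"
    using f_cont by (intro borel_measurable_continuous_onI continuous_at_imp_continuous_on) auto
  define I where "I = (\<integral>x. f x \<partial>\<mu>)"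
  have lim: "(\<lambda>n. (\<Sum>k<n. f (eigs_sorted (X n) ! k)) / real n) \<longlonglongrightarrow> I"
    unfolding I_def using f_cont f01 by (intro spectral_average_tendsto[OF H1 len, of _ 1]) auto
  have I: "0 < I"
  proof -
    have fp: "0 < f p" using p(2) by (simp add: f_def)
    obtain e where e: "0 < e" "\<And>x. dist x p < e \<Longrightarrow> dist (f x) (f p) < f p / 2"
      using f_cont[of p] fp unfolding continuous_at_eps_delta by (metis half_gt_zero)
    have int_f: "integrable \<mu> f" using f01 by (intro integrable_const_bound[where B = 1]) auto
    have "0 < emeasure \<mu> (ball p e)" using p(1) e(1) by (simp add: msupport_def)
    then have "0 < measure \<mu> (ball p e)" by (simp add: emeasure_eq_measure)
    then have "0 < f p / 2 * measure \<mu> (ball p e)" using fp by simp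
    also have "\<dots> = (\<integral>x. f p / 2 * indicator (ball p e) x \<partial>\<mu>)" by simp
    also have "\<dots> \<le> I"
      unfolding I_def
    proof (rule integral_mono[OF _ int_f])
      show "integrable \<mu> (\<lambda>x. f p / 2 * indicator (ball p e) x)" by (simp add: emeasure_eq_measure)
      fix x
      show "f p / 2 * indicator (ball p e) x \<le> f x"
      proof (cases "x \<in> ball p e")
        case True
        then have "\<bar>f x - f p\<bar> < f p / 2" using e(2)[of x] by (simp add: dist_commute[of p x]) (simp add: dist_real_def)
        then have "f p / 2 \<le> f x" by argo
        then show ?thesis using True by simp
      qed (use f01 in simp)
    qed
    finally show ?thesis .
  qed
  have "filterlim (\<lambda>n. (\<Sum>k<n. f (eigs_sorted (X n) ! k)) / real n * real n) at_top sequentially"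
    by (rule filterlim_tendsto_pos_mult_at_top[OF lim I filterlim_real_sequentially])
  then have "eventually (\<lambda>n. real N \<le> (\<Sum>k<n. f (eigs_sorted (X n) ! k)) / real n * real n) sequentially"
    unfolding filterlim_at_top by blast
  then show ?thesis
  proof eventually_elim
    case (elim n)
    have "(\<Sum>k<n. f (eigs_sorted (X n) ! k)) \<le> (\<Sum>k<n. if t < h (eigs_sorted (X n) ! k) then 1 else 0)"
      by (intro sum_mono) (auto simp: f_def)
    also have "\<dots> = real (count_above n (\<lambda>k. h (eigs_sorted (X n) ! k)) t)"
      by (simp add: count_above_def sum.If_cases Int_def)
    finally have "(\<Sum>k<n. f (eigs_sorted (X n) ! k)) \<le> real (count_above n (\<lambda>k. h (eigs_sorted (X n) ! k)) t)" .
    then show ?case using elim by (cases "n = 0") auto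
  qed
qed

text \<open>The exceptional null set must not depend on t; this is why t runs over the countable set
  of rationals inside a single \<open>AE\<close>.\<close>

lemma (in iid_entries) AE_model_resolvent_gram:
  fixes h :: "real \<Rightarrow> real" and orth :: bool
  defines "v \<equiv> (\<lambda>n i \<omega>. vec n (\<lambda>k. x n i k \<omega> / complex_of_real (sqrt (real n))))"
  defines "u \<equiv> (\<lambda>n \<omega>. if orth then gram_schmidt_c r (\<lambda>i. v n i \<omega>) else (\<lambda>i. v n i \<omega>))"
  assumes H1: "hypothesis_H1 X \<mu>" and len: "\<And>n. length (eigs_sorted (X n)) = n"
    and P: "\<And>n. orthonormal n n (P n)"
    and h: "\<And>x. isCont h x" and h_le: "AE x in \<mu>. h x \<le> \<beta>"
    and top: "\<And>t. \<beta> < t \<Longrightarrow> eventually (\<lambda>n. \<forall>k<n. h (eigs_sorted (X n) ! k) < t) sequentially"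
  shows "AE \<omega> in M. \<forall>t\<in>\<rat>. \<beta> < t \<longrightarrow> (\<forall>i\<in>{1..r}. \<forall>j\<in>{1..r}.
    (\<lambda>n. resolvent_gram n (P n) (\<lambda>k. 1 / (t - h (eigs_sorted (X n) ! k))) (\<lambda>i. ($) (u n \<omega> i)) i j)
      \<longlonglongrightarrow> of_real (if i = j then \<integral>x. 1 / (t - h x) \<partial>\<mu> else 0))"
proof -
  interpret mu: real_distribution \<mu> using H1 by (simp add: hypothesis_H1_def)
  have h_meas[measurable]: "h \<in> borel_measurable borel"
    using h by (intro borel_measurable_continuous_onI continuous_at_imp_continuous_on) auto
  have v_cong: "resolvent_gram n (P n) g (\<lambda>i. ($) (v n i \<omega>)) i j = resolvent_gram n (P n) g (scaled n \<omega>) i j" for n g \<omega> i j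
    by (rule resolvent_gram_cong) (simp add: v_def scaled_def)
  have v_gram: "AE \<omega> in M. \<forall>i\<in>{1..r}. \<forall>j\<in>{1..r}.
      (\<lambda>n. resolvent_gram n (P n) (g n) (\<lambda>i. ($) (v n i \<omega>)) i j) \<longlonglongrightarrow> of_real (if i = j then G else 0)"
    if "\<And>n k. k < n \<Longrightarrow> \<bar>g n k\<bar> \<le> B" "(\<lambda>n. (\<Sum>k<n. g n k) / real n) \<longlonglongrightarrow> G" for g :: "nat \<Rightarrow> nat \<Rightarrow> real" and G B
    unfolding v_cong
    by (intro AE_finite_allI finite_atLeastAtMost AE_resolvent_gram_tendsto[OF P that(1) _ _ that(2)])
  \<comment> \<open>With g = 1 the Gram entries are the plain inner products, by Parseval; their
    convergence to those of an orthonormal system is the input for Gram--Schmidt.\<close>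
  have "(\<lambda>n. (\<Sum>k<n. 1) / real n) \<longlonglongrightarrow> 1"
    by (rule Lim_transform_eventually[OF tendsto_const]) (auto intro!: eventually_sequentiallyI[of 1])
  from v_gram[OF _ this, of 1]
  have one: "AE \<omega> in M. \<forall>i\<in>{1..r}. \<forall>j\<in>{1..r}.
      (\<lambda>n. resolvent_gram n (P n) (\<lambda>_. 1) (\<lambda>i. ($) (v n i \<omega>)) i j) \<longlonglongrightarrow> of_real (if i = j then 1 else 0)"
    by simp
  have "AE \<omega> in M. \<forall>t\<in>{t \<in> \<rat>. \<beta> < t}. \<forall>i\<in>{1..r}. \<forall>j\<in>{1..r}.
    (\<lambda>n. resolvent_gram n (P n) (\<lambda>k. 1 / (t - h (eigs_sorted (X n) ! k))) (\<lambda>i. ($) (u n \<omega> i)) i j)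
      \<longlonglongrightarrow> of_real (if i = j then \<integral>x. 1 / (t - h x) \<partial>\<mu> else 0)"
  proof (rule AE_ball_countable')
    fix t assume "t \<in> {t \<in> \<rat>. \<beta> < t}"
    then have t: "\<beta> < t" by simp
    define t' where "t' = (t + \<beta>) / 2"
    have t': "\<beta> < t'" "t' < t" using t by (auto simp: t'_def)
    define f where "f x = 1 / (t - min (h x) t')" for x
      \<comment> \<open>bounded and continuous, and equal to \<open>1 / (t - h x)\<close> on all but finitely many of the spectra\<close>
    have f_cont: "isCont f x" for x
      unfolding f_def using t' h by (intro continuous_intros) auto
    have f_bound: "\<bar>f x\<bar> \<le> 1 / (t - t')" for x
      unfolding f_def using t' by (auto intro!: frac_le)
    have f_int: "(\<integral>x. f x \<partial>\<mu>) = (\<integral>x. 1 / (t - h x) \<partial>\<mu>)"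
    proof (rule integral_cong_AE)
      show "AE x in \<mu>. f x = 1 / (t - h x)" using h_le by eventually_elim (use t' in \<open>auto simp: f_def min_def\<close>)
      show "f \<in> borel_measurable \<mu>" unfolding f_def by measurable
    qed measurable
    have "AE \<omega> in M. \<forall>i\<in>{1..r}. \<forall>j\<in>{1..r}.
      (\<lambda>n. resolvent_gram n (P n) (\<lambda>k. f (eigs_sorted (X n) ! k)) (\<lambda>i. ($) (v n i \<omega>)) i j)
        \<longlonglongrightarrow> of_real (if i = j then \<integral>x. 1 / (t - h x) \<partial>\<mu> else 0)"
      using f_bound spectral_average_tendsto[OF H1 len f_cont f_bound] unfolding f_int
      by (intro v_gram[of _ "1 / (t - t')"])
    with one show "AE \<omega> in M. \<forall>i\<in>{1..r}. \<forall>j\<in>{1..r}.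
      (\<lambda>n. resolvent_gram n (P n) (\<lambda>k. 1 / (t - h (eigs_sorted (X n) ! k))) (\<lambda>i. ($) (u n \<omega> i)) i j)
      \<longlonglongrightarrow> of_real (if i = j then \<integral>x. 1 / (t - h x) \<partial>\<mu> else 0)"
    proof eventually_elim
      case (elim \<omega>)
      have dim: "dim_vec (v n i \<omega>) = n" for n i by (simp add: v_def)
      have ip: "(\<lambda>n. ip n (($) (v n i \<omega>)) (($) (v n j \<omega>))) \<longlonglongrightarrow> of_bool (i = j)" if "i \<in> {1..r}" "j \<in> {1..r}" for i j
      proof -
        have "resolvent_gram n (P n) (\<lambda>_. 1) (\<lambda>i. ($) (v n i \<omega>)) i j = ip n (($) (v n i \<omega>)) (($) (v n j \<omega>))" for n
          unfolding resolvent_gram_def by (subst orthonormal_parseval[OF P]) simp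
        with bspec[OF bspec[OF elim(1) that(1)] that(2)] show ?thesis by (cases "i = j") simp_all
      qed
      show ?case
      proof (intro ballI)
        fix i j assume i: "i \<in> {1..r}" and j: "j \<in> {1..r}"
        have "(\<lambda>n. resolvent_gram n (P n) (\<lambda>k. f (eigs_sorted (X n) ! k)) (\<lambda>i. ($) (u n \<omega> i)) i j)
            \<longlonglongrightarrow> of_real (if i = j then \<integral>x. 1 / (t - h x) \<partial>\<mu> else 0)"
        proof (cases orth)
          case True
          have gr: "(\<lambda>n. resolvent_gram n (P n) (\<lambda>k. f (eigs_sorted (X n) ! k)) (\<lambda>i. ($) (v n i \<omega>)) i j)
            \<longlonglongrightarrow> of_real (if i = j then \<integral>x. 1 / (t - h x) \<partial>\<mu> else 0)" if "i \<in> {1..r}" "j \<in> {1..r}" for i j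
            using elim(2) that by blast
          show ?thesis
            using gram_schmidt_c_resolvent_gram_tendsto[of "\<lambda>n i. v n i \<omega>", OF dim ip gr i j] True by (simp add: u_def)
        next
          case False
          then show ?thesis using elim(2) i j by (simp add: u_def)
        qed
        \<comment> \<open>Once h maps the whole spectrum below t', the truncation in f is
          inactive.\<close>
        moreover have "eventually (\<lambda>n. resolvent_gram n (P n) (\<lambda>k. f (eigs_sorted (X n) ! k)) (\<lambda>i. ($) (u n \<omega> i)) i j
            = resolvent_gram n (P n) (\<lambda>k. 1 / (t - h (eigs_sorted (X n) ! k))) (\<lambda>i. ($) (u n \<omega> i)) i j) sequentially"
          using top[OF t'(1)]
        proof eventually_elim
          case (elim n)
          then show ?case unfolding resolvent_gram_def by (intro sum.cong refl) (auto simp: f_def min_absorb1 less_imp_le)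
        qed
        ultimately show "(\<lambda>n. resolvent_gram n (P n) (\<lambda>k. 1 / (t - h (eigs_sorted (X n) ! k))) (\<lambda>i. ($) (u n \<omega> i)) i j)
            \<longlonglongrightarrow> of_real (if i = j then \<integral>x. 1 / (t - h x) \<partial>\<mu> else 0)"
          by (rule Lim_transform_eventually)
      qed
    qed
  qed (rule countable_subset[OF _ countable_rat], auto)
  then show ?thesis by eventually_elim auto
qed

theorem theorem1p1:
  fixes M :: "'w measure"
    and X :: "nat \<Rightarrow> complex mat"
    and \<mu>X :: "real measure"
    and \<nu> :: "complex measure"
    and r r0 :: nat
    and \<theta> :: "nat \<Rightarrow> real"
    and x :: "nat \<Rightarrow> nat \<Rightarrow> nat \<Rightarrow> 'w \<Rightarrow> complex"
    and orth :: bool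
  defines "a \<equiv> Inf (msupport \<mu>X)"
    and "b \<equiv> Sup (msupport \<mu>X)"
    and "v \<equiv> (\<lambda>n i \<omega>. vec n (\<lambda>k. x n i k \<omega> / complex_of_real (sqrt (real n))))"
  defines "u \<equiv> (\<lambda>n \<omega>. if orth then gram_schmidt_c r (\<lambda>i. v n i \<omega>) else (\<lambda>i. v n i \<omega>))"
  defines "Xt \<equiv> (\<lambda>n \<omega>. perturbed (X n) r \<theta> (u n \<omega>))"
  assumes X_dim: "\<And>n. X n \<in> carrier_mat n n"
    and X_herm: "\<And>n. hermitian_mat (X n)"
    and H1: "hypothesis_H1 X \<mu>X"
    and A1: "assumption_A1 \<nu>"
    and r_pos: "r \<ge> 1"
    and \<theta>_nz: "\<And>i. i \<in> {1..r} \<Longrightarrow> \<theta> i \<noteq> 0"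
    and \<theta>_sorted: "\<And>i j. i \<in> {1..r} \<Longrightarrow> j \<in> {1..r} \<Longrightarrow> i \<le> j \<Longrightarrow> \<theta> i \<le> \<theta> j"
    and r0_le: "r0 \<le> r"
    and r0_sign: "\<And>i. i \<in> {1..r} \<Longrightarrow> (i \<le> r0 \<longleftrightarrow> \<theta> i < 0)"
    and M_prob: "prob_space M"
    and x_meas: "\<And>n i k. x n i k \<in> borel_measurable M"
    and x_law: "\<And>n i k. i \<in> {1..r} \<Longrightarrow> k < n \<Longrightarrow> distr M borel (x n i k) = \<nu>"
    and x_indep: "\<And>n. prob_space.indep_vars M (\<lambda>_. borel) (\<lambda>(i, k). x n i k) ({1..r} \<times> {..<n})"
  shows "(\<forall>i\<in>{1..r0}. AE \<omega> in M. (\<lambda>n. eig (Xt n \<omega>) i) \<longlonglongrightarrow> rho \<mu>X (\<theta> i))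
       \<and> (\<forall>i\<in>{r0+1..r}. AE \<omega> in M. (\<lambda>n. eig (Xt n \<omega>) (n - r + i)) \<longlonglongrightarrow> rho \<mu>X (\<theta> i))
       \<and> (\<forall>i::nat. i > r0 \<longrightarrow> (AE \<omega> in M. (\<lambda>n. eig (Xt n \<omega>) i) \<longlonglongrightarrow> a))
       \<and> (\<forall>i::nat. i \<ge> r - r0 \<longrightarrow> (AE \<omega> in M. (\<lambda>n. eig (Xt n \<omega>) (n - i)) \<longlonglongrightarrow> b))"
proof -
  interpret iid_entries M x r \<nu>
    by (intro iid_entries.intro iid_entries_axioms.intro M_prob A1 x_meas x_law x_indep)
  have rd: "real_distribution \<mu>X" and cpt: "compact (msupport \<mu>X)"
    and low: "(\<lambda>n. eig (X n) 1) \<longlonglongrightarrow> a" and high: "(\<lambda>n. eig (X n) n) \<longlonglongrightarrow> b"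
    using H1 by (auto simp: hypothesis_H1_def a_def b_def)
  interpret mu: real_distribution \<mu>X by (rule rd)
  note supp = AE_msupport_bounds[OF rd cpt, folded a_def b_def]
  define e where "e n k = eigs_sorted (X n) ! k" for n k
  have len: "length (eigs_sorted (X n)) = n" for n
    by (rule hermitian_sorted_eigensystem(1)[OF X_dim X_herm])
  have "\<forall>n. \<exists>P. eigensystem n (\<lambda>i j. X n $$ (i, j)) P (e n)"
    using hermitian_sorted_eigensystem(2)[OF X_dim X_herm] unfolding e_def by blast
  then obtain P where es: "\<And>n. eigensystem n (\<lambda>i j. X n $$ (i, j)) (P n) (e n)" by metis
  have P: "orthonormal n n (P n)" for n using es[of n] by (simp add: eigensystem_def)
  have e_mono: "e n i \<le> e n j" if "i \<le> j" "j < n" for n i j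
    using that len[of n] unfolding e_def by (intro sorted_nth_mono) (auto simp: eigs_sorted_def)
  have top_b: "eventually (\<lambda>n. \<forall>k<n. e n k < t) sequentially" if "b < t" for t
    using order_tendstoD(2)[OF high that]
  proof eventually_elim
    case (elim n)
    show ?case
    proof (intro allI impI)
      fix k assume "k < n"
      then have "e n k \<le> e n (n - 1)" by (intro e_mono) auto
      then show "e n k < t" using elim by (simp add: eig_def e_def)
    qed
  qed
  have top_a: "eventually (\<lambda>n. \<forall>k<n. - e n k < t) sequentially" if "- a < t" for t
  proof -
    have "- t < a" using that by simp
    from order_tendstoD(1)[OF low this] show ?thesis
    proof eventually_elim
      case (elim n)
      show ?case
      proof (intro allI impI)
        fix k assume "k < n"
        then have "e n 0 \<le> e n k" by (intro e_mono) auto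
        then show "- e n k < t" using elim by (simp add: eig_def e_def)
      qed
    qed
  qed
  have bulk_b: "eventually (\<lambda>n. N \<le> count_above n (e n) t) sequentially" if "t < b" for t N
    using eventually_count_bulk[OF H1 len, of "\<lambda>x. x" b t N] supp(2) that by (simp add: e_def[abs_def])
  have bulk_a: "eventually (\<lambda>n. N \<le> count_above n (\<lambda>k. - e n k) t) sequentially" if "t < - a" for t N
    using eventually_count_bulk[OF H1 len, of uminus a t N] supp(1) that by (simp add: e_def[abs_def])
  have dims: "dim_row (X n) = n" "dim_col (X n) = n" for n using carrier_matD[OF X_dim] by blast+
  have Xt_dim: "Xt n \<omega> \<in> carrier_mat n n" for n \<omega>
    unfolding Xt_def perturbed_def dims by (rule mat_carrier)
  have Xt_entry: "Xt n \<omega> $$ (i, j) = X n $$ (i, j) + (\<Sum>l\<in>{1..r}. of_real (\<theta> l) * u n \<omega> l $ i * cnj (u n \<omega> l $ j))"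
    if "i < n" "j < n" for n \<omega> i j
    unfolding Xt_def perturbed_def dims using that by simp
  have Xt_herm: "hermitian_mat (Xt n \<omega>)" for n \<omega>
  proof -
    have sym: "Xt n \<omega> $$ (i, j) = cnj (Xt n \<omega> $$ (j, i))" if ij: "i < n" "j < n" for i j
    proof -
      have "X n $$ (i, j) = cnj (X n $$ (j, i))"
        using X_herm[of n] ij unfolding hermitian_mat_def dims by blast
      then show ?thesis unfolding Xt_entry[OF ij] Xt_entry[OF ij(2,1)]
        by (simp add: mult_ac)
    qed
    have "dim_row (Xt n \<omega>) = n" "dim_col (Xt n \<omega>) = n" using carrier_matD[OF Xt_dim] by blast+
    then show ?thesis unfolding hermitian_mat_def using sym by metis
  qed
  define f where "f \<omega> n = eigs_sorted (Xt n \<omega>)" for \<omega> n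
  have f_len: "length (f \<omega> n) = n" for \<omega> n
    unfolding f_def by (rule hermitian_sorted_eigensystem(1)[OF Xt_dim Xt_herm])
  have f_sorted: "sorted (f \<omega> n)" for \<omega> n by (simp add: f_def eigs_sorted_def)
  have "\<exists>Q. eigensystem n (\<lambda>i j. Xt n \<omega> $$ (i, j)) Q (\<lambda>k. f \<omega> n ! k)" for n \<omega>
    unfolding f_def by (rule hermitian_sorted_eigensystem(2)[OF Xt_dim Xt_herm])
  then obtain Q where es': "\<And>n \<omega>. eigensystem n (\<lambda>i j. Xt n \<omega> $$ (i, j)) (Q n \<omega>) (\<lambda>k. f \<omega> n ! k)" by metis
  define \<Gamma>b where "\<Gamma>b t = (\<integral>x. 1 / (t - x) \<partial>\<mu>X)" for t
  define \<Gamma>a where "\<Gamma>a t = (\<integral>x. 1 / (t - (- x)) \<partial>\<mu>X)" for t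
  have \<Gamma>b: "0 < \<Gamma>b t" if "b < t" for t
    unfolding \<Gamma>b_def by (rule resolvent_integral(1)[OF mu.prob_space_axioms _ supp(3) that]) simp
  have supp': "AE x in \<mu>X. - b \<le> - x \<and> - x \<le> - a" using supp(3) by eventually_elim auto
  have \<Gamma>a: "0 < \<Gamma>a t" if "- a < t" for t
    unfolding \<Gamma>a_def by (rule resolvent_integral(1)[OF mu.prob_space_axioms _ supp' that]) simp
  have Kb: "AE \<omega> in M. \<forall>t\<in>\<rat>. b < t \<longrightarrow> (\<forall>i\<in>{1..r}. \<forall>j\<in>{1..r}.
    (\<lambda>n. resolvent_gram n (P n) (\<lambda>k. 1 / (t - e n k)) (\<lambda>i. ($) (u n \<omega> i)) i j) \<longlonglongrightarrow> of_real (if i = j then \<Gamma>b t else 0))"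
    unfolding e_def \<Gamma>b_def u_def v_def
    by (rule AE_model_resolvent_gram[OF H1 len P, of "\<lambda>x. x"]) (use supp(3) top_b in \<open>auto simp: e_def\<close>)
  have Ka: "AE \<omega> in M. \<forall>t\<in>\<rat>. - a < t \<longrightarrow> (\<forall>i\<in>{1..r}. \<forall>j\<in>{1..r}.
    (\<lambda>n. resolvent_gram n (P n) (\<lambda>k. 1 / (t - (- e n k))) (\<lambda>i. ($) (u n \<omega> i)) i j) \<longlonglongrightarrow> of_real (if i = j then \<Gamma>a t else 0))"
    unfolding e_def \<Gamma>a_def u_def v_def
    by (rule AE_model_resolvent_gram[OF H1 len P, of uminus]) (use supp' top_a in \<open>auto simp: e_def\<close>)
  \<comment> \<open>Covers outliers and eigenvalues that stay at the edge together: for \<rho> = b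
    the last premise is vacuous.\<close>
  have upper: "AE \<omega> in M. (\<lambda>n. f \<omega> n ! (n - 1 - q)) \<longlonglongrightarrow> \<rho>"
    if "b \<le> \<rho>" "\<And>t. \<rho> < t \<Longrightarrow> card {l \<in> {1..r}. 1 / \<Gamma>b t \<le> \<theta> l} \<le> q"
      "\<And>t. b < t \<Longrightarrow> t < \<rho> \<Longrightarrow> Suc q \<le> card {l \<in> {1..r}. 1 / \<Gamma>b t < \<theta> l}" for q \<rho>
    using Kb
  proof eventually_elim
    case (elim \<omega>)
    note c = eventually_count_near_outlier[where u = "\<lambda>n l. ($) (u n \<omega> l)" and \<Gamma> = \<Gamma>b,
        OF es es' finite_atLeastAtMost Xt_entry top_b bulk_b \<Gamma>b elim[rule_format] that]
    show ?case by (rule nth_tendsto_of_counts(1)[OF f_sorted f_len c])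
  qed
  \<comment> \<open>Negating X and all \<theta> l turns the smallest eigenvalues into the largest,
    with edge - a, so the same counting lemma applies.\<close>
  have lower: "AE \<omega> in M. (\<lambda>n. f \<omega> n ! q) \<longlonglongrightarrow> \<rho>"
    if "- a \<le> - \<rho>" "\<And>t. - \<rho> < t \<Longrightarrow> card {l \<in> {1..r}. 1 / \<Gamma>a t \<le> - \<theta> l} \<le> q"
      "\<And>t. - a < t \<Longrightarrow> t < - \<rho> \<Longrightarrow> Suc q \<le> card {l \<in> {1..r}. 1 / \<Gamma>a t < - \<theta> l}" for q \<rho>
    using Ka
  proof eventually_elim
    case (elim \<omega>)
    have entry: "- Xt n \<omega> $$ (i, j) = - X n $$ (i, j) + (\<Sum>l\<in>{1..r}. of_real (- \<theta> l) * u n \<omega> l $ i * cnj (u n \<omega> l $ j))"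
      if "i < n" "j < n" for n i j
      unfolding Xt_entry[OF that] by (simp add: sum_negf)
    note c = eventually_count_near_outlier[where u = "\<lambda>n l. ($) (u n \<omega> l)" and \<Gamma> = \<Gamma>a,
        OF eigensystem_uminus[OF es] eigensystem_uminus[OF es'] finite_atLeastAtMost entry top_a bulk_a \<Gamma>a elim[rule_format] that]
    show ?case by (rule nth_tendsto_of_counts(2)[OF f_sorted f_len c])
  qed
  have \<theta>_less: "i < l" if "i \<in> {1..r}" "l \<in> {1..r}" "\<theta> i < \<theta> l" for i l
    using \<theta>_sorted[OF that(2,1)] that(3) by linarith
  have card_le: "card {l \<in> {1..r}. p l} \<le> card B" if "\<And>l. l \<in> {1..r} \<Longrightarrow> p l \<Longrightarrow> l \<in> B" "finite B" for p and B :: "nat set"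
    using that by (intro card_mono) auto
  have le_card: "card B \<le> card {l \<in> {1..r}. p l}" if "\<And>l. l \<in> B \<Longrightarrow> l \<in> {1..r} \<and> p l" for p and B :: "nat set"
    using that by (intro card_mono) auto
  \<comment> \<open>Subtraction on \<open>nat\<close> is truncated, so the index identity is
    demanded only from N on; \<open>n - r + i\<close> is the intended index once n is at least
    r.\<close>
  have shift: "(\<lambda>n. eig (Xt n \<omega>) (g n)) \<longlonglongrightarrow> \<rho>"
    if "(\<lambda>n. f \<omega> n ! (n - 1 - q)) \<longlonglongrightarrow> \<rho>" "\<And>n. N \<le> n \<Longrightarrow> g n - 1 = n - 1 - q" for \<omega> q \<rho> N g
    by (rule Lim_transform_eventually[OF that(1)])
      (use that(2) in \<open>auto simp: eig_def f_def intro!: eventually_sequentiallyI[of N]\<close>)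
  have part1: "AE \<omega> in M. (\<lambda>n. eig (Xt n \<omega>) i) \<longlonglongrightarrow> rho \<mu>X (\<theta> i)" if i: "i \<in> {1..r0}" for i
  proof -
    have i': "i \<in> {1..r}" using i r0_le by simp
    have neg: "\<theta> i < 0" using r0_sign[OF i'] i by simp
    note rho = rho_negative[OF rd cpt neg, folded a_def, folded \<Gamma>a_def]
    have "AE \<omega> in M. (\<lambda>n. f \<omega> n ! (i - 1)) \<longlonglongrightarrow> rho \<mu>X (\<theta> i)"
    proof (rule lower)
      show "- a \<le> - rho \<mu>X (\<theta> i)" by (rule rho(1))
      fix t assume t: "- rho \<mu>X (\<theta> i) < t"
      have "- \<theta> i < 1 / \<Gamma>a t" using rho(1,3) t by simp
      \<comment> \<open>Members of this set satisfy \<open>\<theta> l < \<theta> i\<close> strictly,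
        hence l < i; in the other direction every l up to i lies in the strict set. Equal values
        therefore do not disturb the count.\<close>
      then have "card {l \<in> {1..r}. 1 / \<Gamma>a t \<le> - \<theta> l} \<le> card {1..<i}"
        using \<theta>_less[OF _ i'] by (intro card_le) auto
      then show "card {l \<in> {1..r}. 1 / \<Gamma>a t \<le> - \<theta> l} \<le> i - 1" by simp
    next
      fix t assume "- a < t" "t < - rho \<mu>X (\<theta> i)"
      from rho(2)[OF this] have "card {1..i} \<le> card {l \<in> {1..r}. 1 / \<Gamma>a t < - \<theta> l}"
        using \<theta>_sorted[OF _ i'] i' by (intro le_card) force
      then show "Suc (i - 1) \<le> card {l \<in> {1..r}. 1 / \<Gamma>a t < - \<theta> l}" using i by simp
    qed
    then show ?thesis by (simp add: eig_def f_def)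
  qed
  have part2: "AE \<omega> in M. (\<lambda>n. eig (Xt n \<omega>) (n - r + i)) \<longlonglongrightarrow> rho \<mu>X (\<theta> i)" if i: "i \<in> {r0 + 1..r}" for i
  proof -
    have i': "i \<in> {1..r}" using i by simp
    have pos: "0 < \<theta> i" using r0_sign[OF i'] \<theta>_nz[OF i'] i by auto
    note rho = rho_positive[OF rd cpt pos, folded b_def, folded \<Gamma>b_def]
    have "AE \<omega> in M. (\<lambda>n. f \<omega> n ! (n - 1 - (r - i))) \<longlonglongrightarrow> rho \<mu>X (\<theta> i)"
    proof (rule upper)
      show "b \<le> rho \<mu>X (\<theta> i)" by (rule rho(1))
      fix t assume t: "rho \<mu>X (\<theta> i) < t"
      have "\<theta> i < 1 / \<Gamma>b t" using rho(1,3) t by simp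
      then have "card {l \<in> {1..r}. 1 / \<Gamma>b t \<le> \<theta> l} \<le> card {i<..r}"
        using \<theta>_less[OF i'] by (intro card_le) auto
      then show "card {l \<in> {1..r}. 1 / \<Gamma>b t \<le> \<theta> l} \<le> r - i" by simp
    next
      fix t assume "b < t" "t < rho \<mu>X (\<theta> i)"
      from rho(2)[OF this] have "card {i..r} \<le> card {l \<in> {1..r}. 1 / \<Gamma>b t < \<theta> l}"
        using \<theta>_sorted[OF i'] i' by (intro le_card) force
      then show "Suc (r - i) \<le> card {l \<in> {1..r}. 1 / \<Gamma>b t < \<theta> l}" using i by (simp add: Suc_diff_le)
    qed
    then show ?thesis
      by eventually_elim (rule shift[of _ "r - i" _ r], use i in auto)
  qed
  have part3: "AE \<omega> in M. (\<lambda>n. eig (Xt n \<omega>) i) \<longlonglongrightarrow> a" if i: "r0 < i" for i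
  proof -
    have "AE \<omega> in M. (\<lambda>n. f \<omega> n ! (i - 1)) \<longlonglongrightarrow> a"
    proof (rule lower)
      fix t assume "- a < t"
      then have G: "0 < 1 / \<Gamma>a t" using \<Gamma>a by simp
      \<comment> \<open>The threshold is positive, so only the r0 negative \<theta> l can reach it,
        and r0 is at most i - 1.\<close>
      have "card {l \<in> {1..r}. 1 / \<Gamma>a t \<le> - \<theta> l} \<le> card {1..r0}"
      proof (rule card_le)
        fix l assume l: "l \<in> {1..r}" "1 / \<Gamma>a t \<le> - \<theta> l"
        then have "\<theta> l < 0" using G by linarith
        then show "l \<in> {1..r0}" using r0_sign[OF l(1)] l(1) by simp
      qed simp
      then show "card {l \<in> {1..r}. 1 / \<Gamma>a t \<le> - \<theta> l} \<le> i - 1" using i by simp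
    qed auto
    then show ?thesis by (simp add: eig_def f_def)
  qed
  have part4: "AE \<omega> in M. (\<lambda>n. eig (Xt n \<omega>) (n - i)) \<longlonglongrightarrow> b" if i: "r - r0 \<le> i" for i
  proof -
    \<comment> \<open>Here q = i, because eigenvalue number \<open>n - i\<close> has list index
      \<open>n - i - 1\<close>; at most \<open>r - r0\<close> of the \<theta> l, the positive ones,
      reach a positive threshold.\<close>
    have "AE \<omega> in M. (\<lambda>n. f \<omega> n ! (n - 1 - i)) \<longlonglongrightarrow> b"
    proof (rule upper)
      fix t assume "b < t"
      then have G: "0 < 1 / \<Gamma>b t" using \<Gamma>b by simp
      have "card {l \<in> {1..r}. 1 / \<Gamma>b t \<le> \<theta> l} \<le> card {r0<..r}"
      proof (rule card_le)
        fix l assume l: "l \<in> {1..r}" "1 / \<Gamma>b t \<le> \<theta> l"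
        then have "\<not> \<theta> l < 0" using G by linarith
        then show "l \<in> {r0<..r}" using r0_sign[OF l(1)] l(1) by simp
      qed simp
      then show "card {l \<in> {1..r}. 1 / \<Gamma>b t \<le> \<theta> l} \<le> i" using i by simp
    qed auto
    then show ?thesis
      by eventually_elim (rule shift[of _ i _ 0], auto)
  qed
  show ?thesis using part1 part2 part3 part4 by blast
qed

end
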